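(* There is at most one reflectionless potential $q\in\mathcal{Q}_1$ for which the Schr\"odinger operator $T_q$ has prescribed spectral data $(\boldsymbol{\varkappa},\mathbf{m})$. That is, if $q,\tilde q\in\mathcal{Q}_1$ are reflectionless, the operators $T_q$ and $T_{\tilde q}$ have the same negative eigenvalues $-\varkappa_1^2<-\varkappa_2^2<\dots$ and, for each of these eigenvalues $-\varkappa_n^2$, the same (right) norming constant $m_n$, then $q=\tilde q$.
   Context: $\mathcal{Q}_1$ is the set of all real-valued functions in $L_1(\mathbb{R})$. For $q\in\mathcal{Q}_1$, $T_q=-\frac{d^2}{dx^2}+q$ is the corresponding self-adjoint Schr\"odinger operator in $L_2(\mathbb{R})$; its negative spectrum consists of at most countably many simple eigenvalues $-\varkappa_1^2<-\varkappa_2^2<\dots$ (with $\varkappa_1>\varkappa_2>\dots>0$), and $\sum_j\varkappa_j<\infty$. Jost solutions: for $\lambda\ne0$ with $\operatorname{Im}\lambda\ge0$, the right Jost solution $e_+(\cdot,\lambda;q)$ is the unique solution of $-y''+qy=\lambda^2y$ with $\lim_{x\to+\infty}e^{-i\lambda x}e_+(x,\lambda;q)=1$; for $\lambda\neq0$ with $\operatorname{Im}\lambda\le0$, the left Jost solution $e_-(\cdot,\lambda;q)$ is the unique solution of the same equation with $\lim_{x\to-\infty}e^{-i\lambda x}e_-(x,\lambda;q)=1$. Reflectionless potentials: for real $k\ne0$ there are unique $a(k),b(k)$ with $e_+(x,k;q)=a(k)e_-(x,k;q)+b(k)e_-(x,-k;q)$, and $|a(k)|^2=1+|b(k)|^2$;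 the reflection coefficients are $r_-(k)=b(k)/a(k)$ and $r_+(k)=-b(-k)/a(k)$. A potential $q\in\mathcal{Q}_1$ is called reflectionless if its reflection coefficients vanish identically on $\mathbb{R}\setminus\{0\}$. Norming constants: if $-\varkappa^2$ ($\varkappa>0$) is an eigenvalue of $T_q$, then $e_+(\cdot,i\varkappa;q)\in L_2(\mathbb{R})$ is an eigenfunction and the (right) norming constant $m>0$ is defined by $m^{-2}=\int_{\mathbb{R}}|e_+(x,i\varkappa;q)|^2\,dx$. The spectral data of $T_q$ are the pair $(\boldsymbol{\varkappa},\mathbf{m})$ with $\boldsymbol{\varkappa}=(\varkappa_n)$ and $\mathbf{m}=(m_n)$, $m_n$ being the right norming constant for $-\varkappa_n^2$. *)

theory Defs
  imports "HOL-Analysis.Analysis"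
begin

text \<open>Functions are pointwise representatives; two elements of \<open>Q1\<close> are the same potential iff
  they agree almost everywhere.\<close>

definition Q1 :: "(real \<Rightarrow> real) set" where
  "Q1 = {q. integrable lebesgue q}"

definition L2 :: "(real \<Rightarrow> complex) set" where
  "L2 = {y \<in> borel_measurable lebesgue. integrable lebesgue (\<lambda>x. (cmod (y x))\<^sup>2)}"

text \<open>\<open>f\<close> is locally absolutely continuous with almost-everywhere derivative \<open>g\<close>, in the sense
  that \<open>f\<close> is an indefinite Lebesgue integral of the locally integrable function \<open>g\<close>.\<close>

definition loc_abs_cont_deriv :: "(real \<Rightarrow> complex) \<Rightarrow> (real \<Rightarrow> complex) \<Rightarrow> bool" where
  "loc_abs_cont_deriv f g \<longleftrightarrow>
     (\<forall>a b. a \<le> b \<longrightarrow>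
        g absolutely_integrable_on {a..b} \<and> (g has_integral (f b - f a)) {a..b})"

text \<open>\<open>-y'' + q y = f\<close> almost everywhere, where \<open>y\<close> is differentiable and \<open>y'\<close> is locally
  absolutely continuous.\<close>

definition schroedinger_expr ::
    "(real \<Rightarrow> real) \<Rightarrow> (real \<Rightarrow> complex) \<Rightarrow> (real \<Rightarrow> complex) \<Rightarrow> bool" where
  "schroedinger_expr q y f \<longleftrightarrow>
     (\<exists>dy ddy. (\<forall>x. (y has_vector_derivative dy x) (at x)) \<and>
        loc_abs_cont_deriv dy ddy \<and>
        (AE x in lebesgue. - ddy x + complex_of_real (q x) * y x = f x))"

text \<open>The graph of \<open>T_q\<close>, i.e. \<open>y \<in> dom T_q\<close> and \<open>T_q y = f\<close>. This is the maximal operator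
  generated by the differential expression; it is self-adjoint because for \<open>q \<in> Q1\<close> the
  expression is in the limit point case at both ends.\<close>

definition schroedinger_op ::
    "(real \<Rightarrow> real) \<Rightarrow> (real \<Rightarrow> complex) \<Rightarrow> (real \<Rightarrow> complex) \<Rightarrow> bool" where
  "schroedinger_op q y f \<longleftrightarrow> y \<in> L2 \<and> f \<in> L2 \<and> schroedinger_expr q y f"

definition neg_eigenvalues :: "(real \<Rightarrow> real) \<Rightarrow> real set" where
  "neg_eigenvalues q =
     {\<mu>. \<mu> < 0 \<and> (\<exists>y. \<not> (AE x in lebesgue. y x = 0) \<and>
                     schroedinger_op q y (\<lambda>x. complex_of_real \<mu> * y x))}"

definition schroedinger_solution :: "(real \<Rightarrow> real) \<Rightarrow> complex \<Rightarrow> (real \<Rightarrow> complex) \<Rightarrow> bool" where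
  "schroedinger_solution q z y \<longleftrightarrow> schroedinger_expr q y (\<lambda>x. z\<^sup>2 * y x)"

text \<open>The spectral parameter is \<open>z\<^sup>2\<close>. Meaningful for \<open>q \<in> Q1\<close>, \<open>z \<noteq> 0\<close>, and \<open>Im z \<ge> 0\<close> (right) or \<open>Im z \<le> 0\<close> (left).\<close>

definition jost_right :: "(real \<Rightarrow> real) \<Rightarrow> complex \<Rightarrow> real \<Rightarrow> complex" where
  "jost_right q z =
     (THE y. schroedinger_solution q z y \<and>
        ((\<lambda>x. exp (- \<i> * z * complex_of_real x) * y x) \<longlongrightarrow> 1) at_top)"

definition jost_left :: "(real \<Rightarrow> real) \<Rightarrow> complex \<Rightarrow> real \<Rightarrow> complex" where
  "jost_left q z =
     (THE y. schroedinger_solution q z y \<and>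
        ((\<lambda>x. exp (- \<i> * z * complex_of_real x) * y x) \<longlongrightarrow> 1) at_bot)"

text \<open>The pair \<open>(a(k), b(k))\<close>, for real \<open>k \<noteq> 0\<close>.\<close>

definition scattering_coeffs :: "(real \<Rightarrow> real) \<Rightarrow> real \<Rightarrow> complex \<times> complex" where
  "scattering_coeffs q k =
     (THE p. \<forall>x. jost_right q (complex_of_real k) x =
        fst p * jost_left q (complex_of_real k) x + snd p * jost_left q (complex_of_real (- k)) x)"

definition scattering_a :: "(real \<Rightarrow> real) \<Rightarrow> real \<Rightarrow> complex" where
  "scattering_a q k = fst (scattering_coeffs q k)"

definition scattering_b :: "(real \<Rightarrow> real) \<Rightarrow> real \<Rightarrow> complex" where
  "scattering_b q k = snd (scattering_coeffs q k)"

definition refl_left :: "(real \<Rightarrow> real) \<Rightarrow> real \<Rightarrow> complex" where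
  "refl_left q k = scattering_b q k / scattering_a q k"

definition refl_right :: "(real \<Rightarrow> real) \<Rightarrow> real \<Rightarrow> complex" where
  "refl_right q k = - scattering_b q (- k) / scattering_a q k"

definition reflectionless :: "(real \<Rightarrow> real) \<Rightarrow> bool" where
  "reflectionless q \<longleftrightarrow> (\<forall>k. k \<noteq> 0 \<longrightarrow> refl_left q k = 0 \<and> refl_right q k = 0)"

text \<open>Since \<open>1 / m\<^sup>2 > 0\<close>, the Bochner integral below cannot take its default value \<open>0\<close>, so the
  Jost solution is forced to be square integrable.\<close>

definition is_norming_constant :: "(real \<Rightarrow> real) \<Rightarrow> real \<Rightarrow> real \<Rightarrow> bool" where
  "is_norming_constant q \<kappa> m \<longleftrightarrow>
     m > 0 \<and> 1 / m\<^sup>2 = (LINT x|lebesgue. (cmod (jost_right q (\<i> * complex_of_real \<kappa>) x))\<^sup>2)"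

text \<open>The finite or infinite sequences \<open>\<kappa>\<close> and \<open>m\<close> are indexed by the \<open>n\<close> with \<open>enat n < N\<close>,
  starting from \<open>0\<close>; \<open>N\<close> is the number of negative eigenvalues.\<close>

definition has_spectral_data ::
    "(real \<Rightarrow> real) \<Rightarrow> enat \<Rightarrow> (nat \<Rightarrow> real) \<Rightarrow> (nat \<Rightarrow> real) \<Rightarrow> bool" where
  "has_spectral_data q N \<kappa> m \<longleftrightarrow>
     (\<forall>n. enat n < N \<longrightarrow> \<kappa> n > 0) \<and>
     (\<forall>i j. i < j \<and> enat j < N \<longrightarrow> \<kappa> j < \<kappa> i) \<and>
     neg_eigenvalues q = {- (\<kappa> n)\<^sup>2 | n. enat n < N} \<and>
     (\<forall>n. enat n < N \<longrightarrow> is_norming_constant q (\<kappa> n) (m n))"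

end

theory Submission
  imports Defs "HOL-Complex_Analysis.Complex_Analysis"
begin

text \<open>Let \<open>a\<close> be the inverse transmission coefficient and \<open>psi\<close>, \<open>psiL\<close> the right and left Jost solutions, all continued to
  the upper half plane. For a reflectionless potential \<open>psiL / a\<close> equals \<open>psi (- k)\<close> at real \<open>k\<close>, and its residue at an
  eigenvalue \<open>i \<kappa>\<close> is \<open>i m\<^sup>2 psi (i \<kappa>)\<close>. Given two reflectionless potentials \<open>q\<close>, \<open>p\<close> with the same spectral data, the
  function \<open>D = (psiL\<^sub>p / a\<^sub>p psi\<^sub>q - psiL\<^sub>q / a\<^sub>q psi\<^sub>p) / z\<close> therefore has no poles, is even on the real line, and extends to
  an even holomorphic function on the punctured plane which vanishes at infinity.

  No decay of \<open>q\<close> beyond integrability is available to control \<open>D\<close> at \<open>z = 0\<close>. Two bounds replace it. First, the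
  right and left Weyl functions of a reflectionless potential are parts of one function on the right half plane with
  positive imaginary part; comparison with the free one yields \<open>\<bar>psi (k)\<bar> \<le> 1\<close> for real \<open>k\<close>, so
  \<open>\<bar>D (k)\<bar> \<le> 2 / \<bar>k\<bar>\<close>. Second, Gronwall estimates for \<open>psi' + i z psi\<close>
  give \<open>\<bar>D (z)\<bar> \<le> exp (\<epsilon> / \<bar>Re z\<bar>)\<close> near \<open>0\<close> for every \<open>\<epsilon> > 0\<close>. A Phragmen--Lindelof argument in \<open>1 / z\<close> then shows
  \<open>D = 0\<close>. At \<open>z = 1\<close> this means that the quotient of the two Jost solutions is real; the Wronskian forces it to be \<open>1\<close>,
  and the potential can be read off from the common solution.\<close>

section \<open>Locally absolutely continuous functions\<close>

text \<open>For \<open>q\<close> merely integrable the Jost solutions need not have limits at z = 0: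
  the Volterra kernel is controlled by 1 / |z|, and control uniform at 0 would cost a first moment
  of \<open>q\<close>. Moreover there may be infinitely many eigenvalues, so the zeros i \<kappa> of
  a may accumulate at 0, and no positive lower bound for |a| can then hold on a full half
  neighbourhood of 0. This dictates the form of the growth bound: D is estimated by separate bounds
  for psi, psiL and 1 / a, which must be allowed to blow up on the imaginary axis although D itself
  is holomorphic there. With u = 1 / z the bound reads exp (\<epsilon> |u|^2 / |Re u|), and the
  Phragmen-Lindelof argument has to tolerate its singularity along the imaginary axis. Evenness of D
  is what excludes a nonzero remainder: a small multiple of 1 / z vanishes at infinity and satisfies
  both bounds. Evenness holds because at real k the exchange of k and - k swaps the two products in
  the numerator, while the divisor changes sign.\<close>

lemma lac_absolutely_integrable:
  assumes "loc_abs_cont_deriv f g"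
  shows "g absolutely_integrable_on {a..b}"
proof (cases "a \<le> b")
  case True
  then show ?thesis using assms by (auto simp: loc_abs_cont_deriv_def)
next
  case False
  then show ?thesis by (simp add: set_integrable_def)
qed

lemma absolutely_integrable_imp_integrable:
  fixes f :: "real \<Rightarrow> 'b::euclidean_space"
  shows "f absolutely_integrable_on S \<Longrightarrow> f integrable_on S"
  using set_lebesgue_integral_eq_integral(1) by blast

lemma lac_integral:
  assumes "loc_abs_cont_deriv f g" "a \<le> b"
  shows "integral {a..b} g = f b - f a"
  using assms by (auto simp: loc_abs_cont_deriv_def integral_unique)

lemma lac_continuous_on:
  assumes "loc_abs_cont_deriv f g"
  shows "continuous_on A f"
proof -
  have "isCont f x" for x
  proof -
    have "g integrable_on {x-1..x+1}"
      using lac_absolutely_integrable[OF assms] set_lebesgue_integral_eq_integral(1) by blast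
    then have "continuous_on {x-1..x+1} (\<lambda>y. f (x-1) + integral {x-1..y} g)"
      by (intro continuous_intros indefinite_integral_continuous_1)
    then have "continuous_on {x-1..x+1} f"
      by (rule continuous_on_eq) (use lac_integral[OF assms] in auto)
    then show ?thesis
      by (rule continuous_on_interior) (simp add: interior_cbox)
  qed
  then show ?thesis by (simp add: continuous_at_imp_continuous_on)
qed

lemma absolutely_integrable_continuous_mult:
  fixes F g :: "real \<Rightarrow> complex"
  assumes "continuous_on {a..b} F" "g absolutely_integrable_on {a..b}"
  shows "(\<lambda>x. F x * g x) absolutely_integrable_on {a..b}"
  by (rule absolutely_integrable_bounded_measurable_product[OF bilinear_times _ _ _ assms(2)])
     (auto simp: assms(1) continuous_imp_measurable_on_sets_lebesgue
        intro!: compact_imp_bounded compact_continuous_image)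

text \<open>By bisection, an error infinitesimal relative to a fixed integrable weight adds up to nothing.\<close>

lemma lac_criterion:
  fixes \<Phi> \<phi> :: "real \<Rightarrow> complex" and l :: "real \<Rightarrow> real"
  assumes \<phi>: "\<And>a b. \<phi> absolutely_integrable_on {a..b}"
    and l: "\<And>a b. l absolutely_integrable_on {a..b}" and l0: "\<And>x. 0 \<le> l x"
    and loc: "\<And>x e. e > 0 \<Longrightarrow> \<exists>d>0. \<forall>s t. s \<le> x \<and> x \<le> t \<and> t - s < d \<longrightarrow>
      cmod (\<Phi> t - \<Phi> s - integral {s..t} \<phi>) \<le> e * integral {s..t} l"
  shows "loc_abs_cont_deriv \<Phi> \<phi>"
proof -
  have int\<phi>: "\<phi> integrable_on {a..b}" for a b using \<phi> set_lebesgue_integral_eq_integral(1) by blast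
  have intl: "l integrable_on {a..b}" for a b using l set_lebesgue_integral_eq_integral(1) by blast
  have "integral {a..b} \<phi> = \<Phi> b - \<Phi> a" if "a \<le> b" for a b
  proof -
    have est: "cmod (\<Phi> b - \<Phi> a - integral {a..b} \<phi>) \<le> e * integral {a..b} l" if "e > 0" for e
    proof (rule Bolzano[OF \<open>a \<le> b\<close>])
      fix r s t assume rs: "cmod (\<Phi> s - \<Phi> r - integral {r..s} \<phi>) \<le> e * integral {r..s} l"
        and st: "cmod (\<Phi> t - \<Phi> s - integral {s..t} \<phi>) \<le> e * integral {s..t} l"
        and ord: "r \<le> s" "s \<le> t"
      have 1: "integral {r..t} \<phi> = integral {r..s} \<phi> + integral {s..t} \<phi>"
        using Henstock_Kurzweil_Integration.integral_combine[OF ord int\<phi>] by simp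
      have 2: "integral {r..t} l = integral {r..s} l + integral {s..t} l"
        using Henstock_Kurzweil_Integration.integral_combine[OF ord intl] by simp
      have 3: "\<Phi> t - \<Phi> r - integral {r..t} \<phi> =
        (\<Phi> s - \<Phi> r - integral {r..s} \<phi>) + (\<Phi> t - \<Phi> s - integral {s..t} \<phi>)"
        using 1 by simp
      show "cmod (\<Phi> t - \<Phi> r - integral {r..t} \<phi>) \<le> e * integral {r..t} l"
        unfolding 2 3 distrib_left by (rule norm_triangle_mono[OF rs st])
    next
      fix x show "\<exists>d>0. \<forall>s t. s \<le> x \<and> x \<le> t \<and> t - s < d \<longrightarrow>
          cmod (\<Phi> t - \<Phi> s - integral {s..t} \<phi>) \<le> e * integral {s..t} l"
        using loc[OF that] .
    qed
    have L0: "integral {a..b} l \<ge> 0" using intl l0 by (simp add: integral_nonneg)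
    have "cmod (\<Phi> b - \<Phi> a - integral {a..b} \<phi>) \<le> 0"
    proof (rule field_le_epsilon)
      fix e :: real assume "e > 0"
      have "cmod (\<Phi> b - \<Phi> a - integral {a..b} \<phi>) \<le> e / (1 + integral {a..b} l) * integral {a..b} l"
        using \<open>e > 0\<close> L0 by (intro est) simp
      also have "\<dots> \<le> e" using \<open>e > 0\<close> L0 by (simp add: field_simps)
      finally show "cmod (\<Phi> b - \<Phi> a - integral {a..b} \<phi>) \<le> 0 + e" by simp
    qed
    then show ?thesis by simp
  qed
  then show ?thesis
    using \<phi> int\<phi> unfolding loc_abs_cont_deriv_def by (metis integrable_integral)
qed

text \<open>The increment of \<open>F * G\<close> over [s, t] is (F t - F s) G s + F t (G t - G s).
  Its difference from the integral of \<open>f * G + F * g\<close> is an integral of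
  \<open>f\<close> and \<open>g\<close> against oscillations of \<open>G\<close> and
  \<open>F\<close>, which continuity makes small relative to the weight |f| + |g|.\<close>

lemma lac_mult:
  assumes F: "loc_abs_cont_deriv F f" and G: "loc_abs_cont_deriv G g"
  shows "loc_abs_cont_deriv (\<lambda>x. F x * G x) (\<lambda>x. f x * G x + F x * g x)"
proof (rule lac_criterion[where l = "\<lambda>x. cmod (f x) + cmod (g x)"])
  note fi = lac_absolutely_integrable[OF F] and gi = lac_absolutely_integrable[OF G]
  have i1: "(\<lambda>x. f x * G x) absolutely_integrable_on {a..b}" for a b
    using absolutely_integrable_continuous_mult[OF lac_continuous_on[OF G] fi] by (simp add: mult.commute)
  have i2: "(\<lambda>x. F x * g x) absolutely_integrable_on {a..b}" for a b
    by (rule absolutely_integrable_continuous_mult[OF lac_continuous_on[OF F] gi])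
  show "(\<lambda>x. f x * G x + F x * g x) absolutely_integrable_on {a..b}" for a b
    by (intro set_integral_add i1 i2)
  show wi: "(\<lambda>x. cmod (f x) + cmod (g x)) absolutely_integrable_on {a..b}" for a b
    by (intro set_integral_add absolutely_integrable_norm fi[unfolded o_def] gi)
       (use absolutely_integrable_norm[OF fi] absolutely_integrable_norm[OF gi] in \<open>simp_all add: o_def\<close>)
  fix x e :: real assume e: "e > 0"
  have "isCont F x" "isCont G x"
    using lac_continuous_on[OF F, of UNIV] lac_continuous_on[OF G, of UNIV]
    by (auto simp: continuous_on_eq_continuous_at)
  then have "\<forall>e>0. \<exists>d>0. \<forall>y. \<bar>y - x\<bar> < d \<longrightarrow> cmod (F y - F x) < e"
     "\<forall>e>0. \<exists>d>0. \<forall>y. \<bar>y - x\<bar> < d \<longrightarrow> cmod (G y - G x) < e"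
    unfolding continuous_at_eps_delta dist_norm real_norm_def by auto
  then obtain d1 d2 where d: "d1 > 0" "\<And>y. \<bar>y - x\<bar> < d1 \<Longrightarrow> cmod (F y - F x) < e/2"
     "d2 > 0" "\<And>y. \<bar>y - x\<bar> < d2 \<Longrightarrow> cmod (G y - G x) < e/2"
    using half_gt_zero[OF e] by metis
  show "\<exists>d>0. \<forall>s t. s \<le> x \<and> x \<le> t \<and> t - s < d \<longrightarrow>
      cmod (F t * G t - F s * G s - integral {s..t} (\<lambda>x. f x * G x + F x * g x))
        \<le> e * integral {s..t} (\<lambda>x. cmod (f x) + cmod (g x))"
  proof (intro exI[of _ "min d1 d2"] conjI allI impI)
    show "0 < min d1 d2" using d by simp
    fix s t assume st: "s \<le> x \<and> x \<le> t \<and> t - s < min d1 d2"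
    have close: "cmod (F y - F y') \<le> e" "cmod (G y - G y') \<le> e" if "y \<in> {s..t}" "y' \<in> {s..t}" for y y'
    proof -
      have *: "\<bar>y - x\<bar> < d1" "\<bar>y' - x\<bar> < d1" "\<bar>y - x\<bar> < d2" "\<bar>y' - x\<bar> < d2" using that st by auto
      have "F y - F y' = (F y - F x) - (F y' - F x)" "G y - G y' = (G y - G x) - (G y' - G x)" by auto
      then show "cmod (F y - F y') \<le> e" "cmod (G y - G y') \<le> e"
        using norm_triangle_ineq4[of "F y - F x" "F y' - F x"] d(2)[OF *(1)] d(2)[OF *(2)]
          norm_triangle_ineq4[of "G y - G x" "G y' - G x"] d(4)[OF *(3)] d(4)[OF *(4)] by auto
    qed
    have st': "s \<le> t" using st by simp
    have HF: "(f has_integral (F t - F s)) {s..t}" and HG: "(g has_integral (G t - G s)) {s..t}"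
      using F G st' by (auto simp: loc_abs_cont_deriv_def)
    have "((\<lambda>r. f r * G r + F r * g r) has_integral integral {s..t} (\<lambda>x. f x * G x + F x * g x)) {s..t}"
      using set_integral_add(1)[OF i1 i2] set_lebesgue_integral_eq_integral(1) by blast
    then have "((\<lambda>r. (f r * G s + F t * g r) - (f r * G r + F r * g r)) has_integral
      (((F t - F s) * G s + F t * (G t - G s)) - integral {s..t} (\<lambda>x. f x * G x + F x * g x))) {s..t}"
      by (intro has_integral_diff has_integral_add has_integral_mult_left has_integral_mult_right HF HG)
    then have "integral {s..t} (\<lambda>r. (f r * G s + F t * g r) - (f r * G r + F r * g r)) =
        F t * G t - F s * G s - integral {s..t} (\<lambda>x. f x * G x + F x * g x)"
      and int: "(\<lambda>r. (f r * G s + F t * g r) - (f r * G r + F r * g r)) integrable_on {s..t}"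
      by (auto simp: algebra_simps integral_unique integrable_on_def)
    moreover have "cmod (integral {s..t} (\<lambda>r. (f r * G s + F t * g r) - (f r * G r + F r * g r)))
      \<le> integral {s..t} (\<lambda>r. e * (cmod (f r) + cmod (g r)))"
    proof (rule integral_norm_bound_integral[OF int])
      show "(\<lambda>r. e * (cmod (f r) + cmod (g r))) integrable_on {s..t}"
        using wi set_lebesgue_integral_eq_integral(1) by (intro integrable_on_mult_right) blast
      fix r assume r: "r \<in> {s..t}"
      have "(f r * G s + F t * g r) - (f r * G r + F r * g r) = f r * (G s - G r) + (F t - F r) * g r"
        by (simp add: algebra_simps)
      also have "cmod \<dots> \<le> cmod (f r) * e + e * cmod (g r)"
        using close[of t r] close[of s r] r st'
        by (intro norm_triangle_mono) (use e in \<open>auto simp: norm_mult intro!: mult_mono\<close>)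
      finally show "cmod ((f r * G s + F t * g r) - (f r * G r + F r * g r)) \<le> e * (cmod (f r) + cmod (g r))"
        by (simp add: algebra_simps)
    qed
    ultimately show "cmod (F t * G t - F s * G s - integral {s..t} (\<lambda>x. f x * G x + F x * g x))
        \<le> e * integral {s..t} (\<lambda>x. cmod (f x) + cmod (g x))"
      by simp
  qed
qed simp

text \<open>Near x the exponential is replaced by its linearisation with slope exp (F x). The mean
  value inequality bounds the error of the linearisation, and freezing exp (F r) at r = x bounds the
  error in the integral; each receives e / 2 of the weight |f|.\<close>

lemma lac_exp:
  assumes F: "loc_abs_cont_deriv F f"
  shows "loc_abs_cont_deriv (\<lambda>x. exp (F x)) (\<lambda>x. exp (F x) * f x)"
proof (rule lac_criterion[where l = "\<lambda>x. cmod (f x)"])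
  note fi = lac_absolutely_integrable[OF F]
  have cE: "continuous_on A (\<lambda>x. exp (F x))" for A
    by (intro continuous_intros lac_continuous_on[OF F])
  show ei: "(\<lambda>x. exp (F x) * f x) absolutely_integrable_on {a..b}" for a b
    by (rule absolutely_integrable_continuous_mult[OF cE fi])
  show wi: "(\<lambda>x. cmod (f x)) absolutely_integrable_on {a..b}" for a b
    using absolutely_integrable_norm[OF fi] by (simp add: o_def)
  fix x e :: real assume e: "e > 0"
  have cont: "isCont F x"
    using lac_continuous_on[OF F, of UNIV] by (auto simp: continuous_on_eq_continuous_at)
  have "isCont (\<lambda>z. exp z :: complex) (F x)" by simp
  then have "\<forall>e>0. \<exists>d>0. \<forall>z. cmod (z - F x) < d \<longrightarrow> cmod (exp z - exp (F x)) < e"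
    unfolding continuous_at_eps_delta dist_norm by auto
  then obtain \<delta> where \<delta>: "\<delta> > 0" "\<And>z. cmod (z - F x) < \<delta> \<Longrightarrow> cmod (exp z - exp (F x)) < e/2"
    using half_gt_zero[OF e] by metis
  obtain d where d: "d > 0" "\<And>y. \<bar>y - x\<bar> < d \<Longrightarrow> cmod (F y - F x) < \<delta>"
    using cont \<delta>(1) unfolding continuous_at_eps_delta dist_norm real_norm_def by fastforce
  show "\<exists>d>0. \<forall>s t. s \<le> x \<and> x \<le> t \<and> t - s < d \<longrightarrow>
      cmod (exp (F t) - exp (F s) - integral {s..t} (\<lambda>x. exp (F x) * f x))
        \<le> e * integral {s..t} (\<lambda>x. cmod (f x))"
  proof (intro exI[of _ d] conjI allI impI d(1))
    fix s t assume st: "s \<le> x \<and> x \<le> t \<and> t - s < d"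
    have near: "F y \<in> ball (F x) \<delta>" if "y \<in> {s..t}" for y
      using d(2)[of y] that st by (auto simp: dist_norm norm_minus_commute)
    have st': "s \<le> t" using st by simp
    have HF: "(f has_integral (F t - F s)) {s..t}"
      using F st' by (auto simp: loc_abs_cont_deriv_def)
    have "((\<lambda>r. exp (F r) * f r) has_integral integral {s..t} (\<lambda>x. exp (F x) * f x)) {s..t}"
      using ei set_lebesgue_integral_eq_integral(1) by blast
    from has_integral_diff[OF has_integral_mult_right[OF HF, of "exp (F x)"] this]
    have H: "((\<lambda>r. exp (F x) * f r - exp (F r) * f r) has_integral
        (exp (F x) * (F t - F s) - integral {s..t} (\<lambda>x. exp (F x) * f x))) {s..t}" .
    have A: "cmod (exp (F x) * (F t - F s) - integral {s..t} (\<lambda>x. exp (F x) * f x))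
        \<le> integral {s..t} (\<lambda>r. e/2 * cmod (f r))"
      unfolding integral_unique[OF H, symmetric]
    proof (rule integral_norm_bound_integral)
      show "(\<lambda>r. e/2 * cmod (f r)) integrable_on {s..t}"
        using wi set_lebesgue_integral_eq_integral(1) by (intro integrable_on_mult_right) blast
      fix r assume r: "r \<in> {s..t}"
      have "cmod (exp (F x) - exp (F r)) \<le> e/2"
        using \<delta>(2)[of "F r"] near[OF r] by (simp add: dist_norm norm_minus_commute)
      then show "cmod (exp (F x) * f r - exp (F r) * f r) \<le> e/2 * cmod (f r)"
        by (metis left_diff_distrib mult_right_mono norm_ge_zero norm_mult)
    qed (use H in \<open>auto simp: integrable_on_def\<close>)
    have "cmod ((exp (F t) - exp (F x) * F t) - (exp (F s) - exp (F x) * F s)) \<le> e/2 * cmod (F t - F s)"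
    proof (rule field_differentiable_bound[where S = "ball (F x) \<delta>" and f' = "\<lambda>z. exp z - exp (F x)"
          and f = "\<lambda>z. exp z - exp (F x) * z"])
      fix z assume "z \<in> ball (F x) \<delta>"
      show "((\<lambda>z. exp z - exp (F x) * z) has_field_derivative exp z - exp (F x)) (at z within ball (F x) \<delta>)"
        by (auto intro!: derivative_eq_intros)
      show "cmod (exp z - exp (F x)) \<le> e/2"
        using \<delta>(2)[of z] \<open>z \<in> ball (F x) \<delta>\<close> by (simp add: dist_norm norm_minus_commute)
    qed (use near st' in auto)
    also have "cmod (F t - F s) \<le> integral {s..t} (\<lambda>r. cmod (f r))"
      unfolding integral_unique[OF HF, symmetric]
      by (rule integral_norm_bound_integral) (use HF absolutely_integrable_imp_integrable[OF wi] in \<open>auto intro: has_integral_integrable\<close>)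
    finally have B: "cmod ((exp (F t) - exp (F x) * F t) - (exp (F s) - exp (F x) * F s))
        \<le> e/2 * integral {s..t} (\<lambda>r. cmod (f r))" using e by simp
    have split: "exp (F t) - exp (F s) - integral {s..t} (\<lambda>x. exp (F x) * f x) =
      ((exp (F t) - exp (F x) * F t) - (exp (F s) - exp (F x) * F s)) +
      (exp (F x) * (F t - F s) - integral {s..t} (\<lambda>x. exp (F x) * f x))"
      by (simp add: algebra_simps)
    show "cmod (exp (F t) - exp (F s) - integral {s..t} (\<lambda>x. exp (F x) * f x))
        \<le> e * integral {s..t} (\<lambda>x. cmod (f x))"
      unfolding split using norm_triangle_mono[OF B A] by simp
  qed
qed simp

section \<open>Linear operations, symmetries and changes on null sets\<close>

lemma lac_add:
  assumes "loc_abs_cont_deriv F f" "loc_abs_cont_deriv G g"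
  shows "loc_abs_cont_deriv (\<lambda>x. F x + G x) (\<lambda>x. f x + g x)"
  unfolding loc_abs_cont_deriv_def
proof (intro allI impI conjI)
  fix a b :: real assume "a \<le> b"
  show "(\<lambda>x. f x + g x) absolutely_integrable_on {a..b}"
    using lac_absolutely_integrable[OF assms(1)] lac_absolutely_integrable[OF assms(2)] by (rule set_integral_add)
  show "((\<lambda>x. f x + g x) has_integral F b + G b - (F a + G a)) {a..b}"
    using has_integral_add[of f "F b - F a" "{a..b}" g "G b - G a"] assms \<open>a \<le> b\<close>
    by (auto simp: loc_abs_cont_deriv_def algebra_simps)
qed

lemma lac_C1:
  assumes "\<And>x. (F has_vector_derivative f x) (at x)" "continuous_on UNIV f"
  shows "loc_abs_cont_deriv F f"
  unfolding loc_abs_cont_deriv_def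
proof (intro allI impI conjI)
  fix a b :: real assume "a \<le> b"
  show "f absolutely_integrable_on {a..b}"
    using assms(2) continuous_on_subset by (intro absolutely_integrable_continuous_real) blast
  show "(f has_integral F b - F a) {a..b}"
    using \<open>a \<le> b\<close> assms(1) by (intro fundamental_theorem_of_calculus) (auto intro: has_vector_derivative_at_within)
qed

lemma lac_const: "loc_abs_cont_deriv (\<lambda>x. c) (\<lambda>x. 0)"
  by (rule lac_C1) auto

lemma lac_cmult:
  assumes "loc_abs_cont_deriv F f"
  shows "loc_abs_cont_deriv (\<lambda>x. c * F x) (\<lambda>x. c * f x)"
  using lac_mult[OF lac_const[of c] assms] by simp

lemma lac_minus:
  assumes "loc_abs_cont_deriv F f"
  shows "loc_abs_cont_deriv (\<lambda>x. - F x) (\<lambda>x. - f x)"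
  using lac_cmult[OF assms, of "-1"] by simp

lemma lac_diff:
  assumes "loc_abs_cont_deriv F f" "loc_abs_cont_deriv G g"
  shows "loc_abs_cont_deriv (\<lambda>x. F x - G x) (\<lambda>x. f x - g x)"
  using lac_add[OF assms(1) lac_minus[OF assms(2)]] by simp

lemma lac_cnj:
  assumes "loc_abs_cont_deriv F f"
  shows "loc_abs_cont_deriv (\<lambda>x. cnj (F x)) (\<lambda>x. cnj (f x))"
  unfolding loc_abs_cont_deriv_def
proof (intro allI impI conjI)
  fix a b :: real assume "a \<le> b"
  show "(\<lambda>x. cnj (f x)) absolutely_integrable_on {a..b}"
    using absolutely_integrable_linear[OF lac_absolutely_integrable[OF assms] bounded_linear_cnj] by (simp add: o_def)
  show "((\<lambda>x. cnj (f x)) has_integral cnj (F b) - cnj (F a)) {a..b}"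
    using has_integral_linear[OF _ bounded_linear_cnj, of f "F b - F a" "{a..b}"] assms \<open>a \<le> b\<close>
    by (auto simp: loc_abs_cont_deriv_def o_def)
qed

lemma lac_reflect:
  assumes "loc_abs_cont_deriv F f"
  shows "loc_abs_cont_deriv (\<lambda>x. F (- x)) (\<lambda>x. - f (- x))"
  unfolding loc_abs_cont_deriv_def
proof (intro allI impI conjI)
  fix a b :: real assume "a \<le> b"
  show "(\<lambda>x. - f (- x)) absolutely_integrable_on {a..b}"
    using absolutely_integrable_linear[OF lac_absolutely_integrable[OF lac_minus[OF assms]] bounded_linear_ident, of "-b" "-a"]
    by (subst absolutely_integrable_reflect_real[symmetric]) (simp add: o_def)
  have "(f has_integral F (-a) - F (-b)) {-b..-a}"
    using assms \<open>a \<le> b\<close> by (auto simp: loc_abs_cont_deriv_def)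
  then have "((\<lambda>x. f (-x)) has_integral F (-a) - F (-b)) {a..b}"
    by (subst has_integral_reflect_real[symmetric]) simp
  then show "((\<lambda>x. - f (- x)) has_integral F (- b) - F (- a)) {a..b}"
    using has_integral_neg[of "\<lambda>x. f (- x)" "F (- a) - F (- b)"] by simp
qed

lemma lac_cong_AE:
  assumes F: "loc_abs_cont_deriv F f" and fg: "AE x in lebesgue. f x = g x"
  shows "loc_abs_cont_deriv F g"
proof -
  obtain N where "N \<in> null_sets lebesgue" "{x. f x \<noteq> g x} \<subseteq> N"
    using fg unfolding eventually_ae_filter by auto
  then have N: "negligible N" "\<And>x. x \<notin> N \<Longrightarrow> g x = f x"
    by (auto simp: negligible_iff_null_sets subset_iff) metis
  show ?thesis
    unfolding loc_abs_cont_deriv_def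
  proof (intro allI impI conjI)
    fix a b :: real assume "a \<le> b"
    show "g absolutely_integrable_on {a..b}"
      by (rule absolutely_integrable_spike[OF lac_absolutely_integrable[OF F] N(1)]) (use N(2) in auto)
    show "(g has_integral F b - F a) {a..b}"
      by (rule has_integral_spike[OF N(1), of _ _ f]) (use N(2) F \<open>a \<le> b\<close> in \<open>auto simp: loc_abs_cont_deriv_def\<close>)
  qed
qed

lemma lac_zero_const:
  assumes "loc_abs_cont_deriv F f" "AE x in lebesgue. f x = 0"
  shows "F x = F y"
proof -
  have "F b = F a" if "a \<le> b" for a b
    using lac_integral[OF lac_cong_AE[OF assms] that] by simp
  then show ?thesis by (metis linear)
qed

lemma lac_has_vector_derivative:
  assumes "loc_abs_cont_deriv F f" "continuous_on UNIV f"
  shows "(F has_vector_derivative f x) (at x)"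
proof -
  have "((\<lambda>u. integral {x-1..u} f) has_vector_derivative f x) (at x within {x-1..x+1})"
    using assms(2) continuous_on_subset by (intro integral_has_vector_derivative) auto
  then have "((\<lambda>u. F (x-1) + integral {x-1..u} f) has_vector_derivative f x) (at x)"
    by (subst (asm) at_within_interior) (auto intro!: derivative_eq_intros)
  then show ?thesis
    by (rule has_vector_derivative_transform_within_open[of _ _ _ "{x-1<..<x+1}"])
       (use lac_integral[OF assms(1)] in auto)
qed

text \<open>The majorant p c + U of \<open>p\<close>, multiplied by the integrating factor exp (-
  K), has derivative exp (- K) k (p - (p c + U)), which is at most 0 to the right of
  \<open>c\<close>. As \<open>k\<close> is only integrable, the product is differentiated by
  \<open>lac_mult\<close> and \<open>lac_exp\<close>.\<close>

lemma gronwall_right: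
  fixes p k :: "real \<Rightarrow> real"
  assumes pc: "continuous_on UNIV p" and p0: "\<And>x. 0 \<le> p x" and k0: "\<And>x. 0 \<le> k x"
    and k: "\<And>a b. k absolutely_integrable_on {a..b}"
    and ineq: "\<And>c d. c \<le> d \<Longrightarrow> p d \<le> p c + integral {c..d} (\<lambda>t. k t * p t)"
    and cd: "c \<le> d"
  shows "p d \<le> p c * exp (integral {c..d} k)"
proof -
  \<comment> \<open>\<open>loc_abs_cont_deriv\<close> speaks of all intervals of the line, so the
    primitive based at \<open>c\<close> is continued to the left of \<open>c\<close> with the
    opposite sign.\<close>
  have indef: "loc_abs_cont_deriv (\<lambda>x. of_real (if c \<le> x then integral {c..x} h else - integral {x..c} h))
       (\<lambda>x. of_real (h x))" if h: "\<And>a b. h absolutely_integrable_on {a..b}" for h :: "real \<Rightarrow> real"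
    unfolding loc_abs_cont_deriv_def
  proof (intro allI impI conjI)
    fix a b :: real assume ab: "a \<le> b"
    have hi: "h integrable_on {a..b}" for a b using h set_lebesgue_integral_eq_integral(1) by blast
    note comb = Henstock_Kurzweil_Integration.integral_combine[OF _ _ hi]
    show "(\<lambda>x. complex_of_real (h x)) absolutely_integrable_on {a..b}"
      using absolutely_integrable_linear[OF h bounded_linear_of_real] by (simp add: o_def)
    have "((\<lambda>x. complex_of_real (h x)) has_integral of_real (integral {a..b} h)) {a..b}"
      using has_integral_linear[OF integrable_integral[OF hi] bounded_linear_of_real] by (simp add: o_def)
    moreover have "integral {a..b} h = (if c \<le> b then integral {c..b} h else - integral {b..c} h)
        - (if c \<le> a then integral {c..a} h else - integral {a..c} h)"
      using ab comb[of a b c] comb[of a c b] comb[of c a b] by auto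
    ultimately show "((\<lambda>x. complex_of_real (h x)) has_integral
        complex_of_real (if c \<le> b then integral {c..b} h else - integral {b..c} h) -
        complex_of_real (if c \<le> a then integral {c..a} h else - integral {a..c} h)) {a..b}"
      by (simp only: of_real_diff[symmetric])
  qed
  have kp: "(\<lambda>t. k t * p t) absolutely_integrable_on {a..b}" for a b
    using absolutely_integrable_bounded_measurable_product_real[of p "{a..b}" k] k pc
    by (simp add: mult.commute compact_continuous_image compact_imp_bounded continuous_imp_measurable_on_sets_lebesgue
        continuous_on_subset[OF pc])
  define U where "U = (\<lambda>x. if c \<le> x then integral {c..x} (\<lambda>t. k t * p t) else - integral {x..c} (\<lambda>t. k t * p t))"
  define K where "K = (\<lambda>x. if c \<le> x then integral {c..x} k else - integral {x..c} k)"
  have lU: "loc_abs_cont_deriv (\<lambda>x. of_real (p c + U x)) (\<lambda>x. of_real (k x * p x))"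
    using lac_add[OF lac_const[of "of_real (p c)"] indef[OF kp]] by (simp add: U_def)
  have lK: "loc_abs_cont_deriv (\<lambda>x. of_real (K x)) (\<lambda>x. of_real (k x))"
    using indef[OF k] by (simp add: K_def)
  define P where "P = (\<lambda>x. (p c + U x) * exp (- K x))"
  define D where "D = (\<lambda>x. exp (- K x) * k x * (p x - (p c + U x)))"
  have "loc_abs_cont_deriv (\<lambda>x. complex_of_real (P x)) (\<lambda>x. complex_of_real (D x))"
    using lac_mult[OF lU lac_exp[OF lac_minus[OF lK]]]
    by (simp add: P_def D_def algebra_simps exp_of_real flip: of_real_minus of_real_mult of_real_add of_real_diff)
  then have "((\<lambda>x. complex_of_real (D x)) has_integral of_real (P d) - of_real (P c)) {c..d}"
    using cd by (auto simp: loc_abs_cont_deriv_def)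
  from has_integral_linear[OF this bounded_linear_Re] have HI: "(D has_integral P d - P c) {c..d}"
    by (simp add: o_def)
  have "P d - P c \<le> 0"
  proof (rule has_integral_le[OF HI has_integral_0])
    fix x assume x: "x \<in> {c..d}"
    have "p x \<le> p c + U x" using ineq[of c x] x by (simp add: U_def)
    then show "D x \<le> 0" using k0[of x] by (simp add: D_def mult_nonneg_nonpos)
  qed
  moreover have "P c = p c" by (simp add: P_def U_def K_def)
  ultimately have "(p c + U d) * exp (- K d) \<le> p c" unfolding P_def by linarith
  then have "(p c + U d) \<le> p c * exp (K d)"
    by (simp add: exp_minus divide_simps)
  moreover have "p d \<le> p c + U d" using ineq[OF cd] cd by (simp add: U_def)
  ultimately show ?thesis using cd by (simp add: K_def)
qed

lemma gronwall_left:
  fixes p k :: "real \<Rightarrow> real"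
  assumes pc: "continuous_on UNIV p" and p0: "\<And>x. 0 \<le> p x" and k0: "\<And>x. 0 \<le> k x"
    and k: "\<And>a b. k absolutely_integrable_on {a..b}"
    and ineq: "\<And>c d. c \<le> d \<Longrightarrow> p c \<le> p d + integral {c..d} (\<lambda>t. k t * p t)"
    and cd: "c \<le> d"
  shows "p c \<le> p d * exp (integral {c..d} k)"
proof -
  have "p (- (- c)) \<le> p (- (- d)) * exp (integral {-d..-c} (\<lambda>x. k (- x)))"
  proof (rule gronwall_right[where p = "\<lambda>x. p (- x)"])
    show "continuous_on UNIV (\<lambda>x. p (- x))"
      by (rule continuous_on_compose2[OF pc]) (auto intro: continuous_intros)
    show "(\<lambda>x. k (- x)) absolutely_integrable_on {a..b}" for a b
      by (subst absolutely_integrable_reflect_real[symmetric]) (use k in simp)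
    fix c d :: real assume "c \<le> d"
    then show "p (- d) \<le> p (- c) + integral {c..d} (\<lambda>t. k (- t) * p (- t))"
      using ineq[of "-d" "-c"] Henstock_Kurzweil_Integration.integral_reflect_real[of "-c" "-d" "\<lambda>t. k t * p t"] by (simp only: minus_minus)
  qed (use p0 k0 cd in auto)
  then show ?thesis using Henstock_Kurzweil_Integration.integral_reflect_real[of d c k] by simp
qed

section \<open>Parameter integrals\<close>

lemma borel_measurable_lebesgue_continuous:
  fixes f :: "real \<Rightarrow> 'b::euclidean_space"
  shows "continuous_on UNIV f \<Longrightarrow> f \<in> borel_measurable lebesgue"
  by (rule measurable_completion) (simp add: borel_measurable_continuous_onI)

lemma tail_integral_split:
  fixes f :: "real \<Rightarrow> 'b::euclidean_space"
  assumes f: "set_integrable lebesgue {a..} f" and ab: "a \<le> b"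
  shows "(LINT t:{a..}|lebesgue. f t) = integral {a..b} f + (LINT t:{b..}|lebesgue. f t)"
proof -
  have 1: "set_integrable lebesgue {a..b} f" "set_integrable lebesgue {b..} f"
    using ab by (auto intro!: set_integrable_subset[OF f])
  have "{a..b} \<union> {b..} = {a..}" "{a..b} \<inter> {b..} = {b}" using ab by auto
  then have "integral {a..} f = integral {a..b} f + integral {b..} f"
    using integral_Un[of f "{a..b}" "{b..}"] 1[THEN set_lebesgue_integral_eq_integral(1)] by simp
  then show ?thesis using f 1(2) by (simp add: set_lebesgue_integral_eq_integral(2))
qed

lemma lac_tail_integral:
  fixes f :: "real \<Rightarrow> complex"
  assumes f: "\<And>x. set_integrable lebesgue {x..} f"
  shows "loc_abs_cont_deriv (\<lambda>x. LINT t:{x..}|lebesgue. f t) (\<lambda>x. - f x)"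
  unfolding loc_abs_cont_deriv_def
proof (intro allI impI conjI)
  fix a b :: real assume ab: "a \<le> b"
  have fi: "f absolutely_integrable_on {a..b}" by (rule set_integrable_subset[OF f[of a]]) auto
  show "(\<lambda>x. - f x) absolutely_integrable_on {a..b}"
    using absolutely_integrable_linear[OF fi bounded_linear_minus[OF bounded_linear_ident]] by (simp add: o_def)
  have "((\<lambda>x. - f x) has_integral - integral {a..b} f) {a..b}"
    using has_integral_neg[OF integrable_integral[OF absolutely_integrable_imp_integrable[OF fi]]] .
  then show "((\<lambda>x. - f x) has_integral (LINT t:{b..}|lebesgue. f t) - (LINT t:{a..}|lebesgue. f t)) {a..b}"
    using tail_integral_split[OF f ab] by simp
qed

lemma tail_integral_tendsto_0:
  fixes f :: "real \<Rightarrow> 'b::euclidean_space"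
  assumes f: "set_integrable lebesgue {a..} f"
  shows "((\<lambda>x. LINT t:{x..}|lebesgue. f t) \<longlongrightarrow> 0) at_top"
proof -
  have "((\<lambda>x. LINT t:{a..x}|lebesgue. f t) \<longlongrightarrow> (LINT t:{a..}|lebesgue. f t)) at_top"
    by (rule tendsto_set_lebesgue_integral_at_top[OF _ f]) auto
  then have "((\<lambda>x. (LINT t:{a..}|lebesgue. f t) - (LINT t:{a..x}|lebesgue. f t)) \<longlongrightarrow> 0) at_top"
    by (auto intro!: tendsto_eq_intros)
  moreover have "\<forall>\<^sub>F x in at_top. (LINT t:{a..}|lebesgue. f t) - (LINT t:{a..x}|lebesgue. f t) = (LINT t:{x..}|lebesgue. f t)"
    using eventually_ge_at_top[of a]
  proof eventually_elim
    case (elim x)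
    have "set_integrable lebesgue {a..x} f" by (rule set_integrable_subset[OF f]) auto
    then show ?case using tail_integral_split[OF f elim] by (simp add: set_lebesgue_integral_eq_integral(2))
  qed
  ultimately show ?thesis by (rule Lim_transform_eventually)
qed

lemma lebesgue_integral_split_0:
  fixes f :: "real \<Rightarrow> 'b::euclidean_space"
  assumes f: "integrable lebesgue f"
  shows "(LINT t|lebesgue. f t) = (LINT t:{..0}|lebesgue. f t) + (LINT t:{0..}|lebesgue. f t)"
proof -
  have fs: "set_integrable lebesgue A f" if "A \<in> sets lebesgue" for A
    unfolding set_integrable_def by (rule integrable_mult_indicator[OF that f])
  have "{..0::real} \<union> {0..} = UNIV" "{..0::real} \<inter> {0..} = {0}" by auto
  then have "integral UNIV f = integral {..0} f + integral {0..} f"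
    using integral_Un[of f "{..0}" "{0..}"] fs[THEN set_lebesgue_integral_eq_integral(1)] by simp
  moreover have "integral UNIV f = (LINT t|lebesgue. f t)"
    using set_lebesgue_integral_eq_integral(2)[OF fs[of UNIV]] by (simp add: set_lebesgue_integral_def)
  ultimately show ?thesis by (simp add: fs set_lebesgue_integral_eq_integral(2))
qed

lemma tail_integral_tendsto_at_bot:
  fixes f :: "real \<Rightarrow> 'b::euclidean_space"
  assumes f: "integrable lebesgue f"
  shows "((\<lambda>x. LINT t:{x..}|lebesgue. f t) \<longlongrightarrow> (LINT t|lebesgue. f t)) at_bot"
proof -
  have fs: "set_integrable lebesgue A f" if "A \<in> sets lebesgue" for A
    unfolding set_integrable_def by (rule integrable_mult_indicator[OF that f])
  have "((\<lambda>x. LINT t:{x..0}|lebesgue. f t) \<longlongrightarrow> (LINT t:{..0}|lebesgue. f t)) at_bot"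
    by (rule tendsto_set_lebesgue_integral_at_bot) (auto intro: fs)
  then have "((\<lambda>x. (LINT t:{x..0}|lebesgue. f t) + (LINT t:{0..}|lebesgue. f t)) \<longlongrightarrow>
      (LINT t:{..0}|lebesgue. f t) + (LINT t:{0..}|lebesgue. f t)) at_bot"
    by (intro tendsto_intros)
  moreover have "\<forall>\<^sub>F x in at_bot. (LINT t:{x..0}|lebesgue. f t) + (LINT t:{0..}|lebesgue. f t) = (LINT t:{x..}|lebesgue. f t)"
    using eventually_le_at_bot[of 0]
  proof eventually_elim
    case (elim x)
    then show ?case using tail_integral_split[OF fs elim] fs by (simp add: set_lebesgue_integral_eq_integral(2))
  qed
  ultimately show ?thesis
    unfolding lebesgue_integral_split_0[OF f] by (rule Lim_transform_eventually)
qed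

lemma continuous_on_integral_dominated:
  fixes F :: "complex \<Rightarrow> real \<Rightarrow> complex"
  assumes cont: "\<And>t. continuous_on S (\<lambda>z. F z t)"
    and meas: "\<And>z. z \<in> S \<Longrightarrow> F z \<in> borel_measurable lebesgue"
    and bnd: "\<And>z t. z \<in> S \<Longrightarrow> cmod (F z t) \<le> b t" and b: "integrable lebesgue b"
  shows "continuous_on S (\<lambda>z. LINT t|lebesgue. F z t)"
  unfolding continuous_on_sequentially comp_def
proof (intro allI ballI impI)
  fix x a assume a: "a \<in> S" and x: "(\<forall>n. x n \<in> S) \<and> x \<longlonglongrightarrow> a"
  show "(\<lambda>n. LINT t|lebesgue. F (x n) t) \<longlonglongrightarrow> (LINT t|lebesgue. F a t)"
  proof (rule integral_dominated_convergence[where w = b])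
    show "AE t in lebesgue. (\<lambda>i. F (x i) t) \<longlonglongrightarrow> F a t"
      using cont x a unfolding continuous_on_sequentially comp_def by auto
  qed (use meas a x bnd b in auto)
qed

text \<open>The difference quotient is extended holomorphically over the point by its derivative, so the
  maximum principle supplies the dominating function.\<close>

lemma holomorphic_on_integral_dominated:
  fixes F :: "complex \<Rightarrow> real \<Rightarrow> complex"
  assumes S: "open S" and hol: "\<And>t. (\<lambda>z. F z t) holomorphic_on S"
    and meas: "\<And>z. z \<in> S \<Longrightarrow> F z \<in> borel_measurable lebesgue"
    and bnd: "\<And>z t. z \<in> S \<Longrightarrow> cmod (F z t) \<le> b t" and b: "integrable lebesgue b"
  shows "(\<lambda>z. LINT t|lebesgue. F z t) holomorphic_on S"
  unfolding holomorphic_on_open[OF S]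
proof
  fix z0 assume z0: "z0 \<in> S"
  then obtain r where r: "r > 0" "cball z0 r \<subseteq> S" using S open_contains_cball by metis
  define G where "G = (\<lambda>z t. if z = z0 then deriv (\<lambda>z. F z t) z0 else (F z t - F z0 t) / (z - z0))"
  have holG: "(\<lambda>z. G z t) holomorphic_on S" for t
    unfolding G_def by (rule pole_lemma[OF hol]) (use z0 S in \<open>simp add: interior_open\<close>)
  have Gb: "cmod (G z t) \<le> 2 / r * b t" if z: "z \<in> cball z0 r" for z t
  proof (rule maximum_modulus_frontier[where S = "cball z0 r" and f = "\<lambda>z. G z t"])
    show "(\<lambda>z. G z t) holomorphic_on interior (cball z0 r)"
      using holG by (rule holomorphic_on_subset) (use r interior_subset in blast)
    show "continuous_on (closure (cball z0 r)) (\<lambda>z. G z t)"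
      using r by (auto intro: holomorphic_on_imp_continuous_on holomorphic_on_subset[OF holG])
    fix u assume "u \<in> frontier (cball z0 r)"
    then have u: "cmod (u - z0) = r" using r by (simp add: dist_norm norm_minus_commute)
    then have uS: "u \<in> S" "u \<noteq> z0" using r by (auto simp: dist_norm norm_minus_commute)
    have "cmod (F u t - F z0 t) \<le> b t + b t"
      using norm_triangle_ineq4[of "F u t" "F z0 t"] bnd[OF uS(1), of t] bnd[OF z0, of t] by linarith
    then show "cmod (G u t) \<le> 2 / r * b t" using u uS r by (simp add: G_def norm_divide field_simps)
  qed (use z in auto)
  have measG': "G z \<in> borel_measurable lebesgue" if "z \<in> cball z0 r" "z \<noteq> z0" for z
    unfolding G_def using that meas[of z] meas[OF z0] r by auto
  \<comment> \<open>At \<open>z0\<close> the integrand is a \<open>deriv\<close>; its measurability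
    in \<open>t\<close> is inherited from the difference quotients along a sequence tending to
    \<open>z0\<close> inside the ball.\<close>
  have measG: "G z \<in> borel_measurable lebesgue" if z: "z \<in> cball z0 r" for z
  proof (cases "z = z0")
    case True
    define c where "c = (\<lambda>n. r * inverse (real (Suc n)))"
    define x where "x = (\<lambda>n. z0 + of_real (c n))"
    have c: "0 < c n" "c n \<le> r" for n
      using r(1) by (auto simp: c_def field_simps simp del: of_nat_Suc)
    have "dist z0 (x n) = c n" for n
      using c(1)[of n] by (simp add: x_def dist_norm)
    then have x: "x n \<in> cball z0 r" "x n \<noteq> z0" for n
      using c[of n] by (auto simp: x_def)
    have "c \<longlonglongrightarrow> r * 0"
      unfolding c_def by (intro tendsto_mult_left LIMSEQ_inverse_real_of_nat)
    then have "x \<longlonglongrightarrow> z0 + of_real (r * 0)"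
      unfolding x_def by (intro tendsto_add tendsto_const tendsto_of_real)
    then have lim: "x \<longlonglongrightarrow> z0" by simp
    show ?thesis
    proof (rule borel_measurable_LIMSEQ_metric)
      show "G (x n) \<in> borel_measurable lebesgue" for n using measG' x by blast
      fix t
      have "continuous_on S (\<lambda>z. G z t)" using holG holomorphic_on_imp_continuous_on by blast
      then show "(\<lambda>n. G (x n) t) \<longlonglongrightarrow> G z t"
        unfolding True continuous_on_sequentially comp_def using x lim z0 r by blast
    qed
  qed (use measG' z in blast)
  have "continuous_on (ball z0 r) (\<lambda>z. LINT t|lebesgue. G z t)"
  proof (rule continuous_on_integral_dominated)
    show "continuous_on (ball z0 r) (\<lambda>z. G z t)" for t
      by (rule holomorphic_on_imp_continuous_on, rule holomorphic_on_subset[OF holG]) (use r in auto)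
    show "integrable lebesgue (\<lambda>t. 2 / r * b t)" using b by simp
  qed (use measG Gb in auto)
  then have "((\<lambda>z. LINT t|lebesgue. G z t) \<longlongrightarrow> (LINT t|lebesgue. G z0 t)) (at z0)"
    using r by (simp add: continuous_on_eq_continuous_at isCont_def)
  moreover have "\<forall>\<^sub>F z in at z0. (LINT t|lebesgue. G z t) = ((LINT t|lebesgue. F z t) - (LINT t|lebesgue. F z0 t)) / (z - z0)"
    unfolding eventually_at
  proof (intro exI[of _ r] conjI ballI impI r(1))
    fix z assume z: "z \<noteq> z0 \<and> dist z z0 < r"
    then have zS: "z \<in> S" using r by (auto simp: dist_commute)
    have int: "integrable lebesgue (F z)" if "z \<in> S" for z
    proof (rule Bochner_Integration.integrable_bound[OF b meas[OF that]])
      show "AE t in lebesgue. cmod (F z t) \<le> norm (b t)"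
        using bnd[OF that] by (auto intro: order_trans[OF _ abs_ge_self])
    qed
    show "(LINT t|lebesgue. G z t) = ((LINT t|lebesgue. F z t) - (LINT t|lebesgue. F z0 t)) / (z - z0)"
      using z int[OF zS] int[OF z0] by (simp add: G_def Bochner_Integration.integral_diff)
  qed
  ultimately have "((\<lambda>z. ((LINT t|lebesgue. F z t) - (LINT t|lebesgue. F z0 t)) / (z - z0)) \<longlongrightarrow> (LINT t|lebesgue. G z0 t)) (at z0)"
    by (rule Lim_transform_eventually)
  then show "\<exists>f'. ((\<lambda>z. LINT t|lebesgue. F z t) has_field_derivative f') (at z0)"
    unfolding has_field_derivative_iff by blast
qed

section \<open>Volterra series\<close>

lemma lac_transform:
  "loc_abs_cont_deriv F f \<Longrightarrow> (\<And>x. F x = G x) \<Longrightarrow> (\<And>x. f x = g x) \<Longrightarrow> loc_abs_cont_deriv G g"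
  by (subgoal_tac "F = G \<and> f = g") auto

lemma has_vector_derivative_exp_linear:
  "((\<lambda>x. exp (c * complex_of_real x)) has_vector_derivative c * exp (c * of_real x)) (at x)"
  by (rule has_vector_derivative_real_field) (auto intro!: derivative_eq_intros)

lemma lac_exp_linear: "loc_abs_cont_deriv (\<lambda>x. exp (c * complex_of_real x)) (\<lambda>x. c * exp (c * of_real x))"
  by (rule lac_C1[OF has_vector_derivative_exp_linear]) (intro continuous_intros)

definition l1_tail :: "(real \<Rightarrow> real) \<Rightarrow> real \<Rightarrow> real" where
  "l1_tail q x = (LINT t:{x..}|lebesgue. \<bar>q t\<bar>)"

definition l1_norm :: "(real \<Rightarrow> real) \<Rightarrow> real" where
  "l1_norm q = (LINT t|lebesgue. \<bar>q t\<bar>)"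

text \<open>The kernel solves m'' + 2 i z m' = q m, the equation satisfied by a solution divided by
  exp (i z x), under the conditions m -> 1 and m' -> 0 at +infinity. The exponential kernel of
  \<open>volterra_exp\<close> below is minus its derivative in x.\<close>

definition volterra_kernel :: "complex \<Rightarrow> real \<Rightarrow> complex" where
  "volterra_kernel z s = (exp (2 * \<i> * z * of_real s) - 1) / (2 * \<i> * z)"

definition volterra :: "(real \<Rightarrow> real) \<Rightarrow> complex \<Rightarrow> (real \<Rightarrow> complex) \<Rightarrow> real \<Rightarrow> complex" where
  "volterra q z f x = (LINT t:{x..}|lebesgue. volterra_kernel z (t - x) * (of_real (q t) * f t))"

definition volterra_exp :: "(real \<Rightarrow> real) \<Rightarrow> complex \<Rightarrow> (real \<Rightarrow> complex) \<Rightarrow> real \<Rightarrow> complex" where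
  "volterra_exp q z f x = (LINT t:{x..}|lebesgue. exp (2 * \<i> * z * of_real (t - x)) * (of_real (q t) * f t))"

primrec jost_term :: "(real \<Rightarrow> real) \<Rightarrow> complex \<Rightarrow> nat \<Rightarrow> real \<Rightarrow> complex" where
  "jost_term q z 0 = (\<lambda>x. 1)"
| "jost_term q z (Suc n) = volterra q z (jost_term q z n)"

text \<open>The right Jost solution divided by \<open>exp (i z x)\<close>, and its derivative in \<open>x\<close>.\<close>

definition jost_mod :: "(real \<Rightarrow> real) \<Rightarrow> complex \<Rightarrow> real \<Rightarrow> complex" where
  "jost_mod q z x = (\<Sum>n. jost_term q z n x)"

definition jost_mod_deriv :: "(real \<Rightarrow> real) \<Rightarrow> complex \<Rightarrow> real \<Rightarrow> complex" where
  "jost_mod_deriv q z x = - volterra_exp q z (jost_mod q z) x"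

lemma norm_exp_i_le_1: "0 \<le> Im z \<Longrightarrow> 0 \<le> s \<Longrightarrow> cmod (exp (2 * \<i> * z * of_real s)) \<le> 1"
  by simp

text \<open>The kernel is also bounded by s, uniformly in z, but that bound would lead to integrals
  of |t| |q t|. The price of the present one is that all later estimates degenerate as z tends to
  0.\<close>

lemma norm_volterra_kernel_le:
  assumes "0 \<le> Im z" "z \<noteq> 0" "0 \<le> s"
  shows "cmod (volterra_kernel z s) \<le> 1 / cmod z"
proof -
  have "cmod (exp (2 * \<i> * z * of_real s) - 1) \<le> 2"
    using norm_triangle_ineq4[of "exp (2 * \<i> * z * of_real s)" 1] norm_exp_i_le_1[OF assms(1,3)]
    unfolding norm_one by linarith
  then have "cmod (volterra_kernel z s) \<le> 2 / cmod (2 * \<i> * z)"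
    unfolding volterra_kernel_def norm_divide by (intro divide_right_mono) auto
  then show ?thesis by (simp add: norm_mult)
qed

lemma continuous_volterra_kernel: "continuous_on UNIV (\<lambda>t. volterra_kernel z (t - x))"
  unfolding volterra_kernel_def divide_inverse by (intro continuous_intros)

section \<open>Integrals against the potential and convergence of the series\<close>

context
  fixes q :: "real \<Rightarrow> real"
  assumes q: "integrable lebesgue q"
begin

lemma q_measurable: "q \<in> borel_measurable lebesgue"
  using q by auto

lemma abs_q_integrable: "integrable lebesgue (\<lambda>t. \<bar>q t\<bar>)"
  using integrable_norm[OF q] by simp

lemma abs_q_set_integrable: "A \<in> sets lebesgue \<Longrightarrow> set_integrable lebesgue A (\<lambda>t. \<bar>q t\<bar>)"
  unfolding set_integrable_def by (rule integrable_mult_indicator[OF _ abs_q_integrable])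

lemma l1_tail_nonneg: "0 \<le> l1_tail q x"
  unfolding l1_tail_def set_lebesgue_integral_def by (rule Bochner_Integration.integral_nonneg) simp

lemma l1_tail_le: "l1_tail q x \<le> l1_norm q"
  unfolding l1_tail_def l1_norm_def set_lebesgue_integral_def
  by (rule Bochner_Integration.integral_mono)
     (auto simp: abs_q_integrable indicator_def intro!: integrable_mult_indicator[OF _ abs_q_integrable, of "{x..}", simplified])

lemma l1_norm_nonneg: "0 \<le> l1_norm q"
  using l1_tail_nonneg[of 0] l1_tail_le[of 0] by linarith

lemma l1_tail_tendsto_0: "(l1_tail q \<longlongrightarrow> 0) at_top"
  using tail_integral_tendsto_0[OF abs_q_set_integrable[of "{0..}"]] by (simp add: l1_tail_def[abs_def])

lemma lac_l1_tail: "loc_abs_cont_deriv (\<lambda>x. of_real (l1_tail q x)) (\<lambda>x. - of_real \<bar>q x\<bar>)"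
proof -
  have "integrable lebesgue (\<lambda>t. complex_of_real \<bar>q t\<bar>)"
    by (rule integrable_of_real[OF abs_q_integrable])
  then have "set_integrable lebesgue {x..} (\<lambda>t. complex_of_real \<bar>q t\<bar>)" for x
    unfolding set_integrable_def by (intro integrable_mult_indicator) auto
  then have "loc_abs_cont_deriv (\<lambda>x. LINT t:{x..}|lebesgue. complex_of_real \<bar>q t\<bar>) (\<lambda>x. - of_real \<bar>q x\<bar>)"
    by (rule lac_tail_integral)
  then show ?thesis by (simp only: l1_tail_def set_integral_complex_of_real)
qed

lemma continuous_l1_tail: "continuous_on UNIV (l1_tail q)"
  using continuous_on_Re[OF lac_continuous_on[OF lac_l1_tail, of UNIV]] by simp

lemma mult_q_integrable:
  assumes g: "g \<in> borel_measurable lebesgue" and b: "\<And>t. t \<in> A \<Longrightarrow> cmod (g t) \<le> B" and A: "A \<in> sets lebesgue"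
  shows "set_integrable lebesgue A (\<lambda>t. g t * of_real (q t))"
  unfolding set_integrable_def
proof (rule Bochner_Integration.integrable_bound[of _ "\<lambda>t. \<bar>B\<bar> * \<bar>q t\<bar>"])
  show "integrable lebesgue (\<lambda>t. \<bar>B\<bar> * \<bar>q t\<bar>)" using abs_q_integrable by simp
  show "(\<lambda>x. indicator A x *\<^sub>R (g x * complex_of_real (q x))) \<in> borel_measurable lebesgue"
    using g q_measurable A by measurable
  show "AE x in lebesgue. norm (indicator A x *\<^sub>R (g x * complex_of_real (q x))) \<le> norm (\<bar>B\<bar> * \<bar>q x\<bar>)"
  proof (rule AE_I2)
    fix x show "norm (indicator A x *\<^sub>R (g x * complex_of_real (q x))) \<le> norm (\<bar>B\<bar> * \<bar>q x\<bar>)"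
    proof (cases "x \<in> A")
      case True
      then have "cmod (g x) * \<bar>q x\<bar> \<le> \<bar>B\<bar> * \<bar>q x\<bar>" using b[of x] by (intro mult_right_mono) auto
      then show ?thesis using True by (simp add: norm_mult abs_mult)
    qed simp
  qed
qed

lemma norm_set_integral_mult_q_le:
  assumes g: "g \<in> borel_measurable lebesgue" and b: "\<And>t. t \<ge> x \<Longrightarrow> cmod (g t) \<le> B"
  shows "cmod (LINT t:{x..}|lebesgue. g t * of_real (q t)) \<le> B * l1_tail q x"
proof -
  have "cmod (LINT t:{x..}|lebesgue. g t * of_real (q t)) \<le> (LINT t:{x..}|lebesgue. B * \<bar>q t\<bar>)"
    unfolding set_lebesgue_integral_def
  proof (rule Bochner_Integration.integral_norm_bound_integral)
    show "integrable lebesgue (\<lambda>t. indicat_real {x..} t *\<^sub>R (g t * complex_of_real (q t)))"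
      using mult_q_integrable[OF g, of "{x..}" B] b by (auto simp: set_integrable_def)
    show "integrable lebesgue (\<lambda>t. indicat_real {x..} t *\<^sub>R (B * \<bar>q t\<bar>))"
      by (rule integrable_mult_indicator) (use abs_q_integrable in auto)
    fix t show "norm (indicat_real {x..} t *\<^sub>R (g t * complex_of_real (q t))) \<le> indicat_real {x..} t *\<^sub>R (B * \<bar>q t\<bar>)"
      using b[of t] by (cases "t \<ge> x") (auto simp: norm_mult intro: mult_right_mono)
  qed
  then show ?thesis by (simp add: l1_tail_def)
qed

text \<open>Since |q| is minus the derivative of \<open>l1_tail q\<close>, the integrand is minus
  the derivative of the tail to the power n + 1, divided by n + 1. Hence the difference of the two
  sides is constant in x, and it tends to 0 at +infinity. The divisor n + 1 produces the factorials
  in the bounds of the series.\<close>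

lemma tail_power_integral:
  "set_integrable lebesgue {x..} (\<lambda>t. \<bar>q t\<bar> * l1_tail q t ^ n)"
  "(LINT t:{x..}|lebesgue. \<bar>q t\<bar> * l1_tail q t ^ n) = l1_tail q x ^ Suc n / Suc n"
proof -
  show int: "set_integrable lebesgue {x..} (\<lambda>t. \<bar>q t\<bar> * l1_tail q t ^ n)" for x
    unfolding set_integrable_def
  proof (rule Bochner_Integration.integrable_bound[of _ "\<lambda>t. l1_norm q ^ n * \<bar>q t\<bar>"])
    show "integrable lebesgue (\<lambda>t. l1_norm q ^ n * \<bar>q t\<bar>)" using abs_q_integrable by simp
    have "l1_tail q \<in> borel_measurable lebesgue"
      by (rule borel_measurable_lebesgue_continuous[OF continuous_l1_tail])
    then show "(\<lambda>t. indicat_real {x..} t *\<^sub>R (\<bar>q t\<bar> * l1_tail q t ^ n)) \<in> borel_measurable lebesgue"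
      using q_measurable
      by (intro borel_measurable_scaleR borel_measurable_indicator borel_measurable_times
          borel_measurable_power borel_measurable_abs) auto
    have *: "l1_tail q t ^ n \<le> l1_norm q ^ n" for t
      by (rule power_mono[OF l1_tail_le l1_tail_nonneg])
    show "AE t in lebesgue. norm (indicat_real {x..} t *\<^sub>R (\<bar>q t\<bar> * l1_tail q t ^ n)) \<le> norm (l1_norm q ^ n * \<bar>q t\<bar>)"
    proof (rule AE_I2)
      fix t
      have "\<bar>q t\<bar> * l1_tail q t ^ n \<le> l1_norm q ^ n * \<bar>q t\<bar>"
        using mult_left_mono[OF *[of t], of "\<bar>q t\<bar>"] by (simp add: mult.commute)
      then show "norm (indicat_real {x..} t *\<^sub>R (\<bar>q t\<bar> * l1_tail q t ^ n)) \<le> norm (l1_norm q ^ n * \<bar>q t\<bar>)"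
        using l1_tail_nonneg[of t] l1_norm_nonneg by (auto simp: indicator_def abs_mult)
    qed
  qed
  have pw: "loc_abs_cont_deriv (\<lambda>x. of_real (l1_tail q x ^ Suc n)) (\<lambda>x. - of_real (real (Suc n) * (\<bar>q x\<bar> * l1_tail q x ^ n)))" for n
  proof (induction n)
    case 0
    then show ?case using lac_l1_tail by simp
  next
    case (Suc n)
    show ?case by (rule lac_transform[OF lac_mult[OF lac_l1_tail Suc]]) (simp_all add: algebra_simps)
  qed
  define D where "D = (\<lambda>x. (LINT t:{x..}|lebesgue. \<bar>q t\<bar> * l1_tail q t ^ n) - l1_tail q x ^ Suc n / Suc n)"
  have "D x = D b" if "x \<le> b" for x b
  proof -
    have "((\<lambda>x. - complex_of_real (real (Suc n) * (\<bar>q x\<bar> * l1_tail q x ^ n))) has_integral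
       of_real (l1_tail q b ^ Suc n) - of_real (l1_tail q x ^ Suc n)) {x..b}"
      using pw[of n] that unfolding loc_abs_cont_deriv_def by blast
    from has_integral_linear[OF this bounded_linear_Re]
    have "((\<lambda>x. - (real (Suc n) * (\<bar>q x\<bar> * l1_tail q x ^ n))) has_integral l1_tail q b ^ Suc n - l1_tail q x ^ Suc n) {x..b}"
      by (simp only: o_def minus_complex.sel uminus_complex.sel Re_complex_of_real)
    from has_integral_mult_right[OF this, of "- 1 / real (Suc n)"]
    have "((\<lambda>x. - 1 / real (Suc n) * - (real (Suc n) * (\<bar>q x\<bar> * l1_tail q x ^ n))) has_integral
      - 1 / real (Suc n) * (l1_tail q b ^ Suc n - l1_tail q x ^ Suc n)) {x..b}" .
    moreover have "- 1 / real (Suc n) * - (real (Suc n) * w) = w" for w by (simp del: of_nat_Suc)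
    moreover have "- 1 / real (Suc n) * (v - w) = (w - v) / Suc n" for v w by (simp add: diff_divide_distrib del: of_nat_Suc)
    ultimately have "((\<lambda>x. \<bar>q x\<bar> * l1_tail q x ^ n) has_integral (l1_tail q x ^ Suc n - l1_tail q b ^ Suc n) / Suc n) {x..b}"
      by (simp only:)
    then show ?thesis
      unfolding D_def tail_integral_split[OF int that] by (simp add: integral_unique diff_divide_distrib)
  qed
  then have "\<forall>\<^sub>F b in at_top. D b = D x"
    by (intro eventually_mono[OF eventually_ge_at_top[of x]]) metis
  then have "(D \<longlongrightarrow> D x) at_top" using tendsto_eventually by blast
  moreover have "(D \<longlongrightarrow> 0 - 0 ^ Suc n / real (Suc n)) at_top"
    unfolding D_def by (intro tendsto_intros tail_integral_tendsto_0[OF int] l1_tail_tendsto_0) simp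
  ultimately have "D x = 0" using tendsto_unique[OF trivial_limit_at_top_linorder] by fastforce
  then show "(LINT t:{x..}|lebesgue. \<bar>q t\<bar> * l1_tail q t ^ n) = l1_tail q x ^ Suc n / Suc n"
    by (simp add: D_def)
qed

text \<open>The kernel exp (2 i z (t - x)) splits into a factor in x and a factor in t, so that
  \<open>volterra_exp\<close> is an exponential times a tail integral and the product rule applies.
  The third claim writes \<open>volterra\<close> through \<open>volterra_exp\<close> and a plain
  tail integral, from which the second follows.\<close>

lemma lac_volterra:
  assumes z: "0 \<le> Im z" "z \<noteq> 0" and f: "continuous_on UNIV f" "\<And>x. cmod (f x) \<le> B"
  shows "loc_abs_cont_deriv (volterra_exp q z f) (\<lambda>x. - (of_real (q x) * f x) - 2 * \<i> * z * volterra_exp q z f x)"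
    and "loc_abs_cont_deriv (volterra q z f) (\<lambda>x. - volterra_exp q z f x)"
    and "2 * \<i> * z * volterra q z f x = volterra_exp q z f x - (LINT t:{x..}|lebesgue. of_real (q t) * f t)"
proof -
  have fm: "f \<in> borel_measurable lebesgue" by (rule borel_measurable_lebesgue_continuous[OF f(1)])
  have em: "(\<lambda>t. exp (2 * \<i> * z * of_real (t - x))) \<in> borel_measurable lebesgue" for x
    by (rule borel_measurable_lebesgue_continuous) (intro continuous_intros)
  have i1: "set_integrable lebesgue {x..} (\<lambda>t. of_real (q t) * f t)" for x
    using mult_q_integrable[OF fm, of "{x..}" B] f(2) by (simp add: mult.commute)
  have i2: "set_integrable lebesgue {x..} (\<lambda>t. exp (2 * \<i> * z * of_real (t - x)) * (of_real (q t) * f t))" for x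
  proof -
    have "cmod (exp (2 * \<i> * z * of_real (t - x)) * f t) \<le> 1 * B" if "t \<in> {x..}" for t
      unfolding norm_mult using that z f(2) norm_exp_i_le_1[OF z(1), of "t - x"] by (intro mult_mono) auto
    from mult_q_integrable[where A = "{x..}" and B = "1 * B", OF borel_measurable_times[OF em fm] this]
    show ?thesis by (simp only: mult_ac) simp
  qed
  have e: "exp (2 * \<i> * z * of_real (t - x)) = exp (2 * \<i> * z * of_real t) * exp (- (2 * \<i> * z * of_real x))" for t x
    by (simp add: exp_diff exp_minus divide_inverse algebra_simps)
  have i3: "set_integrable lebesgue {x..} (\<lambda>t. exp (2 * \<i> * z * of_real t) * (of_real (q t) * f t))" for x
  proof -
    have "set_integrable lebesgue {x..} (\<lambda>t. exp (2 * \<i> * z * of_real x) * (exp (2 * \<i> * z * of_real (t - x)) * (of_real (q t) * f t)))"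
      by (rule set_integrable_mult_right) (use i2 in simp)
    moreover have "exp (2 * \<i> * z * of_real x) * (exp (2 * \<i> * z * of_real (t - x)) * (of_real (q t) * f t)) =
        exp (2 * \<i> * z * of_real t) * (of_real (q t) * f t)" for t
      unfolding e by (simp add: exp_minus field_simps)
    ultimately show ?thesis by (simp only:)
  qed
  have E: "volterra_exp q z f x = exp (- (2 * \<i> * z * of_real x)) * (LINT t:{x..}|lebesgue. exp (2 * \<i> * z * of_real t) * (of_real (q t) * f t))" for x
  proof -
    have "volterra_exp q z f x = (LINT t:{x..}|lebesgue. exp (- (2 * \<i> * z * of_real x)) * (exp (2 * \<i> * z * of_real t) * (of_real (q t) * f t)))"
      unfolding volterra_exp_def e by (simp add: mult_ac)
    then show ?thesis by simp
  qed
  have lacE: "loc_abs_cont_deriv (\<lambda>x. exp (- (2 * \<i> * z * of_real x))) (\<lambda>x. - 2 * \<i> * z * exp (- (2 * \<i> * z * of_real x)))"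
    by (rule lac_transform[OF lac_exp_linear[of "- 2 * \<i> * z"]]) simp_all
  have inv: "exp (- (2 * \<i> * z * of_real x)) * (exp (2 * \<i> * z * of_real x) * w) = w" for x w
    by (simp add: exp_minus)
  show L1: "loc_abs_cont_deriv (volterra_exp q z f) (\<lambda>x. - (of_real (q x) * f x) - 2 * \<i> * z * volterra_exp q z f x)"
  proof (rule lac_transform[OF lac_mult[OF lacE lac_tail_integral[OF i3]]])
    have alg: "- 2 * \<i> * z * e1 * L + e1 * (- (e2 * w)) = - w - 2 * \<i> * z * (e1 * L)" if "e1 * (e2 * w) = w" for e1 e2 L w
      using that by (simp add: mult.assoc)
    show "- 2 * \<i> * z * exp (- (2 * \<i> * z * of_real x)) * (LINT t:{x..}|lebesgue. exp (2 * \<i> * z * of_real t) * (of_real (q t) * f t)) +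
        exp (- (2 * \<i> * z * of_real x)) * - (exp (2 * \<i> * z * of_real x) * (of_real (q x) * f x)) =
        - (of_real (q x) * f x) - 2 * \<i> * z * volterra_exp q z f x" for x
      unfolding E by (rule alg[OF inv])
  qed (simp only: E)
  have S: "2 * \<i> * z * volterra q z f x = volterra_exp q z f x - (LINT t:{x..}|lebesgue. of_real (q t) * f t)" for x
  proof -
    have "2 * \<i> * z * volterra q z f x = (LINT t:{x..}|lebesgue. 2 * \<i> * z * (volterra_kernel z (t - x) * (of_real (q t) * f t)))"
      unfolding volterra_def by simp
    also have "\<dots> = (LINT t:{x..}|lebesgue. exp (2 * \<i> * z * of_real (t - x)) * (of_real (q t) * f t) - of_real (q t) * f t)"
    proof -
      have "2 * \<i> * z * (volterra_kernel z s * w) = exp (2 * \<i> * z * of_real s) * w - w" for s w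
        using z by (simp add: volterra_kernel_def left_diff_distrib)
      then show ?thesis by (simp only:)
    qed
    finally show ?thesis
      unfolding volterra_exp_def using set_integral_diff(2)[OF i2 i1] by simp
  qed
  show "2 * \<i> * z * volterra q z f x = volterra_exp q z f x - (LINT t:{x..}|lebesgue. of_real (q t) * f t)"
    by (rule S)
  have V: "volterra q z f = (\<lambda>x. (1 / (2 * \<i> * z)) * (volterra_exp q z f x - (LINT t:{x..}|lebesgue. of_real (q t) * f t)))"
    unfolding S[symmetric] using z by simp
  show "loc_abs_cont_deriv (volterra q z f) (\<lambda>x. - volterra_exp q z f x)"
    unfolding V using lac_cmult[OF lac_diff[OF L1 lac_tail_integral[OF i1]], of "1 / (2 * \<i> * z)"] z by simp
qed

text \<open>Each integration against |q| raises the power of the tail by one and divides by n + 1,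
  by \<open>tail_power_integral\<close>; the kernel contributes 1 / |z|.\<close>

lemma jost_term_bound:
  assumes z: "0 \<le> Im z" "z \<noteq> 0"
  shows "continuous_on UNIV (jost_term q z n) \<and> (\<forall>x. cmod (jost_term q z n x) \<le> (l1_tail q x / cmod z) ^ n / fact n)"
proof (induction n)
  case 0
  then show ?case by (simp)
next
  case (Suc n)
  have jc: "continuous_on UNIV (jost_term q z n)" and jb: "\<And>x. cmod (jost_term q z n x) \<le> (l1_tail q x / cmod z) ^ n / fact n"
    using Suc by auto
  have gb: "cmod (jost_term q z n x) \<le> (l1_norm q / cmod z) ^ n / fact n" for x
    by (rule order_trans[OF jb]) (use l1_tail_nonneg l1_tail_le in \<open>auto intro!: divide_right_mono power_mono\<close>)
  have c: "continuous_on UNIV (volterra q z (jost_term q z n))"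
    by (rule lac_continuous_on[OF lac_volterra(2)[OF z jc gb]])
  have "cmod (volterra q z (jost_term q z n) x) \<le> (l1_tail q x / cmod z) ^ Suc n / fact (Suc n)" for x
  proof -
    define C where "C = 1 / (cmod z ^ Suc n * fact n)"
    have "cmod (volterra q z (jost_term q z n) x) \<le> (LINT t:{x..}|lebesgue. C * (\<bar>q t\<bar> * l1_tail q t ^ n))"
      unfolding volterra_def set_lebesgue_integral_def
    proof (rule Bochner_Integration.integral_norm_bound_integral)
      let ?F = "\<lambda>t. indicat_real {x..} t *\<^sub>R (volterra_kernel z (t - x) * (complex_of_real (q t) * jost_term q z n t))"
      let ?G = "\<lambda>t. indicat_real {x..} t *\<^sub>R (C * (\<bar>q t\<bar> * l1_tail q t ^ n))"
      show Gi: "integrable lebesgue ?G"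
        using set_integrable_mult_right[OF tail_power_integral(1)[of x n], of C] by (simp add: set_integrable_def)
      show le: "norm (?F t) \<le> ?G t" for t
      proof (cases "t \<ge> x")
        case True
        have "cmod (volterra_kernel z (t - x) * (complex_of_real (q t) * jost_term q z n t))
          \<le> (1 / cmod z) * (\<bar>q t\<bar> * ((l1_tail q t / cmod z) ^ n / fact n))"
          unfolding norm_mult norm_of_real using True norm_volterra_kernel_le[OF z, of "t - x"] jb[of t]
          by (intro mult_mono mult_nonneg_nonneg) auto
        also have "\<dots> = C * (\<bar>q t\<bar> * l1_tail q t ^ n)" by (simp add: C_def power_divide)
        finally show ?thesis using True by simp
      qed simp
      show "integrable lebesgue ?F"
      proof (rule Bochner_Integration.integrable_bound[OF Gi])
        have "(\<lambda>t. volterra_kernel z (t - x)) \<in> borel_measurable lebesgue"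
          by (rule borel_measurable_lebesgue_continuous[OF continuous_volterra_kernel])
        then show "?F \<in> borel_measurable lebesgue"
          using q_measurable borel_measurable_lebesgue_continuous[OF jc]
          by (intro borel_measurable_scaleR borel_measurable_indicator borel_measurable_times borel_measurable_of_real) auto
        show "AE t in lebesgue. norm (?F t) \<le> norm (?G t)"
          by (rule AE_I2) (rule order_trans[OF le], simp)
      qed
    qed
    also have "\<dots> = C * (l1_tail q x ^ Suc n / Suc n)" by (simp add: tail_power_integral(2) del: power_Suc of_nat_Suc)
    also have "\<dots> = (l1_tail q x / cmod z) ^ Suc n / fact (Suc n)"
      by (simp add: C_def power_divide field_simps)
    finally show ?thesis .
  qed
  then show ?case using c by simp
qed

lemma continuous_jost_term: "0 \<le> Im z \<Longrightarrow> z \<noteq> 0 \<Longrightarrow> continuous_on UNIV (jost_term q z n)"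
  using jost_term_bound by blast

lemma norm_jost_term_le:
  "0 \<le> Im z \<Longrightarrow> z \<noteq> 0 \<Longrightarrow> cmod (jost_term q z n x) \<le> (l1_tail q x / cmod z) ^ n / fact n"
  using jost_term_bound by blast

lemma norm_jost_term_le':
  assumes "0 \<le> Im z" "r > 0" "r \<le> cmod z"
  shows "cmod (jost_term q z n x) \<le> (l1_norm q / r) ^ n / fact n"
proof -
  have "l1_tail q x / cmod z \<le> l1_norm q / r"
    using assms l1_tail_le l1_norm_nonneg by (intro frac_le) auto
  moreover have "z \<noteq> 0" using assms by auto
  ultimately show ?thesis
    using l1_tail_nonneg by (intro order_trans[OF norm_jost_term_le[OF assms(1)]] divide_right_mono power_mono) auto
qed

lemma summable_exp_series: "summable (\<lambda>n. (c::real) ^ n / fact n)"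
  using summable_exp[of c] by (simp add: field_simps)

lemma suminf_exp_series: "(\<Sum>n. (c::real) ^ n / fact n) = exp c"
  unfolding exp_def by (simp add: field_simps)

lemma summable_jost_term:
  assumes "0 \<le> Im z" "z \<noteq> 0"
  shows "summable (\<lambda>n. jost_term q z n x)"
  by (rule summable_comparison_test'[OF summable_exp_series[of "l1_tail q x / cmod z"]]) (rule norm_jost_term_le[OF assms])

lemma norm_jost_mod_minus_1:
  assumes z: "0 \<le> Im z" "z \<noteq> 0"
  shows "cmod (jost_mod q z x - 1) \<le> exp (l1_tail q x / cmod z) - 1"
proof -
  note s = summable_jost_term[OF z, of x]
  note e = summable_exp_series[of "l1_tail q x / cmod z"]
  have "jost_mod q z x - 1 = (\<Sum>n. jost_term q z (Suc n) x)"
    unfolding jost_mod_def using suminf_split_initial_segment[OF s, of 1] by simp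
  also have "cmod \<dots> \<le> (\<Sum>n. (l1_tail q x / cmod z) ^ Suc n / fact (Suc n))"
    by (rule norm_suminf_le[OF norm_jost_term_le[OF z] summable_Suc_iff[THEN iffD2, OF e]])
  also have "\<dots> = exp (l1_tail q x / cmod z) - 1"
    using suminf_split_initial_segment[OF e, of 1] by (simp add: suminf_exp_series del: power_Suc fact_Suc)
  finally show ?thesis .
qed

lemma norm_jost_mod_le:
  assumes z: "0 \<le> Im z" "z \<noteq> 0"
  shows "cmod (jost_mod q z x) \<le> exp (l1_tail q x / cmod z)"
  using norm_jost_mod_minus_1[OF z, of x] norm_triangle_ineq[of "jost_mod q z x - 1" 1] by simp

lemma norm_jost_mod_le':
  assumes "0 \<le> Im z" "r > 0" "r \<le> cmod z"
  shows "cmod (jost_mod q z x) \<le> exp (l1_norm q / r)"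
proof -
  have "l1_tail q x / cmod z \<le> l1_norm q / r"
    using assms l1_tail_le l1_norm_nonneg by (intro frac_le) auto
  moreover have "z \<noteq> 0" using assms by auto
  ultimately show ?thesis by (intro order_trans[OF norm_jost_mod_le[OF assms(1)]]) auto
qed

lemma uniform_limit_jost_mod:
  assumes "r > 0" "\<And>i. i \<in> I \<Longrightarrow> 0 \<le> Im (\<zeta> i)" "\<And>i. i \<in> I \<Longrightarrow> r \<le> cmod (\<zeta> i)"
  shows "uniform_limit I (\<lambda>N i. \<Sum>n<N. jost_term q (\<zeta> i) n (\<xi> i)) (\<lambda>i. jost_mod q (\<zeta> i) (\<xi> i)) sequentially"
  unfolding jost_mod_def
  by (rule Weierstrass_m_test[OF _ summable_exp_series[of "l1_norm q / r"]]) (use assms norm_jost_term_le' in auto)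

lemma continuous_jost_mod:
  assumes z: "0 \<le> Im z" "z \<noteq> 0"
  shows "continuous_on UNIV (jost_mod q z)"
proof (rule uniform_limit_theorem)
  show "uniform_limit UNIV (\<lambda>N x. \<Sum>n<N. jost_term q z n x) (jost_mod q z) sequentially"
    using uniform_limit_jost_mod[of "cmod z" UNIV "\<lambda>_. z" "\<lambda>x. x"] z by simp
  show "\<forall>\<^sub>F N in sequentially. continuous_on UNIV (\<lambda>x. \<Sum>n<N. jost_term q z n x)"
    by (intro always_eventually allI continuous_on_sum continuous_jost_term z)
qed simp

text \<open>The integral operator shifts the series by one term. Its n-th integrand is dominated by
  c^n / n! times |q| / |z|, whose integrals are summable, so the operator may be applied
  termwise.\<close>

lemma jost_mod_volterra:
  assumes z: "0 \<le> Im z" "z \<noteq> 0"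
  shows "jost_mod q z x = 1 + volterra q z (jost_mod q z) x"
proof -
  define F where "F = (\<lambda>n t. indicat_real {x..} t *\<^sub>R (volterra_kernel z (t - x) * (of_real (q t) * jost_term q z n t)))"
  define c where "c = l1_norm q / cmod z"
  have km: "(\<lambda>t. volterra_kernel z (t - x)) \<in> borel_measurable lebesgue"
    by (rule borel_measurable_lebesgue_continuous[OF continuous_volterra_kernel])
  have Fb: "norm (F n t) \<le> (c ^ n / fact n) * (\<bar>q t\<bar> / cmod z)" for n t
  proof (cases "t \<ge> x")
    case True
    have "norm (F n t) = cmod (volterra_kernel z (t - x)) * (\<bar>q t\<bar> * cmod (jost_term q z n t))"
      using True by (simp add: F_def norm_mult)
    also have "\<dots> \<le> (1 / cmod z) * (\<bar>q t\<bar> * (c ^ n / fact n))"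
      using True norm_volterra_kernel_le[OF z, of "t - x"] norm_jost_term_le'[OF z(1), of "cmod z" n t] z(2)
      unfolding c_def by (intro mult_mono mult_nonneg_nonneg) auto
    finally have "norm (F n t) \<le> (1 / cmod z) * (\<bar>q t\<bar> * (c ^ n / fact n))" .
    then show ?thesis by (simp add: mult_ac)
  next
    case False
    then show ?thesis using l1_norm_nonneg by (simp add: F_def c_def)
  qed
  have Fi: "integrable lebesgue (F n)" for n
  proof (rule Bochner_Integration.integrable_bound[of _ "\<lambda>t. (c ^ n / fact n) * (\<bar>q t\<bar> / cmod z)"])
    show "integrable lebesgue (\<lambda>t. (c ^ n / fact n) * (\<bar>q t\<bar> / cmod z))" using abs_q_integrable by simp
    show "F n \<in> borel_measurable lebesgue"
      unfolding F_def using km q_measurable borel_measurable_lebesgue_continuous[OF continuous_jost_term[OF z]]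
      by (intro borel_measurable_scaleR borel_measurable_indicator borel_measurable_times borel_measurable_of_real) auto
    show "AE t in lebesgue. norm (F n t) \<le> norm ((c ^ n / fact n) * (\<bar>q t\<bar> / cmod z))"
      by (rule AE_I2) (rule order_trans[OF Fb], simp only: real_norm_def abs_ge_self)
  qed
  have sF: "summable (\<lambda>n. norm (F n t))" for t
    by (rule summable_comparison_test'[OF summable_mult2[OF summable_exp_series[of c], of "\<bar>q t\<bar> / cmod z"]])
       (use Fb in simp)
  have sI: "summable (\<lambda>n. LINT t|lebesgue. norm (F n t))"
  proof (rule summable_comparison_test'[OF summable_mult2[OF summable_exp_series[of c], of "l1_norm q / cmod z"]])
    fix n
    have "(LINT t|lebesgue. norm (F n t)) \<le> (LINT t|lebesgue. (c ^ n / fact n) * (\<bar>q t\<bar> / cmod z))"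
      using Fi Fb abs_q_integrable by (intro Bochner_Integration.integral_mono) auto
    also have "\<dots> = (c ^ n / fact n) * (l1_norm q / cmod z)" by (simp add: l1_norm_def)
    finally show "norm (LINT t|lebesgue. norm (F n t)) \<le> (c ^ n / fact n) * (l1_norm q / cmod z)"
      by (simp add: Bochner_Integration.integral_nonneg)
  qed
  have "(LINT t|lebesgue. (\<Sum>n. F n t)) = (\<Sum>n. LINT t|lebesgue. F n t)"
    using Fi sF sI by (intro integral_suminf) auto
  moreover have "(\<Sum>n. F n t) = indicat_real {x..} t *\<^sub>R (volterra_kernel z (t - x) * (of_real (q t) * jost_mod q z t))" for t
    unfolding F_def jost_mod_def
    by (cases "t \<ge> x") (simp_all add: suminf_mult summable_mult summable_jost_term[OF z, of t])
  ultimately have "volterra q z (jost_mod q z) x = (\<Sum>n. jost_term q z (Suc n) x)"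
    by (simp add: volterra_def set_lebesgue_integral_def F_def)
  then show ?thesis
    unfolding jost_mod_def[of q z x] using suminf_split_initial_segment[OF summable_jost_term[OF z], of x 1] by simp
qed

text \<open>In the third identity the exponential kernel has disappeared: 2 i z m + m' is a constant
  minus the tail integral of q m. Both the limit at -infinity and the growth estimates near z = 0
  rest on this combination.\<close>

lemma lac_jost_mod:
  assumes z: "0 \<le> Im z" "z \<noteq> 0"
  shows "loc_abs_cont_deriv (jost_mod q z) (jost_mod_deriv q z)"
    and "loc_abs_cont_deriv (jost_mod_deriv q z) (\<lambda>x. of_real (q x) * jost_mod q z x - 2 * \<i> * z * jost_mod_deriv q z x)"
    and "2 * \<i> * z * jost_mod q z x + jost_mod_deriv q z x = 2 * \<i> * z - (LINT t:{x..}|lebesgue. of_real (q t) * jost_mod q z t)"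
proof -
  have b: "cmod (jost_mod q z x) \<le> exp (l1_norm q / cmod z)" for x
    using norm_jost_mod_le'[of z "cmod z" x] z by simp
  note L = lac_volterra[OF z continuous_jost_mod[OF z] b]
  have eq: "jost_mod q z = (\<lambda>x. 1 + volterra q z (jost_mod q z) x)"
    using jost_mod_volterra[OF z] by blast
  show "loc_abs_cont_deriv (jost_mod q z) (jost_mod_deriv q z)"
    by (subst eq) (use lac_add[OF lac_const[of 1] L(2)] in \<open>simp add: jost_mod_deriv_def[abs_def]\<close>)
  show "loc_abs_cont_deriv (jost_mod_deriv q z) (\<lambda>x. of_real (q x) * jost_mod q z x - 2 * \<i> * z * jost_mod_deriv q z x)"
    using lac_minus[OF L(1)] by (simp add: jost_mod_deriv_def[abs_def] add.commute)
  show "2 * \<i> * z * jost_mod q z x + jost_mod_deriv q z x = 2 * \<i> * z - (LINT t:{x..}|lebesgue. of_real (q t) * jost_mod q z t)"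
    using L(3)[of x] jost_mod_volterra[OF z, of x] by (simp add: jost_mod_deriv_def algebra_simps)
qed

lemma norm_jost_mod_deriv_le:
  assumes z: "0 \<le> Im z" "z \<noteq> 0"
  shows "cmod (jost_mod_deriv q z x) \<le> exp (l1_norm q / cmod z) * l1_tail q x"
proof -
  define g where "g = (\<lambda>t. exp (2 * \<i> * z * of_real (t - x)) * jost_mod q z t)"
  have "g \<in> borel_measurable lebesgue" unfolding g_def
    by (rule borel_measurable_lebesgue_continuous) (intro continuous_intros continuous_jost_mod z)
  moreover have "cmod (g t) \<le> exp (l1_norm q / cmod z)" if "t \<ge> x" for t
  proof -
    have "cmod (g t) \<le> 1 * exp (l1_norm q / cmod z)"
      unfolding g_def norm_mult using norm_exp_i_le_1[OF z(1), of "t - x"] norm_jost_mod_le'[of z "cmod z" t] z that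
      by (intro mult_mono) auto
    then show ?thesis by simp
  qed
  ultimately have "cmod (LINT t:{x..}|lebesgue. g t * of_real (q t)) \<le> exp (l1_norm q / cmod z) * l1_tail q x"
    by (rule norm_set_integral_mult_q_le)
  then show ?thesis by (simp add: jost_mod_deriv_def volterra_exp_def g_def mult_ac)
qed

end

section \<open>Jost solutions\<close>

definition uhp_closed :: "complex set" where "uhp_closed = {z. 0 \<le> Im z \<and> z \<noteq> 0}"

definition uhp :: "complex set" where "uhp = {z. 0 < Im z}"

lemma open_uhp: "open uhp"
  unfolding uhp_def by (intro open_Collect_less continuous_intros)

lemma uhp_subset: "uhp \<subseteq> uhp_closed"
  by (auto simp: uhp_def uhp_closed_def)

text \<open>The estimates of the Volterra series are uniform only for \<open>r \<le> cmod z\<close>;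
  regularity is proved on these regions, which exhaust the half plane as r decreases to 0.\<close>

lemma holomorphic_on_uhpI:
  assumes "\<And>r. r > 0 \<Longrightarrow> f holomorphic_on {z. 0 < Im z \<and> r < cmod z}"
  shows "f holomorphic_on uhp"
  unfolding holomorphic_on_open[OF open_uhp]
proof
  fix z assume z: "z \<in> uhp"
  have "open {w. 0 < Im w \<and> cmod z / 2 < cmod w}"
    by (intro open_Collect_conj open_Collect_less continuous_intros)
  moreover have "cmod z > 0" using z by (auto simp: uhp_def)
  ultimately show "\<exists>f'. (f has_field_derivative f') (at z)"
    using assms[of "cmod z / 2"] z by (auto simp: holomorphic_on_open uhp_def)
qed

lemma continuous_on_uhp_closedI:
  fixes f :: "complex \<Rightarrow> complex"
  assumes "\<And>r. r > 0 \<Longrightarrow> continuous_on {z. 0 \<le> Im z \<and> r \<le> cmod z} f"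
  shows "continuous_on uhp_closed f"
  unfolding continuous_on_sequentially comp_def
proof (intro allI ballI impI)
  fix x a assume a: "a \<in> uhp_closed" and x: "(\<forall>n. x n \<in> uhp_closed) \<and> x \<longlonglongrightarrow> a"
  define r where "r = cmod a / 2"
  have r: "r > 0" using a by (auto simp: r_def uhp_closed_def)
  have "(\<lambda>n. cmod (x n)) \<longlonglongrightarrow> cmod a" using x by (intro tendsto_norm) auto
  then have "\<forall>\<^sub>F n in sequentially. r < cmod (x n)" by (rule order_tendstoD(1)) (use r in \<open>simp add: r_def\<close>)
  then obtain N where N: "\<And>n. n \<ge> N \<Longrightarrow> r < cmod (x n)" by (auto simp: eventually_sequentially)
  have "(\<lambda>n. x (n + N)) \<longlonglongrightarrow> a" using x by (simp add: LIMSEQ_ignore_initial_segment)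
  moreover have "\<forall>n. x (n + N) \<in> {z. 0 \<le> Im z \<and> r \<le> cmod z}"
    using N x by (auto simp: uhp_closed_def intro: less_imp_le)
  moreover have "a \<in> {z. 0 \<le> Im z \<and> r \<le> cmod z}" using a r by (auto simp: r_def uhp_closed_def)
  moreover have "\<forall>y. \<forall>a\<in>{z. 0 \<le> Im z \<and> r \<le> cmod z}. (\<forall>n. y n \<in> {z. 0 \<le> Im z \<and> r \<le> cmod z}) \<and> y \<longlonglongrightarrow> a \<longrightarrow> (\<lambda>n. f (y n)) \<longlonglongrightarrow> f a"
    using assms[OF r] unfolding continuous_on_sequentially comp_def .
  from spec[OF this, of "\<lambda>n. x (n + N)"] calculation have "(\<lambda>n. f (x (n + N))) \<longlonglongrightarrow> f a"
    by blast
  then show "(\<lambda>n. f (x n)) \<longlonglongrightarrow> f a" by (rule LIMSEQ_offset)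
qed

section \<open>Regularity in the spectral parameter\<close>

context
  fixes q :: "real \<Rightarrow> real"
  assumes q: "integrable lebesgue q"
begin

text \<open>Serves two kernels, \<open>volterra_kernel\<close> for the terms of the series and the
  pure exponential for the derivative. The function K C |q| dominates the integrand for all
  admissible z at once.\<close>

lemma volterra_integrand:
  assumes r: "r > 0" and km: "\<And>z. 0 \<le> Im z \<Longrightarrow> r \<le> cmod z \<Longrightarrow> (\<lambda>t. k z (t - x)) \<in> borel_measurable lebesgue"
    and kb: "\<And>z s. 0 \<le> Im z \<Longrightarrow> r \<le> cmod z \<Longrightarrow> 0 \<le> s \<Longrightarrow> cmod (k z s) \<le> K"
    and fm: "\<And>z. 0 \<le> Im z \<Longrightarrow> r \<le> cmod z \<Longrightarrow> f z \<in> borel_measurable lebesgue"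
    and fb: "\<And>z t. 0 \<le> Im z \<Longrightarrow> r \<le> cmod z \<Longrightarrow> cmod (f z t) \<le> C"
    and kc: "\<And>s. continuous_on {z. 0 \<le> Im z \<and> r \<le> cmod z} (\<lambda>z. k z s)"
    and fc: "\<And>t. continuous_on {z. 0 \<le> Im z \<and> r \<le> cmod z} (\<lambda>z. f z t)"
    and kh: "\<And>s. (\<lambda>z. k z s) holomorphic_on {z. 0 < Im z \<and> r < cmod z}"
    and fh: "\<And>t. (\<lambda>z. f z t) holomorphic_on {z. 0 < Im z \<and> r < cmod z}"
  shows "continuous_on {z. 0 \<le> Im z \<and> r \<le> cmod z} (\<lambda>z. LINT t:{x..}|lebesgue. k z (t - x) * (of_real (q t) * f z t))"
    and "(\<lambda>z. LINT t:{x..}|lebesgue. k z (t - x) * (of_real (q t) * f z t)) holomorphic_on {z. 0 < Im z \<and> r < cmod z}"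
proof -
  let ?F = "\<lambda>z t. indicat_real {x..} t *\<^sub>R (k z (t - x) * (complex_of_real (q t) * f z t))"
  have m: "?F z \<in> borel_measurable lebesgue" if "0 \<le> Im z" "r \<le> cmod z" for z
    using km[OF that] fm[OF that] q_measurable[OF q]
    by (intro borel_measurable_scaleR borel_measurable_indicator borel_measurable_times borel_measurable_of_real) auto
  have b: "cmod (?F z t) \<le> K * C * \<bar>q t\<bar>" if z: "0 \<le> Im z" "r \<le> cmod z" for z t
  proof -
    have K: "K \<ge> 0" using order_trans[OF norm_ge_zero kb[OF z order_refl]] .
    have C: "C \<ge> 0" using order_trans[OF norm_ge_zero fb[OF z]] .
    show ?thesis
    proof (cases "t \<ge> x")
      case True
      have "cmod (?F z t) = cmod (k z (t - x)) * (\<bar>q t\<bar> * cmod (f z t))" using True by (simp add: norm_mult)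
      also have "\<dots> \<le> K * (\<bar>q t\<bar> * C)"
        using True kb[OF z, of "t - x"] fb[OF z, of t] K by (intro mult_mono mult_nonneg_nonneg) auto
      finally show ?thesis by (simp add: mult_ac)
    next
      case False
      then show ?thesis using K C by simp
    qed
  qed
  have i: "integrable lebesgue (\<lambda>t. K * C * \<bar>q t\<bar>)" using abs_q_integrable[OF q] by simp
  show "continuous_on {z. 0 \<le> Im z \<and> r \<le> cmod z} (\<lambda>z. LINT t:{x..}|lebesgue. k z (t - x) * (of_real (q t) * f z t))"
    unfolding set_lebesgue_integral_def
    by (rule continuous_on_integral_dominated[OF _ _ _ i])
       (use m b in \<open>auto intro!: continuous_intros kc fc simp del: scaleR_conv_of_real\<close>)
  have op: "open {z. 0 < Im z \<and> r < cmod z}"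
    by (intro open_Collect_conj open_Collect_less continuous_intros)
  show "(\<lambda>z. LINT t:{x..}|lebesgue. k z (t - x) * (of_real (q t) * f z t)) holomorphic_on {z. 0 < Im z \<and> r < cmod z}"
    unfolding set_lebesgue_integral_def
  proof (rule holomorphic_on_integral_dominated[OF op _ _ _ i])
    show "(\<lambda>z. ?F z t) holomorphic_on {z. 0 < Im z \<and> r < cmod z}" for t
      unfolding scaleR_conv_of_real by (intro holomorphic_intros kh fh)
  qed (use m b in auto)
qed

lemma jost_term_regular:
  assumes r: "r > 0"
  shows "(\<forall>x. continuous_on {z. 0 \<le> Im z \<and> r \<le> cmod z} (\<lambda>z. jost_term q z n x)) \<and>
    (\<forall>x. (\<lambda>z. jost_term q z n x) holomorphic_on {z. 0 < Im z \<and> r < cmod z})"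
proof (induction n)
  case 0
  then show ?case by simp
next
  case (Suc n)
  have ne: "z \<noteq> 0" if "r \<le> cmod z" for z using that r by auto
  have km: "(\<lambda>t. volterra_kernel z (t - x)) \<in> borel_measurable lebesgue" for z x
    by (rule borel_measurable_lebesgue_continuous[OF continuous_volterra_kernel])
  have kb: "cmod (volterra_kernel z s) \<le> 1 / r" if z: "0 \<le> Im z" "r \<le> cmod z" and s: "0 \<le> s" for z s
  proof -
    have "1 / cmod z \<le> 1 / r" using r z by (intro frac_le) auto
    then show ?thesis using norm_volterra_kernel_le[OF z(1) ne[OF z(2)] s] by linarith
  qed
  have fm: "jost_term q z n \<in> borel_measurable lebesgue" if z: "0 \<le> Im z" "r \<le> cmod z" for z
    by (rule borel_measurable_lebesgue_continuous[OF continuous_jost_term[OF q z(1) ne[OF z(2)]]])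
  have fb: "cmod (jost_term q z n t) \<le> (l1_norm q / r) ^ n / fact n" if z: "0 \<le> Im z" "r \<le> cmod z" for z t
    by (rule norm_jost_term_le'[OF q z(1) r z(2)])
  have kc: "continuous_on {z. 0 \<le> Im z \<and> r \<le> cmod z} (\<lambda>z. volterra_kernel z s)" for s
    unfolding volterra_kernel_def by (intro continuous_intros) (use ne in auto)
  have kh: "(\<lambda>z. volterra_kernel z s) holomorphic_on {z. 0 < Im z \<and> r < cmod z}" for s
    unfolding volterra_kernel_def by (intro holomorphic_intros) (use r in auto)
  have fc: "continuous_on {z. 0 \<le> Im z \<and> r \<le> cmod z} (\<lambda>z. jost_term q z n t)"
    and fh: "(\<lambda>z. jost_term q z n t) holomorphic_on {z. 0 < Im z \<and> r < cmod z}" for t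
    using Suc by auto
  have "continuous_on {z. 0 \<le> Im z \<and> r \<le> cmod z} (\<lambda>z. volterra q z (jost_term q z n) x)"
    "(\<lambda>z. volterra q z (jost_term q z n) x) holomorphic_on {z. 0 < Im z \<and> r < cmod z}" for x
    unfolding volterra_def
    by (rule volterra_integrand(1)[where k = volterra_kernel, OF r km kb fm fb kc fc kh fh]; assumption)
      (rule volterra_integrand(2)[where k = volterra_kernel, OF r km kb fm fb kc fc kh fh]; assumption)
  then show ?case by simp
qed

lemma jost_mod_regular:
  assumes r: "r > 0"
  shows "continuous_on {z. 0 \<le> Im z \<and> r \<le> cmod z} (\<lambda>z. jost_mod q z x)"
    and "(\<lambda>z. jost_mod q z x) holomorphic_on {z. 0 < Im z \<and> r < cmod z}"
proof -
  show "continuous_on {z. 0 \<le> Im z \<and> r \<le> cmod z} (\<lambda>z. jost_mod q z x)"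
  proof (rule uniform_limit_theorem)
    show "uniform_limit {z. 0 \<le> Im z \<and> r \<le> cmod z} (\<lambda>N z. \<Sum>n<N. jost_term q z n x) (\<lambda>z. jost_mod q z x) sequentially"
      by (rule uniform_limit_jost_mod[OF q r, of _ "\<lambda>z. z" "\<lambda>_. x"]) auto
    show "\<forall>\<^sub>F N in sequentially. continuous_on {z. 0 \<le> Im z \<and> r \<le> cmod z} (\<lambda>z. \<Sum>n<N. jost_term q z n x)"
      by (intro always_eventually allI continuous_on_sum) (use jost_term_regular[OF r] in blast)
  qed simp
  have op: "open {z. 0 < Im z \<and> r < cmod z}"
    by (intro open_Collect_conj open_Collect_less continuous_intros)
  show "(\<lambda>z. jost_mod q z x) holomorphic_on {z. 0 < Im z \<and> r < cmod z}"
  proof (rule holomorphic_uniform_sequence[OF op])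
    show "(\<lambda>z. \<Sum>n<N. jost_term q z n x) holomorphic_on {z. 0 < Im z \<and> r < cmod z}" for N
      by (intro holomorphic_on_sum) (use jost_term_regular[OF r] in blast)
    fix z assume "z \<in> {z. 0 < Im z \<and> r < cmod z}"
    then obtain d where d: "d > 0" "cball z d \<subseteq> {z. 0 < Im z \<and> r < cmod z}"
      using op open_contains_cball by blast
    then have sub: "0 \<le> Im w" "r \<le> cmod w" if "w \<in> cball z d" for w using that by (force intro: less_imp_le)+
    then have "uniform_limit (cball z d) (\<lambda>N z. \<Sum>n<N. jost_term q z n x) (\<lambda>z. jost_mod q z x) sequentially"
      by (intro uniform_limit_jost_mod[OF q r, of _ "\<lambda>z. z" "\<lambda>_. x"]) auto
    then show "\<exists>d>0. cball z d \<subseteq> {z. 0 < Im z \<and> r < cmod z} \<and>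
        uniform_limit (cball z d) (\<lambda>N z. \<Sum>n<N. jost_term q z n x) (\<lambda>z. jost_mod q z x) sequentially"
      using d by blast
  qed
qed

lemma jost_mod_deriv_regular:
  assumes r: "r > 0"
  shows "continuous_on {z. 0 \<le> Im z \<and> r \<le> cmod z} (\<lambda>z. jost_mod_deriv q z x)"
    and "(\<lambda>z. jost_mod_deriv q z x) holomorphic_on {z. 0 < Im z \<and> r < cmod z}"
proof -
  have ne: "z \<noteq> 0" if "r \<le> cmod z" for z using that r by auto
  let ?k = "\<lambda>z s. exp (2 * \<i> * z * complex_of_real s)"
  have km: "(\<lambda>t. ?k z (t - x)) \<in> borel_measurable lebesgue" for z x
    by (rule borel_measurable_lebesgue_continuous) (intro continuous_intros)
  have fm: "jost_mod q z \<in> borel_measurable lebesgue" if z: "0 \<le> Im z" "r \<le> cmod z" for z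
    by (rule borel_measurable_lebesgue_continuous[OF continuous_jost_mod[OF q z(1) ne[OF z(2)]]])
  have fb: "cmod (jost_mod q z t) \<le> exp (l1_norm q / r)" if z: "0 \<le> Im z" "r \<le> cmod z" for z t
    by (rule norm_jost_mod_le'[OF q z(1) r z(2)])
  have kc: "continuous_on {z. 0 \<le> Im z \<and> r \<le> cmod z} (\<lambda>z. ?k z s)" for s
    by (intro continuous_intros)
  have kh: "(\<lambda>z. ?k z s) holomorphic_on {z. 0 < Im z \<and> r < cmod z}" for s
    by (intro holomorphic_intros)
  note V = volterra_integrand[where k = ?k, OF r km norm_exp_i_le_1 fm fb kc jost_mod_regular(1)[OF r] kh jost_mod_regular(2)[OF r]]
  have *: "continuous_on {z. 0 \<le> Im z \<and> r \<le> cmod z} (\<lambda>z. volterra_exp q z (jost_mod q z) x)"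
    unfolding volterra_exp_def by (rule V(1); assumption)
  have **: "(\<lambda>z. volterra_exp q z (jost_mod q z) x) holomorphic_on {z. 0 < Im z \<and> r < cmod z}"
    unfolding volterra_exp_def by (rule V(2); assumption)
  show "continuous_on {z. 0 \<le> Im z \<and> r \<le> cmod z} (\<lambda>z. jost_mod_deriv q z x)"
    "(\<lambda>z. jost_mod_deriv q z x) holomorphic_on {z. 0 < Im z \<and> r < cmod z}"
    unfolding jost_mod_deriv_def by (intro continuous_intros *) (intro holomorphic_intros **)
qed

end

section \<open>Solutions paired with their derivatives, and Wronskians\<close>

definition sol :: "(real \<Rightarrow> real) \<Rightarrow> complex \<Rightarrow> (real \<Rightarrow> complex) \<Rightarrow> (real \<Rightarrow> complex) \<Rightarrow> bool" where
  "sol q z y dy \<longleftrightarrow> (\<forall>x. (y has_vector_derivative dy x) (at x)) \<and>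
     loc_abs_cont_deriv dy (\<lambda>x. (of_real (q x) - z\<^sup>2) * y x)"

text \<open>\<open>loc_abs_cont_deriv\<close> sees its second argument only up to null sets, so the
  equation, which holds almost everywhere, can be substituted for the second derivative. The first
  derivative stays explicit in \<open>sol\<close> because Wronskians need it.\<close>

lemma schroedinger_solution_iff_sol: "schroedinger_solution q z y \<longleftrightarrow> (\<exists>dy. sol q z y dy)"
proof
  assume "schroedinger_solution q z y"
  then obtain dy ddy where 1: "\<forall>x. (y has_vector_derivative dy x) (at x)" and 2: "loc_abs_cont_deriv dy ddy"
    and 3: "AE x in lebesgue. - ddy x + of_real (q x) * y x = z\<^sup>2 * y x"
    unfolding schroedinger_solution_def schroedinger_expr_def by blast
  have "AE x in lebesgue. ddy x = (of_real (q x) - z\<^sup>2) * y x"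
    using 3 by eventually_elim (simp add: algebra_simps add_eq_0_iff minus_equation_iff)
  from lac_cong_AE[OF 2 this] 1 have s: "sol q z y dy" unfolding sol_def by simp
  show "\<exists>dy. sol q z y dy" by (rule exI[where x = dy]) (rule s)
next
  assume "\<exists>dy. sol q z y dy"
  then obtain dy where s: "sol q z y dy" ..
  have "AE x in lebesgue. - ((of_real (q x) - z\<^sup>2) * y x) + of_real (q x) * y x = z\<^sup>2 * y x"
    by (simp add: algebra_simps)
  with s show "schroedinger_solution q z y"
    unfolding sol_def schroedinger_solution_def schroedinger_expr_def
    by (intro exI[of _ dy] exI[of _ "\<lambda>x. (of_real (q x) - z\<^sup>2) * y x"]) auto
qed

lemma sol_continuous:
  assumes "sol q z y dy"
  shows "continuous_on UNIV y" "continuous_on UNIV dy"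
proof -
  show "continuous_on UNIV y"
    using assms unfolding sol_def
    by (intro continuous_at_imp_continuous_on ballI has_vector_derivative_continuous) blast
  show "continuous_on UNIV dy" using assms lac_continuous_on unfolding sol_def by blast
qed

lemma sol_lac:
  assumes "sol q z y dy"
  shows "loc_abs_cont_deriv y dy"
  by (rule lac_C1[OF _ sol_continuous(2)[OF assms]]) (use assms in \<open>simp add: sol_def\<close>)

lemma sol_cong: "z\<^sup>2 = w\<^sup>2 \<Longrightarrow> sol q z y dy \<longleftrightarrow> sol q w y dy"
  by (simp add: sol_def)

lemma sol_cmult:
  assumes "sol q z y dy"
  shows "sol q z (\<lambda>x. c * y x) (\<lambda>x. c * dy x)"
  unfolding sol_def
proof
  show "\<forall>x. ((\<lambda>x. c * y x) has_vector_derivative c * dy x) (at x)"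
    using assms unfolding sol_def by (blast intro: has_vector_derivative_mult_right)
  show "loc_abs_cont_deriv (\<lambda>x. c * dy x) (\<lambda>x. (of_real (q x) - z\<^sup>2) * (c * y x))"
    by (rule lac_transform[OF lac_cmult[of dy "\<lambda>x. (of_real (q x) - z\<^sup>2) * y x" c]])
       (use assms in \<open>simp_all add: sol_def\<close>)
qed

lemma sol_diff:
  assumes "sol q z y dy" "sol q z u du"
  shows "sol q z (\<lambda>x. y x - u x) (\<lambda>x. dy x - du x)"
  unfolding sol_def
proof
  show "\<forall>x. ((\<lambda>x. y x - u x) has_vector_derivative dy x - du x) (at x)"
    using assms unfolding sol_def by (blast intro: has_vector_derivative_diff)
  have "loc_abs_cont_deriv dy (\<lambda>x. (of_real (q x) - z\<^sup>2) * y x)" "loc_abs_cont_deriv du (\<lambda>x. (of_real (q x) - z\<^sup>2) * u x)"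
    using assms by (simp_all add: sol_def)
  from lac_diff[OF this] show "loc_abs_cont_deriv (\<lambda>x. dy x - du x) (\<lambda>x. (of_real (q x) - z\<^sup>2) * (y x - u x))"
    by (simp only: right_diff_distrib)
qed

lemma sol_cnj:
  assumes "sol q z y dy"
  shows "sol q (- cnj z) (\<lambda>x. cnj (y x)) (\<lambda>x. cnj (dy x))"
  unfolding sol_def
proof
  show "\<forall>x. ((\<lambda>x. cnj (y x)) has_vector_derivative cnj (dy x)) (at x)"
    using assms unfolding sol_def by (blast intro: has_vector_derivative_cnj)
  have "loc_abs_cont_deriv dy (\<lambda>x. (of_real (q x) - z\<^sup>2) * y x)" using assms by (simp add: sol_def)
  from lac_cnj[OF this] show "loc_abs_cont_deriv (\<lambda>x. cnj (dy x)) (\<lambda>x. (of_real (q x) - (- cnj z)\<^sup>2) * cnj (y x))"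
    by simp
qed

lemma sol_reflect: "sol q z y dy \<Longrightarrow> sol (\<lambda>x. q (- x)) z (\<lambda>x. y (- x)) (\<lambda>x. - dy (- x))"
  unfolding sol_def
proof (intro conjI allI; elim conjE)
  fix x assume "\<forall>x. (y has_vector_derivative dy x) (at x)"
  then have "(y has_vector_derivative dy (- x)) (at (- x))" by blast
  moreover have "(uminus has_vector_derivative (- 1 :: real)) (at x)"
    by (auto intro!: derivative_eq_intros)
  ultimately have "((\<lambda>x. y (- x)) has_vector_derivative - 1 *\<^sub>R dy (- x)) (at x)"
    using vector_diff_chain_at[of uminus "-1" x y "dy (- x)"] by (simp add: o_def)
  then show "((\<lambda>x. y (- x)) has_vector_derivative - dy (- x)) (at x)" by simp
next
  assume "loc_abs_cont_deriv dy (\<lambda>x. (of_real (q x) - z\<^sup>2) * y x)"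
  from lac_minus[OF lac_reflect[OF this]]
  show "loc_abs_cont_deriv (\<lambda>x. - dy (- x)) (\<lambda>x. (of_real (q (- x)) - z\<^sup>2) * y (- x))" by simp
qed

lemma wronskian_lac:
  assumes "sol q z u du" "sol q w v dv"
  shows "loc_abs_cont_deriv (\<lambda>x. u x * dv x - du x * v x) (\<lambda>x. (z\<^sup>2 - w\<^sup>2) * (u x * v x))"
proof (rule lac_transform)
  have "loc_abs_cont_deriv du (\<lambda>x. (of_real (q x) - z\<^sup>2) * u x)" "loc_abs_cont_deriv dv (\<lambda>x. (of_real (q x) - w\<^sup>2) * v x)"
    using assms by (simp_all add: sol_def)
  then show "loc_abs_cont_deriv (\<lambda>x. u x * dv x - du x * v x)
    (\<lambda>x. du x * dv x + u x * ((of_real (q x) - w\<^sup>2) * v x) - ((of_real (q x) - z\<^sup>2) * u x * v x + du x * dv x))"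
    using lac_diff lac_mult sol_lac[OF assms(1)] sol_lac[OF assms(2)] by blast
qed (simp_all add: algebra_simps)

lemma wronskian_const:
  assumes "sol q z u du" "sol q w v dv" "z\<^sup>2 = w\<^sup>2"
  shows "u x * dv x - du x * v x = u a * dv a - du a * v a"
  by (rule lac_zero_const[OF wronskian_lac[OF assms(1,2)]]) (simp add: assms(3))

section \<open>Two-sided growth estimates and the initial value problem\<close>

lemma lac_norm_increment:
  assumes "loc_abs_cont_deriv F f" "c \<le> d"
  shows "cmod (F d - F c) \<le> integral {c..d} (\<lambda>t. cmod (f t))"
proof -
  have "(f has_integral F d - F c) {c..d}" using assms by (auto simp: loc_abs_cont_deriv_def)
  then have "F d - F c = integral {c..d} f" "f integrable_on {c..d}" by (auto simp: integral_unique)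
  moreover have "(\<lambda>t. cmod (f t)) integrable_on {c..d}"
    using absolutely_integrable_imp_integrable[OF absolutely_integrable_norm[OF lac_absolutely_integrable[OF assms(1)]]]
    by (simp add: o_def)
  ultimately show ?thesis by (simp add: integral_norm_bound_integral)
qed

lemma lac_gronwall:
  assumes F: "loc_abs_cont_deriv F f" and G: "loc_abs_cont_deriv G g"
    and k0: "\<And>x. 0 \<le> k x" and k: "\<And>a b. k absolutely_integrable_on {a..b}"
    and b: "\<And>x. cmod (f x) + cmod (g x) \<le> k x * (cmod (F x) + cmod (G x))" and cd: "c \<le> d"
  shows "cmod (F d) + cmod (G d) \<le> (cmod (F c) + cmod (G c)) * exp (integral {c..d} k)"
    and "cmod (F c) + cmod (G c) \<le> (cmod (F d) + cmod (G d)) * exp (integral {c..d} k)"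
proof -
  let ?p = "\<lambda>x. cmod (F x) + cmod (G x)"
  have pc: "continuous_on UNIV ?p"
    by (intro continuous_intros lac_continuous_on[OF F] lac_continuous_on[OF G])
  have kp: "(\<lambda>t. k t * ?p t) integrable_on {a..b}" for a b
    using absolutely_integrable_bounded_measurable_product_real[of ?p "{a..b}" k] k
    by (intro absolutely_integrable_imp_integrable)
       (simp add: mult.commute compact_continuous_image compact_imp_bounded continuous_imp_measurable_on_sets_lebesgue
        continuous_on_subset[OF pc])
  have inc: "\<bar>?p d - ?p c\<bar> \<le> integral {c..d} (\<lambda>t. k t * ?p t)" if "c \<le> d" for c d
  proof -
    have ni: "(\<lambda>t. cmod (h t)) integrable_on {c..d}" if "loc_abs_cont_deriv H h" for H h
      using absolutely_integrable_imp_integrable[OF absolutely_integrable_norm[OF lac_absolutely_integrable[OF that]]]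
      by (simp add: o_def)
    have "\<bar>?p d - ?p c\<bar> \<le> cmod (F d - F c) + cmod (G d - G c)"
      using norm_triangle_ineq3[of "F d" "F c"] norm_triangle_ineq3[of "G d" "G c"] by linarith
    also have "\<dots> \<le> integral {c..d} (\<lambda>t. cmod (f t)) + integral {c..d} (\<lambda>t. cmod (g t))"
      by (intro add_mono lac_norm_increment F G that)
    also have "\<dots> = integral {c..d} (\<lambda>t. cmod (f t) + cmod (g t))"
      by (rule Henstock_Kurzweil_Integration.integral_add[symmetric]) (rule ni[OF F], rule ni[OF G])
    also have "\<dots> \<le> integral {c..d} (\<lambda>t. k t * ?p t)"
      by (rule integral_le) (use ni[OF F] ni[OF G] kp b in \<open>auto intro: integrable_add\<close>)
    finally show ?thesis .
  qed
  have r: "?p d \<le> ?p c + integral {c..d} (\<lambda>t. k t * ?p t)"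
    and l: "?p c \<le> ?p d + integral {c..d} (\<lambda>t. k t * ?p t)" if "c \<le> d" for c d
    using inc[OF that] by linarith+
  show "?p d \<le> ?p c * exp (integral {c..d} k)"
    by (rule gronwall_right[OF pc _ k0 k r cd]) auto
  show "?p c \<le> ?p d * exp (integral {c..d} k)"
    by (rule gronwall_left[OF pc _ k0 k l cd]) auto
qed

lemma sol_ivp_zero:
  assumes q: "integrable lebesgue q" and s: "sol q z y dy" and a: "y a = 0" "dy a = 0"
  shows "y x = 0" "dy x = 0"
proof -
  define k where "k = (\<lambda>x. 1 + \<bar>q x\<bar> + cmod (z\<^sup>2))"
  have k0: "0 \<le> k x" for x by (simp add: k_def)
  have kint: "k absolutely_integrable_on {a..b}" for a b
    unfolding k_def by (intro set_integral_add abs_q_set_integrable[OF q] absolutely_integrable_continuous_real) auto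
  have b: "cmod (dy x) + cmod ((of_real (q x) - z\<^sup>2) * y x) \<le> k x * (cmod (y x) + cmod (dy x))" for x
  proof -
    have "cmod (of_real (q x) - z\<^sup>2) \<le> \<bar>q x\<bar> + cmod (z\<^sup>2)"
      using norm_triangle_ineq4[of "of_real (q x)" "z\<^sup>2"] by simp
    then have "cmod ((of_real (q x) - z\<^sup>2) * y x) \<le> (\<bar>q x\<bar> + cmod (z\<^sup>2)) * cmod (y x)"
      unfolding norm_mult by (rule mult_right_mono) simp
    moreover have "0 \<le> (\<bar>q x\<bar> + cmod (z\<^sup>2)) * cmod (dy x)" by simp
    moreover have "k x * (cmod (y x) + cmod (dy x)) = cmod (y x) + cmod (dy x) +
        (\<bar>q x\<bar> + cmod (z\<^sup>2)) * cmod (y x) + (\<bar>q x\<bar> + cmod (z\<^sup>2)) * cmod (dy x)"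
      by (simp add: k_def algebra_simps)
    ultimately show ?thesis using norm_ge_zero[of "y x"] by linarith
  qed
  have l2: "loc_abs_cont_deriv dy (\<lambda>x. (of_real (q x) - z\<^sup>2) * y x)" using s by (simp add: sol_def)
  note gr = lac_gronwall[OF sol_lac[OF s] l2 k0 kint b]
  have "cmod (y x) + cmod (dy x) \<le> 0"
    using gr(1)[of a x] gr(2)[of x a] a by (cases "a \<le> x") auto
  then have "cmod (y x) + cmod (dy x) = 0" by (intro antisym) auto
  then show "y x = 0" "dy x = 0" by (simp_all add: add_nonneg_eq_0_iff)
qed

section \<open>The Jost solutions and their uniqueness\<close>

definition psi :: "(real \<Rightarrow> real) \<Rightarrow> complex \<Rightarrow> real \<Rightarrow> complex" where
  "psi q z x = exp (\<i> * z * of_real x) * jost_mod q z x"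

definition dpsi :: "(real \<Rightarrow> real) \<Rightarrow> complex \<Rightarrow> real \<Rightarrow> complex" where
  "dpsi q z x = exp (\<i> * z * of_real x) * (\<i> * z * jost_mod q z x + jost_mod_deriv q z x)"

lemma sol_psi:
  assumes q: "integrable lebesgue q" and z: "z \<in> uhp_closed"
  shows "sol q z (psi q z) (dpsi q z)"
proof -
  have z': "0 \<le> Im z" "z \<noteq> 0" using z by (auto simp: uhp_closed_def)
  note L = lac_jost_mod[OF q z']
  have cm: "continuous_on UNIV (jost_mod q z)" "continuous_on UNIV (jost_mod_deriv q z)"
    using L lac_continuous_on by blast+
  have 1: "loc_abs_cont_deriv (psi q z) (dpsi q z)"
    by (rule lac_transform[OF lac_mult[OF lac_exp_linear[of "\<i> * z"] L(1)]]) (simp_all add: psi_def dpsi_def algebra_simps)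
  have 2: "continuous_on UNIV (dpsi q z)"
    unfolding dpsi_def by (intro continuous_intros cm)
  have 3: "loc_abs_cont_deriv (dpsi q z) (\<lambda>x. (of_real (q x) - z\<^sup>2) * psi q z x)"
    by (rule lac_transform[OF lac_mult[OF lac_exp_linear[of "\<i> * z"] lac_add[OF lac_cmult[OF L(1), of "\<i> * z"] L(2)]]])
       (simp_all add: psi_def dpsi_def algebra_simps power2_eq_square)
  show ?thesis using lac_has_vector_derivative[OF 1 2] 3 by (simp add: sol_def)
qed

lemma jost_mod_tendsto:
  assumes q: "integrable lebesgue q" and z: "z \<in> uhp_closed"
  shows "(jost_mod q z \<longlongrightarrow> 1) at_top" "(jost_mod_deriv q z \<longlongrightarrow> 0) at_top"
proof -
  have z': "0 \<le> Im z" "z \<noteq> 0" using z by (auto simp: uhp_closed_def)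
  have "((\<lambda>x. exp (l1_tail q x / cmod z) - 1) \<longlongrightarrow> exp (0 / cmod z) - 1) at_top"
    by (intro tendsto_intros l1_tail_tendsto_0[OF q]) (use z' in auto)
  then have "((\<lambda>x. exp (l1_tail q x / cmod z) - 1) \<longlongrightarrow> 0) at_top" by simp
  then have "((\<lambda>x. jost_mod q z x - 1) \<longlongrightarrow> 0) at_top"
    by (rule Lim_null_comparison[OF always_eventually, rotated]) (use norm_jost_mod_minus_1[OF q z'] in simp)
  then show "(jost_mod q z \<longlongrightarrow> 1) at_top" using LIM_zero_iff by blast
  have "((\<lambda>x. exp (l1_norm q / cmod z) * l1_tail q x) \<longlongrightarrow> exp (l1_norm q / cmod z) * 0) at_top"
    by (intro tendsto_intros l1_tail_tendsto_0[OF q])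
  then have "((\<lambda>x. exp (l1_norm q / cmod z) * l1_tail q x) \<longlongrightarrow> 0) at_top" by simp
  then show "(jost_mod_deriv q z \<longlongrightarrow> 0) at_top"
    by (rule Lim_null_comparison[OF always_eventually, rotated]) (use norm_jost_mod_deriv_le[OF q z'] in simp)
qed

lemma exp_psi: "exp (- \<i> * z * of_real x) * psi q z x = jost_mod q z x"
  by (simp add: psi_def mult.assoc[symmetric] flip: exp_add)

text \<open>With \<open>r = y / psi\<close> and \<open>W\<close> the Wronskian, \<open>r' = W / psi\<^sup>2\<close>. If \<open>W \<noteq> 0\<close>, then over steps of a
  fixed small length \<open>r\<close> changes at a rate at least \<open>\<bar>W\<bar> / 2\<close> in a fixed direction, which contradicts
  \<open>r \<longlongrightarrow> 0\<close>.\<close>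

lemma sol_decay_zero:
  assumes q: "integrable lebesgue q" and z: "z \<in> uhp_closed" and s: "sol q z y dy"
    and lim: "((\<lambda>x. exp (- \<i> * z * of_real x) * y x) \<longlongrightarrow> 0) at_top"
  shows "y x = 0"
proof -
  note S = sol_psi[OF q z]
  define W where "W = psi q z 0 * dy 0 - dpsi q z 0 * y 0"
  have W: "psi q z x * dy x - dpsi q z x * y x = W" for x
    unfolding W_def by (rule wronskian_const[OF S s refl])
  note mt = jost_mod_tendsto(1)[OF q z]
  define r where "r = (\<lambda>x. y x / psi q z x)"
  have m2: "((\<lambda>x. (jost_mod q z x)\<^sup>2) \<longlongrightarrow> 1) at_top" using tendsto_power[OF mt, of 2] by simp
  \<comment> \<open>The tolerance 1/8 here and for the exponential below gives |u - v| < 1/4 and |v|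
    > 7/8, hence |u / v - 1| \<le> 1/2 for the quantities u and v introduced later. X is taken
    nonnegative so that |exp (2 i z x)| \<le> 1 from X on.\<close>
  obtain X where X: "X \<ge> 0" "\<And>x. x \<ge> X \<Longrightarrow> cmod ((jost_mod q z x)\<^sup>2 - 1) < 1/8"
  proof -
    have "\<forall>\<^sub>F x in at_top. dist ((jost_mod q z x)\<^sup>2) 1 < 1/8" using tendstoD[OF m2, of "1/8"] by simp
    then obtain X where "\<And>x. x \<ge> X \<Longrightarrow> cmod ((jost_mod q z x)\<^sup>2 - 1) < 1/8"
      by (auto simp: eventually_at_top_linorder dist_norm)
    then show ?thesis using that[of "max X 0"] by auto
  qed
  have mn: "jost_mod q z x \<noteq> 0" if "x \<ge> X" for x using X(2)[OF that] by auto
  have pn: "psi q z x \<noteq> 0" if "x \<ge> X" for x using mn[OF that] by (simp add: psi_def)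
  have rd: "(r has_vector_derivative W / (psi q z x)\<^sup>2) (at x)" if "x \<ge> X" for x
  proof -
    have "(y has_vector_derivative dy x) (at x)" "(psi q z has_vector_derivative dpsi q z x) (at x)"
      using s S by (auto simp: sol_def)
    note d = this
    have "((\<lambda>x. inverse (psi q z x)) has_vector_derivative dpsi q z x * - (inverse (psi q z x) ^ 2)) (at x)"
      using field_vector_diff_chain_at[OF d(2) DERIV_inverse[OF pn[OF that]]] by (simp add: o_def numeral_2_eq_2)
    from has_vector_derivative_mult[OF d(1) this]
    have "((\<lambda>x. y x * inverse (psi q z x)) has_vector_derivative W / (psi q z x)\<^sup>2) (at x)"
      by (rule has_vector_derivative_eq_rhs)
         (use pn[OF that] in \<open>simp add: W[of x, symmetric] field_simps power2_eq_square\<close>)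
    then show ?thesis by (simp add: r_def divide_inverse)
  qed
  have rt: "(r \<longlongrightarrow> 0) at_top"
  proof -
    have "((\<lambda>x. exp (- \<i> * z * of_real x) * y x / jost_mod q z x) \<longlongrightarrow> 0 / 1) at_top"
      by (intro tendsto_divide lim mt) simp
    moreover have "exp (- \<i> * z * of_real x) * y x / jost_mod q z x = r x" for x
      unfolding r_def exp_psi[symmetric] by simp
    ultimately show ?thesis by simp
  qed
  have Re_mult_real: "Re (complex_of_real a * w) = a * Re w" for a w by simp
  have "W = 0"
  proof (rule ccontr)
    assume W0: "W \<noteq> 0"
    have "isCont (\<lambda>s. exp (- 2 * \<i> * z * of_real s)) 0" by (intro continuous_intros)
    then have "\<forall>e>0. \<exists>d>0. \<forall>s. \<bar>s\<bar> < d \<longrightarrow> cmod (exp (- 2 * \<i> * z * of_real s) - 1) < e"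
      unfolding continuous_at_eps_delta dist_norm by simp
    then obtain d where d: "d > 0" "\<And>s. \<bar>s\<bar> < d \<Longrightarrow> cmod (exp (- 2 * \<i> * z * of_real s) - 1) < 1/8"
      by (metis zero_less_divide_1_iff zero_less_numeral)
    define h where "h = d / 2"
    have h: "h > 0" "h < d" using d by (auto simp: h_def)
    have inc: "h * (cmod W)\<^sup>2 / 2 \<le> cmod W * cmod (r (x + h) - r x)" if x: "x \<ge> X" for x
    proof -
      \<comment> \<open>Multiplication by \<open>c\<close> turns r' = W / psi^2 towards the positive
        axis: on [x, x + h] the product is |W|^2 u / v, with real part at least |W|^2 / 2, which is
        the slope subtracted in \<phi>.\<close>
      define c where "c = cnj W * exp (2 * \<i> * z * of_real x)"
      define \<phi> where "\<phi> = (\<lambda>t. Re (c * r t) - (cmod W)\<^sup>2 / 2 * t)"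
      define \<phi>' where "\<phi>' = (\<lambda>t. Re (c * (W / (psi q z t)\<^sup>2)) - (cmod W)\<^sup>2 / 2)"
      have "\<phi> x \<le> \<phi> (x + h)"
      proof (rule DERIV_nonneg_imp_nondecreasing[where f = \<phi> and a = x and b = "x + h"])
        show "x \<le> x + h" using h by simp
        fix t assume t: "x \<le> t" "t \<le> x + h"
        have tX: "t \<ge> X" using t x by simp
        have "((\<lambda>t. Re (c * r t)) has_vector_derivative Re (c * (W / (psi q z t)\<^sup>2))) (at t)"
          by (intro bounded_linear.has_vector_derivative[OF bounded_linear_Re] has_vector_derivative_mult_right rd[OF tX])
        then have "(\<phi> has_real_derivative \<phi>' t) (at t)"
          unfolding \<phi>_def \<phi>'_def has_real_derivative_iff_has_vector_derivative
          by (intro derivative_intros) (auto intro!: derivative_eq_intros simp: has_real_derivative_iff_has_vector_derivative[symmetric])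
        moreover have "0 \<le> \<phi>' t"
        proof -
          define u where "u = exp (- 2 * \<i> * z * of_real (t - x))"
          define v where "v = (jost_mod q z t)\<^sup>2"
          have u: "cmod (u - 1) < 1/8" unfolding u_def using d(2)[of "t - x"] t h by auto
          have v: "cmod (v - 1) < 1/8" unfolding v_def using X(2)[OF tX] .
          have v0: "v \<noteq> 0" using mn[OF tX] by (simp add: v_def)
          have "cmod (u - v) \<le> cmod (u - 1) + cmod (v - 1)"
            using norm_triangle_ineq4[of "u - 1" "v - 1"] by simp
          moreover have "1 \<le> cmod v + cmod (v - 1)" using norm_triangle_ineq4[of v "v - 1"] by simp
          ultimately have "cmod (u - v) \<le> 1/2 * cmod v" using u v by linarith
          then have "cmod (u / v - 1) \<le> 1/2" using v0 by (simp add: field_simps norm_divide diff_divide_eq_iff)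
          then have re: "1/2 \<le> Re (u / v)" using abs_Re_le_cmod[of "u / v - 1"] by (simp add: abs_le_iff)
          have "c * (W / (psi q z t)\<^sup>2) = complex_of_real ((cmod W)\<^sup>2) * (u / v)"
          proof -
            have "(psi q z t)\<^sup>2 = exp (2 * \<i> * z * of_real t) * v"
              by (simp add: psi_def v_def power_mult_distrib mult_ac flip: exp_double)
            moreover have "exp (2 * \<i> * z * of_real x) = exp (2 * \<i> * z * of_real t) * u"
              unfolding u_def by (simp add: algebra_simps flip: exp_add)
            ultimately have "c * (W / (psi q z t)\<^sup>2) = (W * cnj W) * (u / v)"
              using v0 by (simp add: c_def field_simps)
            then show ?thesis by (simp only: complex_norm_square)
          qed
          then have "Re (c * (W / (psi q z t)\<^sup>2)) = (cmod W)\<^sup>2 * Re (u / v)"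
            by (simp only: Re_mult_real)
          then show ?thesis using mult_left_mono[OF re, of "(cmod W)\<^sup>2"] by (simp add: \<phi>'_def)
        qed
        ultimately show "\<exists>y. (\<phi> has_real_derivative y) (at t) \<and> 0 \<le> y" by blast
      qed
      then have "h * (cmod W)\<^sup>2 / 2 \<le> Re (c * (r (x + h) - r x))"
        by (simp add: \<phi>_def algebra_simps add_divide_distrib)
      also have "\<dots> \<le> cmod c * cmod (r (x + h) - r x)"
        using complex_Re_le_cmod[of "c * (r (x + h) - r x)"] by (simp add: norm_mult)
      also have "cmod c \<le> cmod W * 1"
        unfolding c_def norm_mult using norm_exp_i_le_1[of z x] z x X by (intro mult_mono) (auto simp: uhp_closed_def)
      finally show ?thesis by (simp add: mult_right_mono)
    qed
    have "((\<lambda>x. r (x + h)) \<longlongrightarrow> 0) at_top"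
      by (rule filterlim_compose[OF rt]) (rule filterlim_at_top_mono[OF filterlim_ident], use h in \<open>auto intro: always_eventually\<close>)
    then have "((\<lambda>x. cmod W * cmod (r (x + h) - r x)) \<longlongrightarrow> cmod W * cmod (0 - 0)) at_top"
      by (intro tendsto_intros rt)
    then have "((\<lambda>x. cmod W * cmod (r (x + h) - r x)) \<longlongrightarrow> 0) at_top" by simp
    then have "h * (cmod W)\<^sup>2 / 2 \<le> 0"
      by (rule tendsto_lowerbound) (use inc in \<open>auto simp: eventually_at_top_linorder\<close>)
    then show False using h W0 by (simp add: mult_le_0_iff)
  qed
  have r0: "r x = 0" if x: "x \<ge> X" for x
  proof -
    have rb: "r b = r x" if "x \<le> b" for b
    proof -
      have "((\<lambda>t. 0) has_integral r b - r x) {x..b}"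
        by (rule fundamental_theorem_of_calculus[OF that])
           (use rd x \<open>W = 0\<close> in \<open>auto intro: has_vector_derivative_at_within\<close>)
      then show ?thesis using has_integral_unique[OF has_integral_0] by force
    qed
    have "\<forall>\<^sub>F b in at_top. r b = r x"
      by (rule eventually_mono[OF eventually_ge_at_top[of x] rb])
    then have "(r \<longlongrightarrow> r x) at_top" by (rule tendsto_eventually)
    then show ?thesis using tendsto_unique[OF trivial_limit_at_top_linorder _ rt] by blast
  qed
  have y0: "y x = 0" if "x \<ge> X" for x using r0[OF that] pn[OF that] by (simp add: r_def)
  have "dy X = 0" using W[of X] y0[of X] pn[of X] \<open>W = 0\<close> by simp
  then show ?thesis using sol_ivp_zero(1)[OF q s y0[OF order_refl]] by blast
qed

lemma jost_right_eq_psi: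
  assumes q: "integrable lebesgue q" and z: "z \<in> uhp_closed"
  shows "jost_right q z = psi q z"
  unfolding jost_right_def
proof (rule the_equality)
  show "schroedinger_solution q z (psi q z) \<and> ((\<lambda>x. exp (- \<i> * z * of_real x) * psi q z x) \<longlongrightarrow> 1) at_top"
    unfolding exp_psi schroedinger_solution_iff_sol using sol_psi[OF q z] jost_mod_tendsto[OF q z] by blast
  fix y assume "schroedinger_solution q z y \<and> ((\<lambda>x. exp (- \<i> * z * of_real x) * y x) \<longlongrightarrow> 1) at_top"
  then obtain dy where s: "sol q z y dy" and lim: "((\<lambda>x. exp (- \<i> * z * of_real x) * y x) \<longlongrightarrow> 1) at_top"
    by (auto simp: schroedinger_solution_iff_sol)
  have "((\<lambda>x. exp (- \<i> * z * of_real x) * y x - jost_mod q z x) \<longlongrightarrow> 1 - 1) at_top"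
    by (intro tendsto_diff lim jost_mod_tendsto(1)[OF q z])
  then have "((\<lambda>x. exp (- \<i> * z * of_real x) * (y x - psi q z x)) \<longlongrightarrow> 0) at_top"
    by (simp only: right_diff_distrib exp_psi diff_self)
  from sol_decay_zero[OF q z sol_diff[OF s sol_psi[OF q z]] this]
  show "y = psi q z" by fastforce
qed

text \<open>The left Jost solution for \<open>-z\<close>, reduced to the right one by the reflection \<open>x \<mapsto> -x\<close>.\<close>

definition psiL :: "(real \<Rightarrow> real) \<Rightarrow> complex \<Rightarrow> real \<Rightarrow> complex" where
  "psiL q z x = psi (\<lambda>t. q (- t)) z (- x)"

definition dpsiL :: "(real \<Rightarrow> real) \<Rightarrow> complex \<Rightarrow> real \<Rightarrow> complex" where
  "dpsiL q z x = - dpsi (\<lambda>t. q (- t)) z (- x)"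

lemma integrable_lebesgue_reflect:
  assumes "integrable lebesgue (q :: real \<Rightarrow> real)"
  shows "integrable lebesgue (\<lambda>t. q (- t))"
  using lebesgue_integrable_real_affine[OF assms, of "-1" 0] by simp

lemma sol_psiL:
  assumes q: "integrable lebesgue q" and z: "z \<in> uhp_closed"
  shows "sol q z (psiL q z) (dpsiL q z)"
  using sol_reflect[OF sol_psi[OF integrable_lebesgue_reflect[OF q] z]]
  by (simp add: psiL_def[abs_def] dpsiL_def[abs_def])

lemma jost_left_eq_psiL:
  assumes q: "integrable lebesgue q" and z: "- z \<in> uhp_closed"
  shows "jost_left q z = psiL q (- z)"
proof -
  let ?q = "\<lambda>t. q (- t)"
  note q' = integrable_lebesgue_reflect[OF q]
  have lim_iff: "((\<lambda>x. exp (- \<i> * (- z) * of_real x) * y (- x)) \<longlongrightarrow> 1) at_top \<longleftrightarrow>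
      ((\<lambda>x. exp (- \<i> * z * of_real x) * y x) \<longlongrightarrow> 1) at_bot" for y
    by (simp only: filterlim_at_bot_mirror of_real_minus mult_minus_left mult_minus_right minus_minus)
  show ?thesis
    unfolding jost_left_def
  proof (rule the_equality)
    have "((\<lambda>x. exp (- \<i> * (- z) * of_real x) * psiL q (- z) (- x)) \<longlongrightarrow> 1) at_top"
      using jost_mod_tendsto(1)[OF q' z] unfolding exp_psi[symmetric] by (simp add: psiL_def)
    moreover have "schroedinger_solution q z (psiL q (- z))"
      using sol_psiL[OF q z] sol_cong[of z "- z"] by (auto simp: schroedinger_solution_iff_sol)
    ultimately show "schroedinger_solution q z (psiL q (- z)) \<and>
        ((\<lambda>x. exp (- \<i> * z * of_real x) * psiL q (- z) x) \<longlongrightarrow> 1) at_bot"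
      unfolding lim_iff by blast
    fix y assume y: "schroedinger_solution q z y \<and> ((\<lambda>x. exp (- \<i> * z * of_real x) * y x) \<longlongrightarrow> 1) at_bot"
    then obtain dy where s: "sol q z y dy" by (auto simp: schroedinger_solution_iff_sol)
    have "sol ?q (- z) (\<lambda>x. y (- x)) (\<lambda>x. - dy (- x))"
      using sol_reflect[OF s] sol_cong[of z "- z" ?q] by simp
    note s' = this
    have lim: "((\<lambda>x. exp (- \<i> * (- z) * of_real x) * y (- x)) \<longlongrightarrow> 1) at_top"
      unfolding lim_iff using y by blast
    have "((\<lambda>x. exp (- \<i> * (- z) * of_real x) * y (- x) - jost_mod ?q (- z) x) \<longlongrightarrow> 1 - 1) at_top"
      by (intro tendsto_diff lim jost_mod_tendsto(1)[OF q' z])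
    then have "((\<lambda>x. exp (- \<i> * (- z) * of_real x) * (y (- x) - psi ?q (- z) x)) \<longlongrightarrow> 0) at_top"
      by (simp only: right_diff_distrib exp_psi diff_self)
    from sol_decay_zero[OF q' z sol_diff[OF s' sol_psi[OF q' z]] this]
    have "y (- x) - psi ?q (- z) x = 0" for x .
    then have "y x = psiL q (- z) x" for x
      by (metis minus_minus psiL_def right_minus_eq)
    then show "y = psiL q (- z)" by (rule ext)
  qed
qed

text \<open>Conjugation turns solutions for z into solutions for - cnj z, the mirror image in the
  imaginary axis, which stays in the closed half plane. The two sides have the same normalisation at
  +infinity, so \<open>sol_decay_zero\<close> applies to their difference.\<close>

lemma psi_cnj:
  assumes q: "integrable lebesgue q" and z: "z \<in> uhp_closed"
  shows "psi q (- cnj z) x = cnj (psi q z x)" "dpsi q (- cnj z) x = cnj (dpsi q z x)"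
proof -
  have z': "- cnj z \<in> uhp_closed" using z by (simp add: uhp_closed_def)
  have s: "sol q (- cnj z) (\<lambda>x. psi q (- cnj z) x - cnj (psi q z x)) (\<lambda>x. dpsi q (- cnj z) x - cnj (dpsi q z x))"
    by (rule sol_diff[OF sol_psi[OF q z'] sol_cnj[OF sol_psi[OF q z]]])
  have "((\<lambda>x. jost_mod q (- cnj z) x - cnj (jost_mod q z x)) \<longlongrightarrow> 1 - cnj 1) at_top"
    by (intro tendsto_diff tendsto_cnj jost_mod_tendsto(1)[OF q] z z')
  moreover have "exp (- \<i> * (- cnj z) * of_real x) * cnj (psi q z x) = cnj (jost_mod q z x)" for x
    unfolding exp_psi[symmetric] by (simp add: exp_cnj)
  then have "jost_mod q (- cnj z) x - cnj (jost_mod q z x) = exp (- \<i> * (- cnj z) * of_real x) * (psi q (- cnj z) x - cnj (psi q z x))" for x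
    unfolding right_diff_distrib exp_psi by simp
  ultimately have lim: "((\<lambda>x. exp (- \<i> * (- cnj z) * of_real x) * (psi q (- cnj z) x - cnj (psi q z x))) \<longlongrightarrow> 0) at_top"
    by simp
  have 0: "psi q (- cnj z) x - cnj (psi q z x) = 0" for x
    by (rule sol_decay_zero[OF q z' s lim])
  then show "psi q (- cnj z) x = cnj (psi q z x)" by simp
  have "((\<lambda>x. psi q (- cnj z) x - cnj (psi q z x)) has_vector_derivative dpsi q (- cnj z) x - cnj (dpsi q z x)) (at x)"
    using s by (simp add: sol_def)
  moreover have "((\<lambda>x. psi q (- cnj z) x - cnj (psi q z x)) has_vector_derivative 0) (at x)"
    unfolding 0 by simp
  ultimately show "dpsi q (- cnj z) x = cnj (dpsi q z x)"
    using vector_derivative_unique_at by fastforce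
qed

section \<open>Weyl functions of reflectionless potentials\<close>

text \<open>The Wronskian of the two Jost solutions, normalised to be 1 for the zero potential. At
  real k it is the coefficient a(k), because psiL has no Wronskian with itself.\<close>

definition jost_a :: "(real \<Rightarrow> real) \<Rightarrow> complex \<Rightarrow> complex" where
  "jost_a q z = - (psi q z 0 * dpsiL q z 0 - dpsi q z 0 * psiL q z 0) / (2 * \<i> * z)"

lemma wronskian_psi_psiL:
  assumes q: "integrable lebesgue q" and z: "z \<in> uhp_closed"
  shows "psi q z x * dpsiL q z x - dpsi q z x * psiL q z x = - 2 * \<i> * z * jost_a q z"
  using wronskian_const[OF sol_psi[OF q z] sol_psiL[OF q z] refl, of x 0] z
  by (simp add: jost_a_def uhp_closed_def)

lemma psi_regular:
  assumes q: "integrable lebesgue q"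
  shows "continuous_on uhp_closed (\<lambda>z. psi q z x)" "(\<lambda>z. psi q z x) holomorphic_on uhp"
    "continuous_on uhp_closed (\<lambda>z. dpsi q z x)" "(\<lambda>z. dpsi q z x) holomorphic_on uhp"
proof -
  have m: "continuous_on uhp_closed (\<lambda>z. jost_mod q z x)" "(\<lambda>z. jost_mod q z x) holomorphic_on uhp"
    "continuous_on uhp_closed (\<lambda>z. jost_mod_deriv q z x)" "(\<lambda>z. jost_mod_deriv q z x) holomorphic_on uhp"
    by (intro continuous_on_uhp_closedI holomorphic_on_uhpI jost_mod_regular jost_mod_deriv_regular q; assumption)+
  show "continuous_on uhp_closed (\<lambda>z. psi q z x)" "continuous_on uhp_closed (\<lambda>z. dpsi q z x)"
    unfolding psi_def dpsi_def by (intro continuous_intros m)+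
  show "(\<lambda>z. psi q z x) holomorphic_on uhp" "(\<lambda>z. dpsi q z x) holomorphic_on uhp"
    unfolding psi_def dpsi_def by (intro holomorphic_intros m)+
qed

lemma psiL_regular:
  assumes q: "integrable lebesgue q"
  shows "continuous_on uhp_closed (\<lambda>z. psiL q z x)" "(\<lambda>z. psiL q z x) holomorphic_on uhp"
    "continuous_on uhp_closed (\<lambda>z. dpsiL q z x)" "(\<lambda>z. dpsiL q z x) holomorphic_on uhp"
  unfolding psiL_def dpsiL_def
  by (intro continuous_intros holomorphic_intros psi_regular integrable_lebesgue_reflect q)+

lemma jost_a_regular:
  assumes q: "integrable lebesgue q"
  shows "continuous_on uhp_closed (jost_a q)" "jost_a q holomorphic_on uhp"
proof -
  have "continuous_on uhp_closed (\<lambda>z. - (psi q z 0 * dpsiL q z 0 - dpsi q z 0 * psiL q z 0) / (2 * \<i> * z))"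
    by (intro continuous_intros psi_regular psiL_regular q) (auto simp: uhp_closed_def)
  then show "continuous_on uhp_closed (jost_a q)" by (simp add: jost_a_def[abs_def])
  have "(\<lambda>z. - (psi q z 0 * dpsiL q z 0 - dpsi q z 0 * psiL q z 0) / (2 * \<i> * z)) holomorphic_on uhp"
    by (intro holomorphic_intros psi_regular psiL_regular q) (auto simp: uhp_def)
  then show "jost_a q holomorphic_on uhp" by (simp add: jost_a_def[abs_def])
qed

section \<open>Scattering on the real axis\<close>

lemma of_real_in_uhp_closed: "k \<noteq> 0 \<Longrightarrow> complex_of_real k \<in> uhp_closed"
  by (simp add: uhp_closed_def)

text \<open>The Wronskian is constant in x and can be evaluated at +infinity, where the exponentials
  for k and - k cancel and only the limits of \<open>jost_mod\<close> and
  \<open>jost_mod_deriv\<close> remain.\<close>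

lemma wronskian_psi_real:
  assumes q: "integrable lebesgue q" and k: "k \<noteq> 0"
  shows "psi q (of_real k) x * dpsi q (- of_real k) x - dpsi q (of_real k) x * psi q (- of_real k) x = - 2 * \<i> * of_real k"
proof -
  define z where "z = complex_of_real k"
  have z: "z \<in> uhp_closed" and z': "- z \<in> uhp_closed" using k by (auto simp: z_def uhp_closed_def)
  define w where "w = (\<lambda>x. psi q z x * dpsi q (- z) x - dpsi q z x * psi q (- z) x)"
  have const: "w t = w x" for t
    unfolding w_def by (rule wronskian_const[OF sol_psi[OF q z] sol_psi[OF q z']]) simp
  have eq: "w t = jost_mod q z t * (\<i> * (- z) * jost_mod q (- z) t + jost_mod_deriv q (- z) t)
      - (\<i> * z * jost_mod q z t + jost_mod_deriv q z t) * jost_mod q (- z) t" for t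
  proof -
    have e: "exp (\<i> * z * of_real t) * exp (\<i> * (- z) * of_real t) = 1" by (simp flip: exp_add)
    have "w t = (exp (\<i> * z * of_real t) * exp (\<i> * (- z) * of_real t)) *
       (jost_mod q z t * (\<i> * (- z) * jost_mod q (- z) t + jost_mod_deriv q (- z) t)
      - (\<i> * z * jost_mod q z t + jost_mod_deriv q z t) * jost_mod q (- z) t)"
      unfolding w_def psi_def dpsi_def by (simp add: algebra_simps)
    then show ?thesis by (simp only: e mult_1)
  qed
  have "(w \<longlongrightarrow> 1 * (\<i> * (- z) * 1 + 0) - (\<i> * z * 1 + 0) * 1) at_top"
    unfolding eq by (intro tendsto_intros jost_mod_tendsto q z z')
  moreover have "(w \<longlongrightarrow> w x) at_top"
    by (rule tendsto_eventually, rule always_eventually) (use const in blast)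
  ultimately have "w x = 1 * (\<i> * (- z) * 1 + 0) - (\<i> * z * 1 + 0) * 1"
    using tendsto_unique[OF trivial_limit_at_top_linorder] by blast
  then show ?thesis by (simp add: w_def z_def)
qed

lemma wronskian_psiL_real:
  assumes q: "integrable lebesgue q" and k: "k \<noteq> 0"
  shows "psiL q (- of_real k) x * dpsiL q (of_real k) x - dpsiL q (- of_real k) x * psiL q (of_real k) x = - 2 * \<i> * of_real k"
  using wronskian_psi_real[OF integrable_lebesgue_reflect[OF q] k, of "- x"]
  by (simp add: psiL_def dpsiL_def algebra_simps)

text \<open>\<open>\<bar>a\<bar>\<^sup>2 - \<bar>b\<bar>\<^sup>2 = 1\<close> excludes the junk case in which the reflection coefficient \<open>b / a\<close> vanishes because \<open>a = 0\<close>.\<close>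

lemma reflectionless_psi:
  assumes q: "integrable lebesgue q" and r: "reflectionless q" and k: "k \<noteq> 0"
  shows "psi q (of_real k) x = jost_a q (of_real k) * psiL q (- of_real k) x"
    and "dpsi q (of_real k) x = jost_a q (of_real k) * dpsiL q (- of_real k) x"
    and "cmod (jost_a q (of_real k)) = 1"
proof -
  define z where "z = complex_of_real k"
  have z: "z \<in> uhp_closed" and z': "- z \<in> uhp_closed" and z0: "z \<noteq> 0" using k by (auto simp: z_def uhp_closed_def)
  define u where "u = psiL q (- z)" define du where "du = dpsiL q (- z)"
  define v where "v = psiL q z" define dv where "dv = dpsiL q z"
  define y where "y = psi q z" define dy where "dy = dpsi q z"
  have su: "sol q z u du" using sol_psiL[OF q z'] sol_cong[of "- z" z] by (simp add: u_def du_def)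
  have sv: "sol q z v dv" using sol_psiL[OF q z] by (simp add: v_def dv_def)
  have sy: "sol q z y dy" using sol_psi[OF q z] by (simp add: y_def dy_def)
  define w where "w = - 2 * \<i> * z"
  have w0: "w \<noteq> 0" using z0 by (simp add: w_def)
  have uv: "u x * dv x - du x * v x = w" for x
    using wronskian_psiL_real[OF q k, of x] by (simp add: u_def du_def v_def dv_def w_def z_def)
  define \<alpha> where "\<alpha> = (y 0 * dv 0 - dy 0 * v 0) / w"
  define \<beta> where "\<beta> = (u 0 * dy 0 - du 0 * y 0) / w"
  have a: "y x * dv x - dy x * v x = \<alpha> * w" for x
    using wronskian_const[OF sy sv refl, of x 0] w0 by (simp add: \<alpha>_def)
  have b: "u x * dy x - du x * y x = \<beta> * w" for x
    using wronskian_const[OF su sy refl, of x 0] w0 by (simp add: \<beta>_def)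
  have y: "y x = \<alpha> * u x + \<beta> * v x" for x
  proof -
    have "w * (\<alpha> * u x + \<beta> * v x) = (\<alpha> * w) * u x + (\<beta> * w) * v x" by (simp add: algebra_simps)
    also have "\<dots> = y x * (u x * dv x - du x * v x)" unfolding a[of x, symmetric] b[of x, symmetric] by (simp add: algebra_simps)
    finally have "w * y x = w * (\<alpha> * u x + \<beta> * v x)" unfolding uv by (metis mult.commute)
    then show ?thesis using w0 by simp
  qed
  have dy: "dy x = \<alpha> * du x + \<beta> * dv x" for x
  proof -
    have "w * (\<alpha> * du x + \<beta> * dv x) = (\<alpha> * w) * du x + (\<beta> * w) * dv x" by (simp add: algebra_simps)
    also have "\<dots> = dy x * (u x * dv x - du x * v x)" unfolding a[of x, symmetric] b[of x, symmetric] by (simp add: algebra_simps)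
    finally have "w * dy x = w * (\<alpha> * du x + \<beta> * dv x)" unfolding uv by (metis mult.commute)
    then show ?thesis using w0 by simp
  qed
  have JR: "jost_right q z = y" using jost_right_eq_psi[OF q z] by (simp add: y_def)
  have JL: "jost_left q z = u" using jost_left_eq_psiL[OF q z'] by (simp add: u_def)
  have JL': "jost_left q (- z) = v" using jost_left_eq_psiL[of q "- z"] q z by (simp add: v_def)
  have "scattering_coeffs q k = (\<alpha>, \<beta>)"
    unfolding scattering_coeffs_def of_real_minus z_def[symmetric] JR JL JL'
  proof (rule the_equality)
    show "\<forall>x. y x = fst (\<alpha>, \<beta>) * u x + snd (\<alpha>, \<beta>) * v x" using y by simp
    fix p assume p: "\<forall>x. y x = fst p * u x + snd p * v x"
    define c where "c = \<alpha> - fst p" define d where "d = \<beta> - snd p"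
    have 0: "c * u x + d * v x = 0" for x
      using p[rule_format, of x] y[of x] by (simp add: c_def d_def algebra_simps)
    have "((\<lambda>x. c * u x + d * v x) has_vector_derivative c * du 0 + d * dv 0) (at 0)"
      using su sv unfolding sol_def by (intro has_vector_derivative_add has_vector_derivative_mult_right) auto
    then have "((\<lambda>x::real. 0 :: complex) has_vector_derivative c * du 0 + d * dv 0) (at 0)" by (simp only: 0)
    then have 1: "c * du 0 + d * dv 0 = 0"
      using vector_derivative_unique_at has_vector_derivative_const by blast
    have "c * w = (c * u 0 + d * v 0) * dv 0 - (c * du 0 + d * dv 0) * v 0"
      "d * w = (c * du 0 + d * dv 0) * u 0 - (c * u 0 + d * v 0) * du 0"
      unfolding uv[of 0, symmetric] by (simp_all add: algebra_simps)
    then have "c * w = 0" "d * w = 0" unfolding 0 1 by simp_all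
    then have "c = 0" "d = 0" using w0 by auto
    then show "p = (\<alpha>, \<beta>)" by (simp add: c_def d_def prod_eq_iff)
  qed
  then have "\<beta> / \<alpha> = 0"
    using r k by (auto simp: reflectionless_def refl_left_def scattering_a_def scattering_b_def)
  \<comment> \<open>The Wronskian of y with its conjugate is computed twice: by
    \<open>wronskian_psi_real\<close>, and by expansion in u and v, which conjugation
    interchanges.\<close>
  moreover have nrm: "\<alpha> * cnj \<alpha> - \<beta> * cnj \<beta> = 1"
  proof -
    have cu: "cnj (u 0) = v 0" "cnj (du 0) = dv 0"
      using psi_cnj[OF integrable_lebesgue_reflect[OF q] z', of 0]
      by (simp_all add: u_def v_def du_def dv_def psiL_def dpsiL_def z_def)
    then have cv: "cnj (v 0) = u 0" "cnj (dv 0) = du 0" by (metis complex_cnj_cnj)+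
    have cy: "psi q (- z) 0 = cnj (y 0)" "dpsi q (- z) 0 = cnj (dy 0)"
      using psi_cnj[OF q z, of 0] by (simp_all add: y_def dy_def z_def)
    have "y 0 * cnj (dy 0) - dy 0 * cnj (y 0) = w"
      using wronskian_psi_real[OF q k, of 0] cy by (simp add: w_def y_def dy_def z_def)
    then have "(\<alpha> * u 0 + \<beta> * v 0) * (cnj \<alpha> * dv 0 + cnj \<beta> * du 0) - (\<alpha> * du 0 + \<beta> * dv 0) * (cnj \<alpha> * v 0 + cnj \<beta> * u 0) = w"
      unfolding y dy by (simp add: cu cv)
    moreover have "(\<alpha> * u 0 + \<beta> * v 0) * (cnj \<alpha> * dv 0 + cnj \<beta> * du 0) - (\<alpha> * du 0 + \<beta> * dv 0) * (cnj \<alpha> * v 0 + cnj \<beta> * u 0)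
        = (\<alpha> * cnj \<alpha> - \<beta> * cnj \<beta>) * (u 0 * dv 0 - du 0 * v 0)" by (simp add: algebra_simps)
    ultimately have "(\<alpha> * cnj \<alpha> - \<beta> * cnj \<beta>) * w = 1 * w" unfolding uv by simp
    then show ?thesis using w0 by simp
  qed
  moreover have "\<alpha> \<noteq> 0"
  proof
    assume "\<alpha> = 0"
    then have "- complex_of_real ((cmod \<beta>)\<^sup>2) = 1" using nrm by (simp add: complex_norm_square del: of_real_power)
    from arg_cong[OF this, of Re] have "- ((cmod \<beta>)\<^sup>2) = 1" by (simp only: uminus_complex.sel Re_complex_of_real one_complex.sel)
    then show False using zero_le_power2[of "cmod \<beta>"] by linarith
  qed
  ultimately have \<beta>: "\<beta> = 0" by simp
  have \<alpha>: "jost_a q z = \<alpha>"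
    using wronskian_psi_psiL[OF q z, of 0] a[of 0] w0 by (simp add: y_def dy_def v_def dv_def w_def)
  show "psi q (of_real k) x = jost_a q (of_real k) * psiL q (- of_real k) x"
    "dpsi q (of_real k) x = jost_a q (of_real k) * dpsiL q (- of_real k) x"
    using y[of x] dy[of x] \<beta> \<alpha> by (simp_all add: y_def dy_def u_def du_def z_def)
  have "complex_of_real ((cmod \<alpha>)\<^sup>2) = 1" using nrm \<beta> by (simp add: complex_norm_square del: of_real_power)
  then have "(cmod \<alpha>)\<^sup>2 = 1" using of_real_eq_1_iff by blast
  then have "cmod \<alpha> = 1" using power2_eq_iff_nonneg[of "cmod \<alpha>" 1] by simp
  then show "cmod (jost_a q (of_real k)) = 1" using \<alpha> by (simp add: z_def)
qed

section \<open>Positivity and bounds for the Weyl functions\<close>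

lemma psi_decay:
  assumes q: "integrable lebesgue q" and z: "z \<in> uhp"
  shows "((\<lambda>x. exp (\<i> * z * of_real x)) \<longlongrightarrow> 0) at_top" "(psi q z \<longlongrightarrow> 0) at_top" "(dpsi q z \<longlongrightarrow> 0) at_top"
proof -
  have zc: "z \<in> uhp_closed" using z uhp_subset by blast
  have "filterlim (\<lambda>x. Im z * x) at_top at_top"
    using z by (intro filterlim_tendsto_pos_mult_at_top[OF tendsto_const] filterlim_ident) (simp add: uhp_def)
  then have "((\<lambda>x. exp (- (Im z * x))) \<longlongrightarrow> 0) at_top"
    by (intro filterlim_compose[OF exp_at_bot]) (simp add: filterlim_uminus_at_top)
  then show e: "((\<lambda>x. exp (\<i> * z * of_real x)) \<longlongrightarrow> 0) at_top"
    by (subst tendsto_norm_zero_iff[symmetric]) simp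
  have "((\<lambda>x. exp (\<i> * z * of_real x) * jost_mod q z x) \<longlongrightarrow> 0 * 1) at_top"
    by (intro tendsto_mult e jost_mod_tendsto q zc)
  then show "(psi q z \<longlongrightarrow> 0) at_top" by (simp add: psi_def[abs_def])
  have "((\<lambda>x. exp (\<i> * z * of_real x) * (\<i> * z * jost_mod q z x + jost_mod_deriv q z x)) \<longlongrightarrow> 0 * (\<i> * z * 1 + 0)) at_top"
    by (intro tendsto_intros e jost_mod_tendsto q zc)
  then show "(dpsi q z \<longlongrightarrow> 0) at_top" by (simp add: dpsi_def[abs_def])
qed

text \<open>At real z the quantity is half the modulus of a known Wronskian. For Im z > 0 its
  derivative in x is - 2 Re z Im z |psi|^2, so it decreases to its limit 0. A zero at x would force
  psi to vanish beyond x, against \<open>jost_mod\<close> tending to 1.\<close>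

lemma weyl_positivity:
  assumes q: "integrable lebesgue q" and z: "z \<in> uhp_closed" and re: "Re z > 0"
  shows "Im (dpsi q z x * cnj (psi q z x)) > 0"
proof (cases "Im z = 0")
  case True
  define k where "k = Re z"
  have zk: "z = of_real k" and k: "k > 0" using True re by (simp_all add: k_def complex_eq_iff)
  have "psi q z x * cnj (dpsi q z x) - dpsi q z x * cnj (psi q z x) = - 2 * \<i> * of_real k"
    using wronskian_psi_real[OF q, of k x] psi_cnj[OF q z, of x] k by (simp add: zk)
  from arg_cong[OF this, of Im] have "2 * Im (dpsi q z x * cnj (psi q z x)) = 2 * k" by (simp add: algebra_simps)
  then show ?thesis using k by simp
next
  case False
  then have zu: "z \<in> uhp" and im: "Im z > 0" using z by (auto simp: uhp_closed_def uhp_def)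
  define F where "F = (\<lambda>x. Im (dpsi q z x * cnj (psi q z x)))"
  define c where "c = 2 * (Re z * Im z)"
  have c: "c > 0" using re im by (simp add: c_def)
  have pc: "continuous_on UNIV (psi q z)" using sol_continuous[OF sol_psi[OF q z]] by blast
  have FI: "((\<lambda>t. c * (cmod (psi q z t))\<^sup>2) has_integral F a - F b) {a..b}" if "a \<le> b" for a b
  proof -
    have "((\<lambda>t. (z\<^sup>2 - (- cnj z)\<^sup>2) * (psi q z t * cnj (psi q z t))) has_integral
        (psi q z b * cnj (dpsi q z b) - dpsi q z b * cnj (psi q z b)) - (psi q z a * cnj (dpsi q z a) - dpsi q z a * cnj (psi q z a))) {a..b}"
      using wronskian_lac[OF sol_psi[OF q z] sol_cnj[OF sol_psi[OF q z]]] that unfolding loc_abs_cont_deriv_def by blast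
    from has_integral_linear[OF this bounded_linear_Im]
    have "((\<lambda>t. Im ((z\<^sup>2 - (- cnj z)\<^sup>2) * (psi q z t * cnj (psi q z t)))) has_integral - 2 * F b + 2 * F a) {a..b}"
      by (simp add: o_def F_def algebra_simps)
    moreover have "Im ((z\<^sup>2 - (- cnj z)\<^sup>2) * (psi q z t * cnj (psi q z t))) = 2 * (c * (cmod (psi q z t))\<^sup>2)" for t
      unfolding complex_norm_square[symmetric] by (simp add: c_def power2_eq_square algebra_simps)
    ultimately have "((\<lambda>t. 2 * (c * (cmod (psi q z t))\<^sup>2)) has_integral - 2 * F b + 2 * F a) {a..b}" by simp
    from has_integral_mult_right[OF this, of "1/2"] show ?thesis by (simp add: algebra_simps)
  qed
  have dec: "F b \<le> F a" if "a \<le> b" for a b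
    using has_integral_nonneg[OF FI[OF that]] c by simp
  have "((\<lambda>x. dpsi q z x * cnj (psi q z x)) \<longlongrightarrow> 0 * cnj 0) at_top"
    by (intro tendsto_intros psi_decay q zu)
  from tendsto_Im[OF this] have lim: "(F \<longlongrightarrow> 0) at_top" by (simp add: F_def)
  have F0: "F x \<ge> 0" for x
    by (rule tendsto_upperbound[OF lim]) (auto intro: eventually_mono[OF eventually_ge_at_top[of x]] dec)
  have "F x \<noteq> 0"
  proof
    assume Fx: "F x = 0"
    have "psi q z t = 0" if t: "t > x" for t
    proof -
      have "F t = 0" using dec[of x t] F0[of t] Fx t by simp
      then have "integral {x..t} (\<lambda>t. c * (cmod (psi q z t))\<^sup>2) = 0"
        using integral_unique[OF FI[of x t]] t Fx by simp
      moreover have "continuous_on {x..t} (\<lambda>t. c * (cmod (psi q z t))\<^sup>2)"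
        by (intro continuous_intros continuous_on_subset[OF pc]) auto
      ultimately have "\<forall>s\<in>{x..t}. c * (cmod (psi q z s))\<^sup>2 = 0"
        using integral_eq_0_iff[of x t "\<lambda>t. c * (cmod (psi q z t))\<^sup>2"] c t by auto
      then have "c * (cmod (psi q z t))\<^sup>2 = 0" by (rule bspec) (use t in simp)
      then show ?thesis using c by simp
    qed
    then have "\<forall>\<^sub>F t in at_top. jost_mod q z t = 0"
      by (intro eventually_mono[OF eventually_gt_at_top[of x]]) (auto simp: psi_def)
    then have "(jost_mod q z \<longlongrightarrow> 0) at_top" by (rule tendsto_eventually)
    then show False using tendsto_unique[OF trivial_limit_at_top_linorder _ jost_mod_tendsto(1)[OF q z]] by fastforce
  qed
  then show ?thesis using F0[of x] by (simp add: F_def)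
qed

lemma psi_nonzero:
  assumes "integrable lebesgue q" "z \<in> uhp_closed" "Re z > 0"
  shows "psi q z x \<noteq> 0"
  using weyl_positivity[OF assms, of x] by auto

lemma weyl_quotient:
  assumes "integrable lebesgue q" "z \<in> uhp_closed" "Re z > 0"
  shows "Im (dpsi q z x / psi q z x) = Im (dpsi q z x * cnj (psi q z x)) / (cmod (psi q z x))\<^sup>2"
  by (simp add: Im_divide cmod_power2)

lemma norm_log_derivative_le:
  assumes q: "integrable lebesgue q"
  obtains R where "R > 0" "\<And>z x. z \<in> uhp_closed \<Longrightarrow> R \<le> cmod z \<Longrightarrow>
    jost_mod q z x \<noteq> 0 \<and> cmod (dpsi q z x / psi q z x - \<i> * z) \<le> 4 * l1_norm q"
proof
  define L where "L = l1_norm q"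
  have L: "L \<ge> 0" using l1_norm_nonneg[OF q] by (simp add: L_def)
  \<comment> \<open>From ln (2/3) \<le> 2/3 - 1. It turns \<open>L / cmod z \<le> 1/3\<close> into
    exp (L / |z|) \<le> 3/2, which keeps \<open>jost_mod\<close> within 1/2 of 1 and so away from
    0.\<close>
  have l2: "(1/3::real) \<le> ln (3/2)"
    using ln_le_minus_one[of "2/3"] by (simp add: ln_div)
  show "3 * L + 1 > 0" using L by simp
  fix z x assume z: "z \<in> uhp_closed" and R: "3 * L + 1 \<le> cmod z"
  have z': "0 \<le> Im z" "z \<noteq> 0" using z by (auto simp: uhp_closed_def)
  have "l1_tail q x / cmod z \<le> L / cmod z" using l1_tail_le[OF q] by (simp add: L_def divide_right_mono)
  moreover have L3: "L / cmod z \<le> 1/3"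
  proof -
    have "cmod z > 0" "L \<le> 1/3 * cmod z" using R L by linarith+
    then show ?thesis by (simp only: pos_divide_le_eq)
  qed
  ultimately have "l1_tail q x / cmod z \<le> ln (3/2)" "L / cmod z \<le> ln (3/2)" using l2 by linarith+
  then have "exp (l1_tail q x / cmod z) \<le> exp (ln (3/2))" "exp (L / cmod z) \<le> exp (ln (3/2))"
    by (simp_all only: exp_le_cancel_iff)
  then have e: "exp (l1_tail q x / cmod z) \<le> 3/2" "exp (L / cmod z) \<le> 3/2" by simp_all
  have m1: "cmod (jost_mod q z x - 1) \<le> 1/2" using norm_jost_mod_minus_1[OF q z', of x] e by simp
  then have m: "1/2 \<le> cmod (jost_mod q z x)"
    using norm_triangle_ineq4[of "jost_mod q z x" "jost_mod q z x - 1"] by simp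
  have "cmod (jost_mod_deriv q z x) \<le> exp (L / cmod z) * L"
    unfolding L_def
    by (rule order_trans[OF norm_jost_mod_deriv_le[OF q z'] mult_left_mono[OF l1_tail_le[OF q]]]) simp
  also have "\<dots> \<le> 2 * L" using e L by (intro mult_right_mono) auto
  finally have v: "cmod (jost_mod_deriv q z x) \<le> 2 * L" .
  have m0: "jost_mod q z x \<noteq> 0" using m by auto
  then have "dpsi q z x / psi q z x - \<i> * z = jost_mod_deriv q z x / jost_mod q z x"
    by (simp add: psi_def dpsi_def field_simps)
  also have "cmod \<dots> \<le> 2 * L / (1/2)"
    unfolding norm_divide using v m L by (intro frac_le) auto
  finally show "jost_mod q z x \<noteq> 0 \<and> cmod (dpsi q z x / psi q z x - \<i> * z) \<le> 4 * l1_norm q"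
    using m0 by (simp add: L_def)
qed

text \<open>For a reflectionless potential the right and left Weyl functions are the restrictions to the
  first and the fourth quadrant of one function \<open>M\<close>, holomorphic in the right half plane. Since \<open>Im M > 0\<close>
  there and \<open>M - i \<lambda>\<close> is bounded at infinity, the maximum principle gives \<open>Im M \<ge> Re \<lambda>\<close>.\<close>

lemma reflectionless_weyl_lower_bound:
  assumes q: "integrable lebesgue q" and r: "reflectionless q" and l: "l \<in> uhp_closed" "Re l > 0"
  shows "Re l \<le> Im (dpsi q l x / psi q l x)"
proof -
  let ?q = "\<lambda>t. q (- t)"
  note q' = integrable_lebesgue_reflect[OF q]
  define S where "S = {z. 0 < Re z}"
  define A where "A = {z. 0 < Re z \<and> 0 \<le> Im z}"
  define B where "B = {z. 0 < Re z \<and> Im z \<le> 0}"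
  define U where "U = (\<lambda>z. dpsi q z x / psi q z x)"
  define V where "V = (\<lambda>z. dpsiL q (- z) x / psiL q (- z) x)"
  define M where "M = (\<lambda>z. if 0 \<le> Im z then U z else V z)"
  have opS: "open S" unfolding S_def by (intro open_Collect_less continuous_intros)
  have AS: "A \<subseteq> uhp_closed" by (auto simp: A_def uhp_closed_def)
  have BS: "- z \<in> uhp_closed" if "z \<in> B" for z using that by (auto simp: B_def uhp_closed_def)
  have pA: "psi q z x \<noteq> 0" if "z \<in> A" for z using psi_nonzero[OF q] that AS by (auto simp: A_def)
  have cnjL: "psi ?q (cnj z) (- x) = cnj (psi ?q (- z) (- x))" "dpsi ?q (cnj z) (- x) = cnj (dpsi ?q (- z) (- x))" if "z \<in> B" for z
    using psi_cnj[OF q' BS[OF that]] by simp_all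
  have cB: "cnj z \<in> uhp_closed" "Re (cnj z) > 0" if "z \<in> B" for z using that by (auto simp: B_def uhp_closed_def)
  have pB: "psiL q (- z) x \<noteq> 0" if "z \<in> B" for z
    using psi_nonzero[OF q' cB[OF that], of "- x"] cnjL[OF that] by (simp add: psiL_def)
  have ImU: "Im (U z) > 0" if "z \<in> A" for z
    using weyl_positivity[OF q, of z x] pA[OF that] that AS unfolding U_def Im_divide
    by (auto simp: A_def Im_divide intro!: divide_pos_pos) (metis complex_eq_iff sum_power2_gt_zero_iff zero_complex.sel)
  have ImV: "Im (V z) > 0" if "z \<in> B" for z
  proof -
    have "Im (dpsi ?q (cnj z) (- x) * cnj (psi ?q (cnj z) (- x))) > 0"
      by (rule weyl_positivity[OF q' cB[OF that]])
    then have "Im (dpsi ?q (- z) (- x) * cnj (psi ?q (- z) (- x))) < 0"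
      unfolding cnjL[OF that] by (simp add: algebra_simps)
    then have *: "Im (dpsiL q (- z) x * cnj (psiL q (- z) x)) > 0" by (simp add: psiL_def dpsiL_def)
    have "V z = dpsiL q (- z) x * cnj (psiL q (- z) x) / of_real ((cmod (psiL q (- z) x))\<^sup>2)"
      unfolding V_def complex_norm_square using pB[OF that] by simp
    then show ?thesis using * pB[OF that] by (simp add: Im_divide_of_real del: of_real_power)
  qed
  \<comment> \<open>The only place in this proof where absence of reflection enters: on the positive
    axis psi (k) and psiL (- k) are proportional and have the same logarithmic derivative.\<close>
  have glue: "U z = V z" if "z \<in> A" "z \<in> B" for z
  proof -
    define k where "k = Re z"
    have z: "z = of_real k" and k: "k \<noteq> 0" using that by (auto simp: A_def B_def k_def complex_eq_iff)
    have "jost_a q (of_real k) \<noteq> 0" using reflectionless_psi(3)[OF q r k] by auto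
    then show ?thesis unfolding U_def V_def z reflectionless_psi(1,2)[OF q r k] by simp
  qed
  have cU: "continuous_on A U" unfolding U_def
    by (intro continuous_intros continuous_on_subset[OF psi_regular(1)[OF q] AS] continuous_on_subset[OF psi_regular(3)[OF q] AS]) (use pA in auto)
  have cV: "continuous_on B V" unfolding V_def
    by (intro continuous_on_divide continuous_on_compose2[OF psiL_regular(1)[OF q]] continuous_on_compose2[OF psiL_regular(3)[OF q]]
        continuous_intros) (use BS pB in auto)
  have contM: "continuous_on S M"
  proof -
    have SAB: "S = A \<union> B" by (auto simp: S_def A_def B_def)
    have "A = S \<inter> {z. 0 \<le> Im z}" "B = S \<inter> {z. Im z \<le> 0}" by (auto simp: S_def A_def B_def)
    moreover have "closed {z. 0 \<le> Im z}" "closed {z. Im z \<le> 0}"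
      by (intro closed_Collect_le continuous_intros)+
    ultimately have "closedin (top_of_set (A \<union> B)) A" "closedin (top_of_set (A \<union> B)) B"
      unfolding SAB[symmetric] by (metis closedin_closed_Int)+
    then show ?thesis unfolding SAB M_def
      by (rule continuous_on_cases_local[OF _ _ cU cV]) (use glue in \<open>auto simp: A_def B_def\<close>)
  qed
  have holM: "M holomorphic_on S"
  proof (rule holomorphic_on_paste_across_line[OF opS _ _ _ contM, of \<i> 0])
    have U: "U holomorphic_on (S \<inter> {z. 0 < Im z})" unfolding U_def
      by (intro holomorphic_intros holomorphic_on_subset[OF psi_regular(2)[OF q]] holomorphic_on_subset[OF psi_regular(4)[OF q]])
         (use pA in \<open>auto simp: S_def A_def uhp_def\<close>)
    have V: "V holomorphic_on (S \<inter> {z. Im z < 0})" unfolding V_def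
      by (intro holomorphic_intros holomorphic_on_compose_gen[OF _ psiL_regular(2)[OF q], unfolded o_def]
          holomorphic_on_compose_gen[OF _ psiL_regular(4)[OF q], unfolded o_def])
         (use pB in \<open>auto simp: S_def B_def uhp_def\<close>)
    have "S \<inter> {z. \<i> \<bullet> z < 0} = S \<inter> {z. Im z < 0}" "S \<inter> {z. 0 < \<i> \<bullet> z} = S \<inter> {z. 0 < Im z}"
      by (auto simp: inner_complex_def)
    then show "M holomorphic_on (S \<inter> {z. \<i> \<bullet> z < 0})" "M holomorphic_on (S \<inter> {z. 0 < \<i> \<bullet> z})"
      using holomorphic_transform[OF V, of M] holomorphic_transform[OF U, of M] by (auto simp: M_def)
  qed simp
  have ImM: "Im (M z) > 0" if "z \<in> S" for z
    using ImU[of z] ImV[of z] that by (auto simp: M_def S_def A_def B_def)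
  obtain R1 where R1: "R1 > 0" "\<And>z x. z \<in> uhp_closed \<Longrightarrow> R1 \<le> cmod z \<Longrightarrow> cmod (dpsi q z x / psi q z x - \<i> * z) \<le> 4 * l1_norm q"
    using norm_log_derivative_le[OF q] by metis
  obtain R2 where R2: "R2 > 0" "\<And>z x. z \<in> uhp_closed \<Longrightarrow> R2 \<le> cmod z \<Longrightarrow> cmod (dpsi ?q z x / psi ?q z x - \<i> * z) \<le> 4 * l1_norm ?q"
    using norm_log_derivative_le[OF q'] by metis
  define C where "C = 4 * l1_norm q + 4 * l1_norm ?q"
  have C: "C \<ge> 0" using l1_norm_nonneg[OF q] l1_norm_nonneg[OF q'] by (simp add: C_def)
  have big: "cmod (M z - \<i> * z) \<le> C" if z: "z \<in> S" "R1 \<le> cmod z" "R2 \<le> cmod z" for z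
  proof (cases "0 \<le> Im z")
    case True
    then have "z \<in> uhp_closed" using z by (auto simp: uhp_closed_def S_def)
    then show ?thesis using R1(2)[of z x] z True l1_norm_nonneg[OF q'] by (simp add: M_def U_def C_def)
  next
    case False
    then have "- z \<in> uhp_closed" using z by (auto simp: uhp_closed_def S_def)
    then have "cmod (dpsi ?q (- z) (- x) / psi ?q (- z) (- x) - \<i> * (- z)) \<le> 4 * l1_norm ?q"
      by (rule R2(2)) (use z in simp)
    moreover have "M z - \<i> * z = - (dpsi ?q (- z) (- x) / psi ?q (- z) (- x) - \<i> * (- z))"
      using False by (simp add: M_def V_def psiL_def dpsiL_def)
    ultimately show ?thesis using l1_norm_nonneg[OF q] by (simp only: norm_minus_cancel) (simp add: C_def)
  qed
  have lS: "l \<in> S" using l by (simp add: S_def)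
  have key: "exp (- Im (M l - \<i> * l)) \<le> exp \<epsilon> * cmod (1 + of_real \<delta> * l)" if \<epsilon>: "0 < \<epsilon>" "\<epsilon> < Re l" and \<delta>: "\<delta> > 0" for \<epsilon> \<delta>
  proof -
    \<comment> \<open>The exponential has modulus exp (Re z - Im M). On the line Re z = \<epsilon>
      this is at most exp \<epsilon> by positivity of Im M; on the arc only the bound exp C is
      known, and the denominator outweighs it as soon as R exceeds exp C / \<delta>. Afterwards
      \<delta> and then \<epsilon> tend to 0.\<close>
    define F where "F = (\<lambda>z. exp (\<i> * (M z - \<i> * z)) / (1 + of_real \<delta> * z))"
    define R where "R = R1 + R2 + exp C / \<delta> + cmod l + 1"
    have pos: "0 \<le> exp C / \<delta>" using \<delta> by simp
    define D where "D = {z. \<epsilon> < Re z \<and> cmod z < R}"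
    define D' where "D' = {z. \<epsilon> \<le> Re z \<and> cmod z \<le> R}"
    have opD: "open D" unfolding D_def by (intro open_Collect_conj open_Collect_less continuous_intros)
    have clD: "closure D \<subseteq> D'"
      by (rule closure_minimal) (auto simp: D_def D'_def intro!: closed_Collect_conj closed_Collect_le continuous_intros)
    have D'S: "D' \<subseteq> S" using \<epsilon> by (auto simp: D'_def S_def)
    have den: "1 \<le> cmod (1 + of_real \<delta> * z)" "\<delta> * cmod z \<le> cmod (1 + of_real \<delta> * z)" if "z \<in> S" for z
    proof -
      have "1 \<le> Re (1 + of_real \<delta> * z)" using that \<delta> by (simp add: S_def)
      then show "1 \<le> cmod (1 + of_real \<delta> * z)" using complex_Re_le_cmod[of "1 + of_real \<delta> * z"] by linarith
      have "(cmod (1 + of_real \<delta> * z))\<^sup>2 = (1 + \<delta> * Re z)\<^sup>2 + (\<delta> * Im z)\<^sup>2" by (simp add: cmod_power2)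
      moreover have "(\<delta> * cmod z)\<^sup>2 = (\<delta> * Re z)\<^sup>2 + (\<delta> * Im z)\<^sup>2" by (simp add: cmod_power2 power_mult_distrib distrib_left)
      moreover have "(\<delta> * Re z)\<^sup>2 \<le> (1 + \<delta> * Re z)\<^sup>2" using that \<delta> by (intro power_mono) (auto simp: S_def)
      ultimately show "\<delta> * cmod z \<le> cmod (1 + of_real \<delta> * z)" by (intro power2_le_imp_le[OF _ norm_ge_zero]) simp
    qed
    then have ne: "1 + of_real \<delta> * z \<noteq> 0" if "z \<in> S" for z using that by fastforce
    have holF: "F holomorphic_on S" unfolding F_def by (intro holomorphic_intros holM) (use ne in auto)
    have nF: "cmod (F z) = exp (- Im (M z - \<i> * z)) / cmod (1 + of_real \<delta> * z)" for z
      by (simp add: F_def norm_divide)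
    have "cmod (F l) \<le> exp \<epsilon>"
    proof (rule maximum_modulus_frontier[where S = D and f = F])
      show "bounded D" by (auto simp: bounded_iff D_def intro!: exI[of _ R])
      show "F holomorphic_on interior D" using holF clD D'S closure_subset[of D] interior_subset[of D]
        by (meson holomorphic_on_subset subset_trans)
      show "continuous_on (closure D) F"
        by (rule continuous_on_subset[OF holomorphic_on_imp_continuous_on[OF holF]]) (use clD D'S in blast)
      show "l \<in> D" using \<epsilon> R1(1) R2(1) pos by (simp add: D_def R_def)
      fix z assume "z \<in> frontier D"
      then have z: "z \<in> D'" "z \<notin> D" using clD opD by (auto simp: frontier_def interior_open)
      then have zS: "z \<in> S" using D'S by blast
      consider "Re z = \<epsilon>" | "cmod z = R" using z by (force simp: D_def D'_def)
      then show "cmod (F z) \<le> exp \<epsilon>"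
      proof cases
        case 1
        then have "- Im (M z - \<i> * z) \<le> \<epsilon>" using ImM[OF zS] by simp
        then have "exp (- Im (M z - \<i> * z)) \<le> exp \<epsilon>" by simp
        moreover have "exp (- Im (M z - \<i> * z)) / cmod (1 + of_real \<delta> * z) \<le> exp (- Im (M z - \<i> * z)) / 1"
          using den(1)[OF zS] by (intro divide_left_mono) auto
        ultimately show ?thesis unfolding nF div_by_1 by linarith
      next
        case 2
        have "cmod (M z - \<i> * z) \<le> C" using R1(1) R2(1) pos 2 by (intro big[OF zS]) (auto simp: R_def)
        then have "exp (- Im (M z - \<i> * z)) \<le> exp C" using abs_Im_le_cmod[of "M z - \<i> * z"] unfolding exp_le_cancel_iff by linarith
        moreover have "exp C \<le> \<delta> * R" using \<delta> R1(1) R2(1) by (simp add: R_def field_simps add_nonneg_nonneg)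
        ultimately have "exp (- Im (M z - \<i> * z)) \<le> cmod (1 + of_real \<delta> * z)" using den(2)[OF zS] unfolding 2 by linarith
        then have "cmod (F z) \<le> 1" unfolding nF using den(1)[OF zS] by (simp add: divide_le_eq)
        then show ?thesis using \<epsilon> by (auto intro: order_trans)
      qed
    qed
    moreover have "0 < cmod (1 + of_real \<delta> * l)" using den(1)[OF lS] by linarith
    ultimately show ?thesis unfolding nF by (simp only: pos_divide_le_eq)
  qed
  have key2: "exp (- Im (M l - \<i> * l)) \<le> exp \<epsilon>" if \<epsilon>: "0 < \<epsilon>" "\<epsilon> < Re l" for \<epsilon>
  proof -
    have "((\<lambda>\<delta>. exp \<epsilon> * cmod (1 + of_real \<delta> * l)) \<longlongrightarrow> exp \<epsilon> * cmod (1 + of_real 0 * l)) (at_right 0)"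
      by (intro tendsto_intros)
    then have "((\<lambda>\<delta>. exp \<epsilon> * cmod (1 + of_real \<delta> * l)) \<longlongrightarrow> exp \<epsilon>) (at_right 0)" by simp
    then show ?thesis
      by (rule tendsto_lowerbound) (use key[OF \<epsilon>] in \<open>auto intro: eventually_mono[OF eventually_at_right_less]\<close>)
  qed
  have "- Im (M l - \<i> * l) \<le> 0"
  proof (rule field_le_epsilon)
    fix e :: real assume e: "e > 0"
    have "- Im (M l - \<i> * l) \<le> min e (Re l / 2)"
      using key2[of "min e (Re l / 2)"] e l(2) by simp
    then show "- Im (M l - \<i> * l) \<le> 0 + e" by simp
  qed
  then show ?thesis using l by (simp add: M_def U_def uhp_closed_def)
qed

text \<open>For k > 0 the Wronskian with the conjugate gives Im (dpsi / psi) = k / |psi|^2, so the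
  lower bound k for the left side is exactly |psi| \<le> 1. Negative k follows by
  conjugation.\<close>

lemma reflectionless_psi_le_1:
  assumes q: "integrable lebesgue q" and r: "reflectionless q" and k: "k \<noteq> 0"
  shows "cmod (psi q (of_real k) x) \<le> 1"
proof -
  have pos: "cmod (psi q (of_real k) x) \<le> 1" if k: "k > 0" for k
  proof -
    have z: "complex_of_real k \<in> uhp_closed" "Re (complex_of_real k) > 0" using k by (auto simp: uhp_closed_def)
    have "psi q (of_real k) x * cnj (dpsi q (of_real k) x) - dpsi q (of_real k) x * cnj (psi q (of_real k) x) = - 2 * \<i> * of_real k"
      using wronskian_psi_real[OF q, of k x] psi_cnj[OF q z(1), of x] k by simp
    from arg_cong[OF this, of Im] have w: "Im (dpsi q (of_real k) x * cnj (psi q (of_real k) x)) = k" by (simp add: algebra_simps)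
    have n: "(cmod (psi q (of_real k) x))\<^sup>2 > 0" using psi_nonzero[OF q z] by simp
    have "k \<le> k / (cmod (psi q (of_real k) x))\<^sup>2"
      using reflectionless_weyl_lower_bound[OF q r z, of x] unfolding weyl_quotient[OF q z] w by simp
    then have "(cmod (psi q (of_real k) x))\<^sup>2 \<le> 1\<^sup>2" using n k by (simp add: field_simps)
    then show ?thesis by (rule power2_le_imp_le) simp
  qed
  show ?thesis
  proof (cases "k > 0")
    case False
    have "- cnj (complex_of_real (- k)) = complex_of_real k" by simp
    then have "psi q (of_real k) x = cnj (psi q (of_real (- k)) x)"
      using psi_cnj(1)[OF q of_real_in_uhp_closed[of "- k"], of x] k by simp
    then show ?thesis using pos[of "- k"] False k by simp
  qed (use pos in simp)
qed

section \<open>Growth of the Jost solutions near zero\<close>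

lemma l1_norm_reflect:
  "l1_norm (\<lambda>t. q (- t)) = l1_norm q"
  using lebesgue_integral_real_affine[of "-1" "\<lambda>t. \<bar>q t\<bar>" 0] by (simp add: l1_norm_def)

lemma lac_gronwall_homogeneous:
  assumes F: "loc_abs_cont_deriv F f"
    and k0: "\<And>x. 0 \<le> k x" and k: "\<And>a b. k absolutely_integrable_on {a..b}"
    and b: "\<And>x. cmod (f x) \<le> k x * cmod (F x)" and cd: "c \<le> d"
  shows "cmod (F d) \<le> cmod (F c) * exp (integral {c..d} k)"
    and "cmod (F c) \<le> cmod (F d) * exp (integral {c..d} k)"
  using lac_gronwall[OF F lac_const[of 0] k0 k _ cd] b by simp_all

lemma integral_abs_eq_l1_tail_diff:
  assumes q: "integrable lebesgue q" and "a \<le> b"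
  shows "integral {a..b} (\<lambda>t. \<bar>q t\<bar>) = l1_tail q a - l1_tail q b"
  using tail_integral_split[OF abs_q_set_integrable[OF q] assms(2)] by (simp add: l1_tail_def)

text \<open>This combination has derivative \<open>q * jost_mod\<close>, tends to 2 i z at
  +infinity, and is dpsi + i z psi up to an exponential factor. Its limit at -infinity is 2 i z a,
  so it connects a with known data.\<close>

definition jost_sum :: "(real \<Rightarrow> real) \<Rightarrow> complex \<Rightarrow> real \<Rightarrow> complex" where
  "jost_sum q z x = 2 * \<i> * z * jost_mod q z x + jost_mod_deriv q z x"

lemma jost_sum_eq: "jost_sum q z x * exp (\<i> * z * of_real x) = dpsi q z x + \<i> * z * psi q z x"
  by (simp add: jost_sum_def psi_def dpsi_def algebra_simps)

context
  fixes q :: "real \<Rightarrow> real" and z :: complex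
  assumes q: "integrable lebesgue q" and zu: "z \<in> uhp_closed" and re: "Re z > 0"
begin

text \<open>Since \<open>dpsi / psi\<close> and \<open>i z\<close> both lie in the upper half plane, no cancellation occurs in
  \<open>dpsi + i z psi\<close>.\<close>

lemma weyl_sum_lower_bound:
  assumes w: "Im w > 0"
  shows "(Im w) * cmod (psi q z x) \<le> cmod (dpsi q z x + w * psi q z x)"
proof -
  have p: "psi q z x \<noteq> 0" by (rule psi_nonzero[OF q zu re])
  have "Im (dpsi q z x / psi q z x) > 0"
    unfolding weyl_quotient[OF q zu re] using weyl_positivity[OF q zu re] p by simp
  then have "Im w \<le> Im (dpsi q z x / psi q z x + w)" by simp
  also have "\<dots> \<le> cmod (dpsi q z x / psi q z x + w)" using abs_Im_le_cmod[of "dpsi q z x / psi q z x + w"] by linarith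
  finally have "Im w * cmod (psi q z x) \<le> cmod (dpsi q z x / psi q z x + w) * cmod (psi q z x)"
    by (rule mult_right_mono) simp
  also have "\<dots> = cmod (dpsi q z x + w * psi q z x)"
  proof -
    have "(dpsi q z x / psi q z x + w) * psi q z x = dpsi q z x + w * psi q z x"
      using p by (simp add: distrib_right)
    then show ?thesis by (simp only: norm_mult[symmetric])
  qed
  finally show ?thesis .
qed

text \<open>The derivative is q m, and \<open>weyl_sum_lower_bound\<close> with w = i z, where Im w
  = Re z, bounds |m| by |jost_sum| / Re z. The exponent contains only the integral of |q|, not the
  length of the interval, so it can be used on half lines.\<close>

lemma jost_sum_gronwall:
  assumes cd: "c \<le> d"
  shows "cmod (jost_sum q z d) \<le> cmod (jost_sum q z c) * exp (integral {c..d} (\<lambda>t. \<bar>q t\<bar>) / Re z)"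
    and "cmod (jost_sum q z c) \<le> cmod (jost_sum q z d) * exp (integral {c..d} (\<lambda>t. \<bar>q t\<bar>) / Re z)"
proof -
  have z': "0 \<le> Im z" "z \<noteq> 0" using zu by (auto simp: uhp_closed_def)
  note L = lac_jost_mod[OF q z']
  have lg: "loc_abs_cont_deriv (jost_sum q z) (\<lambda>x. of_real (q x) * jost_mod q z x)"
    by (rule lac_transform[OF lac_add[OF lac_cmult[OF L(1), of "2 * \<i> * z"] L(2)]]) (simp_all add: jost_sum_def)
  have b: "cmod (of_real (q x) * jost_mod q z x) \<le> \<bar>q x\<bar> / Re z * cmod (jost_sum q z x)" for x
  proof -
    have e0: "cmod (exp (\<i> * z * of_real x)) > 0" by simp
    have "Re z * cmod (psi q z x) \<le> cmod (jost_sum q z x * exp (\<i> * z * of_real x))"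
      unfolding jost_sum_eq using weyl_sum_lower_bound[of "\<i> * z" x] re by simp
    then have "(Re z * cmod (jost_mod q z x)) * cmod (exp (\<i> * z * of_real x)) \<le> cmod (jost_sum q z x) * cmod (exp (\<i> * z * of_real x))"
      unfolding psi_def norm_mult by (simp only: mult_ac)
    then have "Re z * cmod (jost_mod q z x) \<le> cmod (jost_sum q z x)" using e0 by (rule mult_right_le_imp_le)
    then have "\<bar>q x\<bar> / Re z * (Re z * cmod (jost_mod q z x)) \<le> \<bar>q x\<bar> / Re z * cmod (jost_sum q z x)"
      using re by (intro mult_left_mono) auto
    then show ?thesis using re by (simp add: norm_mult)
  qed
  have ki: "(\<lambda>t. \<bar>q t\<bar> / Re z) absolutely_integrable_on {a..b}" for a b
    using abs_q_set_integrable[OF q, of "{a..b}"] by simp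
  have k0: "0 \<le> \<bar>q x\<bar> / Re z" for x using re by simp
  have "integral {c..d} (\<lambda>t. \<bar>q t\<bar> / Re z) = integral {c..d} (\<lambda>t. \<bar>q t\<bar>) / Re z" by simp
  with lac_gronwall_homogeneous[OF lg k0 ki b cd]
  show "cmod (jost_sum q z d) \<le> cmod (jost_sum q z c) * exp (integral {c..d} (\<lambda>t. \<bar>q t\<bar>) / Re z)"
    "cmod (jost_sum q z c) \<le> cmod (jost_sum q z d) * exp (integral {c..d} (\<lambda>t. \<bar>q t\<bar>) / Re z)" by simp_all
qed

lemma jost_sum_tendsto: "(jost_sum q z \<longlongrightarrow> 2 * \<i> * z) at_top"
proof -
  have "((\<lambda>x. 2 * \<i> * z * jost_mod q z x + jost_mod_deriv q z x) \<longlongrightarrow> 2 * \<i> * z * 1 + 0) at_top"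
    by (intro tendsto_intros jost_mod_tendsto q zu)
  then show ?thesis by (simp add: jost_sum_def[abs_def])
qed

text \<open>The right endpoint of the Gronwall estimates is sent to +infinity, where
  \<open>jost_sum\<close> tends to 2 i z.\<close>

lemma jost_sum_tail:
  shows "cmod (jost_sum q z x) \<le> 2 * cmod z * exp (l1_tail q x / Re z)"
    and "2 * cmod z * exp (- (l1_tail q x / Re z)) \<le> cmod (jost_sum q z x)"
proof -
  have mono: "exp (integral {x..t} (\<lambda>t. \<bar>q t\<bar>) / Re z) \<le> exp (l1_tail q x / Re z)" if "x \<le> t" for t
    using re l1_tail_nonneg[OF q, of t] by (simp add: integral_abs_eq_l1_tail_diff[OF q that] divide_right_mono)
  have lim: "((\<lambda>t. cmod (jost_sum q z t)) \<longlongrightarrow> 2 * cmod z) at_top"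
    using tendsto_norm[OF jost_sum_tendsto] by (simp add: norm_mult)
  show "cmod (jost_sum q z x) \<le> 2 * cmod z * exp (l1_tail q x / Re z)"
  proof (rule tendsto_lowerbound[OF tendsto_mult_right[OF lim]])
    show "\<forall>\<^sub>F t in at_top. cmod (jost_sum q z x) \<le> cmod (jost_sum q z t) * exp (l1_tail q x / Re z)"
      by (rule eventually_mono[OF eventually_ge_at_top[of x]])
         (rule order_trans[OF jost_sum_gronwall(2) mult_left_mono[OF mono]]; simp)
  qed simp
  have "2 * cmod z \<le> cmod (jost_sum q z x) * exp (l1_tail q x / Re z)"
  proof (rule tendsto_upperbound[OF lim])
    show "\<forall>\<^sub>F t in at_top. cmod (jost_sum q z t) \<le> cmod (jost_sum q z x) * exp (l1_tail q x / Re z)"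
      by (rule eventually_mono[OF eventually_ge_at_top[of x]])
         (rule order_trans[OF jost_sum_gronwall(1) mult_left_mono[OF mono]]; simp)
  qed simp
  then show "2 * cmod z * exp (- (l1_tail q x / Re z)) \<le> cmod (jost_sum q z x)"
    by (simp add: exp_minus field_simps)
qed

text \<open>The first bound is \<open>weyl_sum_lower_bound\<close> with w = i. In the second the
  cross term of the expanded square is positive by \<open>weyl_positivity\<close>.\<close>

lemma dpsi_i_psi_bounds:
  shows "cmod (psi q z x) \<le> cmod (dpsi q z x + \<i> * psi q z x)"
    and "cmod (dpsi q z x) \<le> cmod (dpsi q z x + \<i> * psi q z x)"
proof -
  show "cmod (psi q z x) \<le> cmod (dpsi q z x + \<i> * psi q z x)"
    using weyl_sum_lower_bound[of \<i> x] by simp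
  have "(cmod (dpsi q z x + \<i> * psi q z x))\<^sup>2 = (cmod (dpsi q z x))\<^sup>2 + (cmod (psi q z x))\<^sup>2 + 2 * Im (dpsi q z x * cnj (psi q z x))"
    unfolding cmod_power2 by (simp add: power2_eq_square algebra_simps)
  then have "(cmod (dpsi q z x))\<^sup>2 \<le> (cmod (dpsi q z x + \<i> * psi q z x))\<^sup>2"
    using weyl_positivity[OF q zu re, of x] by simp
  then show "cmod (dpsi q z x) \<le> cmod (dpsi q z x + \<i> * psi q z x)" by (rule power2_le_imp_le) simp
qed

text \<open>With i in place of i z both psi and dpsi are controlled without division by Re z. The
  rate |q| + 2 is uniform in z but depends on the length of the interval, so this version
  complements \<open>jost_sum_gronwall\<close> on compact intervals.\<close>

lemma dpsi_i_psi_gronwall: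
  assumes cd: "c \<le> d" and z1: "cmod z \<le> 1"
  shows "cmod (dpsi q z d + \<i> * psi q z d) \<le> cmod (dpsi q z c + \<i> * psi q z c) * exp (l1_norm q + 2 * (d - c))"
    and "cmod (dpsi q z c + \<i> * psi q z c) \<le> cmod (dpsi q z d + \<i> * psi q z d) * exp (l1_norm q + 2 * (d - c))"
proof -
  have s: "sol q z (psi q z) (dpsi q z)" by (rule sol_psi[OF q zu])
  then have s2: "loc_abs_cont_deriv (dpsi q z) (\<lambda>x. (of_real (q x) - z\<^sup>2) * psi q z x)" by (simp add: sol_def)
  have lg: "loc_abs_cont_deriv (\<lambda>x. dpsi q z x + \<i> * psi q z x) (\<lambda>x. (of_real (q x) - z\<^sup>2) * psi q z x + \<i> * dpsi q z x)"
    by (rule lac_add[OF s2 lac_cmult[OF sol_lac[OF s]]])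
  define k where "k = (\<lambda>x. \<bar>q x\<bar> + 2)"
  have k0: "0 \<le> k x" for x by (simp add: k_def)
  have ki: "k absolutely_integrable_on {a..b}" for a b
    unfolding k_def by (intro set_integral_add abs_q_set_integrable[OF q] absolutely_integrable_continuous_real) auto
  have b: "cmod ((of_real (q x) - z\<^sup>2) * psi q z x + \<i> * dpsi q z x) \<le> k x * cmod (dpsi q z x + \<i> * psi q z x)" for x
  proof -
    define Z where "Z = cmod (dpsi q z x + \<i> * psi q z x)"
    have "(cmod z)\<^sup>2 \<le> 1" using z1 by (simp add: power_le_one)
    then have "cmod (of_real (q x) - z\<^sup>2) \<le> \<bar>q x\<bar> + 1"
      using norm_triangle_ineq4[of "of_real (q x)" "z\<^sup>2"] by (simp add: norm_power)
    then have "cmod (of_real (q x) - z\<^sup>2) * cmod (psi q z x) \<le> (\<bar>q x\<bar> + 1) * Z"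
      unfolding Z_def by (intro mult_mono dpsi_i_psi_bounds) auto
    moreover have "cmod (dpsi q z x) \<le> Z" unfolding Z_def by (rule dpsi_i_psi_bounds)
    moreover have "cmod ((of_real (q x) - z\<^sup>2) * psi q z x + \<i> * dpsi q z x) \<le> cmod (of_real (q x) - z\<^sup>2) * cmod (psi q z x) + cmod (dpsi q z x)"
      using norm_triangle_ineq[of "(of_real (q x) - z\<^sup>2) * psi q z x" "\<i> * dpsi q z x"] by (simp add: norm_mult)
    moreover have "k x * Z = (\<bar>q x\<bar> + 1) * Z + Z" by (simp add: k_def algebra_simps)
    ultimately show ?thesis unfolding Z_def by linarith
  qed
  have "integral {c..d} k = integral {c..d} (\<lambda>t. \<bar>q t\<bar>) + 2 * (d - c)"
    unfolding k_def using cd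
    by (subst Henstock_Kurzweil_Integration.integral_add)
       (auto intro!: absolutely_integrable_imp_integrable abs_q_set_integrable[OF q])
  also have "\<dots> \<le> l1_norm q + 2 * (d - c)"
    using integral_abs_eq_l1_tail_diff[OF q cd] l1_tail_le[OF q, of c] l1_tail_nonneg[OF q, of d] by simp
  finally have e: "exp (integral {c..d} k) \<le> exp (l1_norm q + 2 * (d - c))" by simp
  show "cmod (dpsi q z d + \<i> * psi q z d) \<le> cmod (dpsi q z c + \<i> * psi q z c) * exp (l1_norm q + 2 * (d - c))"
    by (rule order_trans[OF lac_gronwall_homogeneous(1)[OF lg k0 ki b cd] mult_left_mono[OF e]]) simp
  show "cmod (dpsi q z c + \<i> * psi q z c) \<le> cmod (dpsi q z d + \<i> * psi q z d) * exp (l1_norm q + 2 * (d - c))"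
    by (rule order_trans[OF lac_gronwall_homogeneous(2)[OF lg k0 ki b cd] mult_left_mono[OF e]]) simp
qed

text \<open>Allows switching between the two Gronwall estimates at an endpoint; the loss is a factor
  2 in one direction and 3 / Re z in the other.\<close>

lemma dpsi_sum_comparison:
  assumes z1: "cmod z \<le> 1"
  shows "cmod (dpsi q z x + \<i> * z * psi q z x) \<le> 2 * cmod (dpsi q z x + \<i> * psi q z x)"
    and "Re z * cmod (dpsi q z x + \<i> * psi q z x) \<le> 3 * cmod (dpsi q z x + \<i> * z * psi q z x)"
proof -
  let ?p = "psi q z x" and ?d = "dpsi q z x"
  have "cmod (?d + \<i> * z * ?p) \<le> cmod ?d + cmod z * cmod ?p"
    using norm_triangle_ineq[of ?d "\<i> * z * ?p"] by (simp add: norm_mult)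
  moreover have zp: "cmod z * cmod ?p \<le> 1 * cmod ?p" using z1 by (rule mult_right_mono) simp
  ultimately show "cmod (?d + \<i> * z * ?p) \<le> 2 * cmod (?d + \<i> * ?p)"
    using dpsi_i_psi_bounds[of x] by linarith
  have 1: "Re z * cmod ?p \<le> cmod (?d + \<i> * z * ?p)" using weyl_sum_lower_bound[of "\<i> * z" x] re by simp
  have re1: "Re z \<le> 1" using complex_Re_le_cmod[of z] z1 by linarith
  have "cmod ?d \<le> cmod (?d + \<i> * z * ?p) + cmod z * cmod ?p"
    using norm_triangle_ineq4[of "?d + \<i> * z * ?p" "\<i> * z * ?p"] by (simp add: norm_mult)
  moreover have "cmod (?d + \<i> * ?p) \<le> cmod ?d + cmod ?p"
    using norm_triangle_ineq[of ?d "\<i> * ?p"] by (simp add: norm_mult)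
  ultimately have "cmod (?d + \<i> * ?p) \<le> cmod (?d + \<i> * z * ?p) + 2 * cmod ?p" using zp by linarith
  then have "Re z * cmod (?d + \<i> * ?p) \<le> Re z * (cmod (?d + \<i> * z * ?p) + 2 * cmod ?p)"
    using re by (intro mult_left_mono) auto
  also have "\<dots> = Re z * cmod (?d + \<i> * z * ?p) + 2 * (Re z * cmod ?p)" by (simp add: algebra_simps)
  also have "Re z * cmod (?d + \<i> * z * ?p) \<le> 1 * cmod (?d + \<i> * z * ?p)" using re1 by (rule mult_right_mono) simp
  finally show "Re z * cmod (?d + \<i> * ?p) \<le> 3 * cmod (?d + \<i> * z * ?p)" using 1 by linarith
qed

end

lemma inverse_power_le_exp_inverse:
  assumes e: "e > 0" and C: "C > 0"
  shows "\<exists>d>0. \<forall>r::real. 0 < r \<and> r < d \<longrightarrow> C / r ^ n \<le> exp (e / r)"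
proof -
  have "((\<lambda>x. (e * x) ^ n / exp (e * x)) \<longlongrightarrow> 0) at_top"
    by (rule filterlim_compose[OF tendsto_power_div_exp_0])
       (rule filterlim_tendsto_pos_mult_at_top[OF tendsto_const e filterlim_ident])
  then have "\<forall>\<^sub>F x in at_top. (e * x) ^ n / exp (e * x) < e ^ n / C"
    using e C by (intro order_tendstoD(2)) auto
  then have "\<forall>\<^sub>F x in at_top. C * x ^ n \<le> exp (e * x)"
    by eventually_elim (use e C in \<open>simp add: field_simps power_mult_distrib\<close>)
  then obtain X where X: "\<And>x. x \<ge> X \<Longrightarrow> C * x ^ n \<le> exp (e * x)" by (auto simp: eventually_at_top_linorder)
  show ?thesis
  proof (intro exI[of _ "1 / (\<bar>X\<bar> + 1)"] conjI allI impI)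
    fix r :: real assume r: "0 < r \<and> r < 1 / (\<bar>X\<bar> + 1)"
    then have "\<bar>X\<bar> + 1 < 1 / r" by (simp add: field_simps)
    then have "C * (1 / r) ^ n \<le> exp (e * (1 / r))" by (intro X) simp
    then show "C / r ^ n \<le> exp (e / r)" by (simp add: power_divide)
  qed simp
qed

text \<open>Away from a compact interval \<open>[-b, b]\<close> the Gronwall exponent is \<open>\<epsilon> / Re z\<close>; on the interval it
  is bounded, up to a factor polynomial in \<open>1 / Re z\<close>.\<close>

lemma psi_subexponential:
  assumes q: "integrable lebesgue q" and e: "e > 0"
  shows "\<exists>d>0. \<forall>z\<in>uhp_closed. Re z \<noteq> 0 \<and> cmod z < d \<longrightarrow> cmod (psi q z x) \<le> exp (e / \<bar>Re z\<bar>)"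
proof -
  have "\<forall>\<^sub>F b in at_top. l1_tail q b < e / 2"
    using l1_tail_tendsto_0[OF q] e by (intro order_tendstoD(2)) auto
  then obtain b0 where "\<And>b. b \<ge> b0 \<Longrightarrow> l1_tail q b < e / 2" by (auto simp: eventually_at_top_linorder)
  then obtain b where b: "l1_tail q b < e / 2" "b \<ge> \<bar>x\<bar>"
    by (metis abs_ge_zero linorder_le_cases order.trans max.cobounded1 max.cobounded2)
  \<comment> \<open>The 6 is the 3 of \<open>dpsi_sum_comparison\<close> times the 2 of
    \<open>jost_sum_tail\<close>. Half of e pays for K / Re z, the other half for the tail of |q|
    beyond b.\<close>
  define K where "K = 6 * exp (l1_norm q + 2 * (b - x))"
  obtain d where d: "d > 0" "\<And>r. 0 < r \<Longrightarrow> r < d \<Longrightarrow> K / r ^ 1 \<le> exp ((e / 2) / r)"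
    using inverse_power_le_exp_inverse[of "e / 2" K 1] e by (auto simp: K_def)
  have pos: "cmod (psi q z x) \<le> exp (e / \<bar>Re z\<bar>)" if z: "z \<in> uhp_closed" "Re z > 0" "cmod z < min d 1" for z
  proof -
    have z1: "cmod z \<le> 1" and zi: "0 \<le> Im z" using z by (auto simp: uhp_closed_def)
    have rz: "Re z < d" using z complex_Re_le_cmod[of z] by auto
    have xb: "x \<le> b" using b by simp
    let ?Z = "\<lambda>x. cmod (dpsi q z x + \<i> * psi q z x)"
    have "cmod (psi q z x) \<le> ?Z x" by (rule dpsi_i_psi_bounds(1)[OF q z(1,2)])
    also have "\<dots> \<le> ?Z b * exp (l1_norm q + 2 * (b - x))" by (rule dpsi_i_psi_gronwall(2)[OF q z(1,2) xb z1])
    also have "?Z b \<le> 3 * (2 * exp (l1_tail q b / Re z)) / Re z"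
    proof -
      have "cmod (dpsi q z b + \<i> * z * psi q z b) = cmod (jost_sum q z b) * cmod (exp (\<i> * z * of_real b))"
        using jost_sum_eq[of q z b] by (metis norm_mult)
      also have "\<dots> \<le> (2 * 1 * exp (l1_tail q b / Re z)) * 1"
        using jost_sum_tail(1)[OF q z(1,2), of b] z1 zi b
        by (intro mult_mono order_trans[OF jost_sum_tail(1)[OF q z(1,2), of b] mult_right_mono]) auto
      finally have "3 * cmod (dpsi q z b + \<i> * z * psi q z b) \<le> 3 * (2 * exp (l1_tail q b / Re z))" by simp
      with dpsi_sum_comparison(2)[OF q z(1,2) z1, of b] have "Re z * ?Z b \<le> 3 * (2 * exp (l1_tail q b / Re z))" by linarith
      then show ?thesis using z(2) by (simp add: field_simps)
    qed
    finally have "cmod (psi q z x) \<le> 3 * (2 * exp (l1_tail q b / Re z)) / Re z * exp (l1_norm q + 2 * (b - x))"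
      by simp
    also have "\<dots> = K / Re z ^ 1 * exp (l1_tail q b / Re z)" by (simp add: K_def)
    also have "\<dots> \<le> exp ((e / 2) / Re z) * exp ((e / 2) / Re z)"
    proof (intro mult_mono)
      have "l1_tail q b / Re z \<le> (e / 2) / Re z" using b z(2) by (intro divide_right_mono) auto
      then show "exp (l1_tail q b / Re z) \<le> exp ((e / 2) / Re z)" by (simp only: exp_le_cancel_iff)
      show "K / Re z ^ 1 \<le> exp ((e / 2) / Re z)" by (rule d(2)[OF z(2) rz])
    qed simp_all
    also have "\<dots> = exp (e / Re z)" by (simp flip: exp_add add: field_simps)
    finally show ?thesis using z by simp
  qed
  show ?thesis
  proof (intro exI[of _ "min d 1"] conjI ballI impI)
    show "0 < min d 1" using d by simp
    fix z assume z: "z \<in> uhp_closed" and h: "Re z \<noteq> 0 \<and> cmod z < min d 1"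
    show "cmod (psi q z x) \<le> exp (e / \<bar>Re z\<bar>)"
    proof (cases "Re z > 0")
      case False
      have "- cnj z \<in> uhp_closed" "Re (- cnj z) > 0" "cmod (- cnj z) < min d 1"
        using z h False by (auto simp: uhp_closed_def)
      then have "cmod (psi q (- cnj z) x) \<le> exp (e / \<bar>Re (- cnj z)\<bar>)" by (rule pos)
      then show ?thesis unfolding psi_cnj(1)[OF q z] by simp
    qed (use pos z h in blast)
  qed
qed

section \<open>The inverse transmission coefficient as a limit at -infinity\<close>

lemma jost_a_cnj:
  assumes q: "integrable lebesgue q" and z: "z \<in> uhp_closed"
  shows "jost_a q (- cnj z) = cnj (jost_a q z)"
  using psi_cnj[OF q z, of 0] psi_cnj[OF integrable_lebesgue_reflect[OF q] z, of 0]
  by (simp add: jost_a_def psiL_def dpsiL_def)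

text \<open>As x tends to -infinity, exp (2 i z (t - x)) tends to 0 for each fixed t because Im z >
  0, and the integrand stays below C |q|; dominated convergence gives the first limit. In the second
  the tail integral becomes the integral over the line.\<close>

lemma volterra_tails_at_bot:
  assumes q: "integrable lebesgue q" and z: "z \<in> uhp"
  shows "(jost_mod_deriv q z \<longlongrightarrow> 0) at_bot"
    and "(jost_sum q z \<longlongrightarrow> 2 * \<i> * z - (LINT t|lebesgue. of_real (q t) * jost_mod q z t)) at_bot"
proof -
  have zc: "z \<in> uhp_closed" and z': "0 \<le> Im z" "z \<noteq> 0" and zp: "Im z > 0"
    using z by (auto simp: uhp_def uhp_closed_def)
  define C where "C = exp (l1_norm q / cmod z)"
  have b: "cmod (jost_mod q z t) \<le> C" for t
    unfolding C_def using norm_jost_mod_le'[OF q z'(1), of "cmod z" t] z' by simp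
  have mm: "jost_mod q z \<in> borel_measurable lebesgue"
    by (rule borel_measurable_lebesgue_continuous[OF continuous_jost_mod[OF q z']])
  have i: "integrable lebesgue (\<lambda>t. of_real (q t) * jost_mod q z t)"
    using mult_q_integrable[OF q mm, of UNIV C] b by (simp add: set_integrable_def mult.commute)
  have "(LINT t:{x..}|lebesgue. of_real (q t) * jost_mod q z t) = 2 * \<i> * z - jost_sum q z x" for x
    using lac_jost_mod(3)[OF q z', of x] unfolding jost_sum_def by (simp add: algebra_simps)
  then have "((\<lambda>x. 2 * \<i> * z - (2 * \<i> * z - jost_sum q z x)) \<longlongrightarrow> 2 * \<i> * z - (LINT t|lebesgue. of_real (q t) * jost_mod q z t)) at_bot"
    using tendsto_diff[OF tendsto_const[of "2 * \<i> * z"] tail_integral_tendsto_at_bot[OF i]] by simp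
  then show "(jost_sum q z \<longlongrightarrow> 2 * \<i> * z - (LINT t|lebesgue. of_real (q t) * jost_mod q z t)) at_bot"
    by simp
  have "((\<lambda>x. volterra_exp q z (jost_mod q z) (- x)) \<longlongrightarrow> 0) at_top"
  proof -
    let ?F = "\<lambda>x t. indicat_real {- x..} t *\<^sub>R (exp (2 * \<i> * z * of_real (t - (- x))) * (of_real (q t) * jost_mod q z t))"
    have "((\<lambda>x. LINT t|lebesgue. ?F x t) \<longlongrightarrow> (LINT t::real|lebesgue. (0::complex))) at_top"
    proof (rule tendsto_at_topI_sequentially, rule integral_dominated_convergence[where w = "\<lambda>t. C * \<bar>q t\<bar>"])
      fix X :: "nat \<Rightarrow> real" assume X: "filterlim X at_top sequentially"
      show "integrable lebesgue (\<lambda>t. C * \<bar>q t\<bar>)" using abs_q_integrable[OF q] by simp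
      show "?F (X n) \<in> borel_measurable lebesgue" for n
      proof -
        have "(\<lambda>t. exp (2 * \<i> * z * of_real (t - (- X n)))) \<in> borel_measurable lebesgue"
          by (rule borel_measurable_lebesgue_continuous) (intro continuous_intros)
        then show ?thesis using mm q_measurable[OF q]
          by (intro borel_measurable_scaleR borel_measurable_indicator borel_measurable_times borel_measurable_of_real) auto
      qed
      show "AE t in lebesgue. norm (?F (X n) t) \<le> C * \<bar>q t\<bar>" for n
      proof (rule AE_I2)
        fix t :: real
        define x where "x = X n"
        have "norm (?F x t) \<le> C * \<bar>q t\<bar>"
        proof (cases "- x \<le> t")
          case True
          have "cmod (exp (2 * \<i> * z * of_real (t - (- x)))) * (\<bar>q t\<bar> * cmod (jost_mod q z t)) \<le> 1 * (\<bar>q t\<bar> * C)"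
            using norm_exp_i_le_1[OF z'(1), of "t - (- x)"] b[of t] True by (intro mult_mono) auto
          then show ?thesis using True by (simp add: norm_mult mult.commute)
        qed (simp add: C_def)
        then show "norm (?F (X n) t) \<le> C * \<bar>q t\<bar>" by (simp only: x_def)
      qed
      show "AE t in lebesgue. (\<lambda>n. ?F (X n) t) \<longlonglongrightarrow> 0"
      proof (rule AE_I2)
        fix t :: real
        have "((\<lambda>x. exp (\<i> * (2 * z) * of_real (t + x))) \<longlongrightarrow> 0) at_top"
          using z by (intro filterlim_compose[OF psi_decay(1)[OF q]] filterlim_tendsto_add_at_top[OF tendsto_const] filterlim_ident)
            (simp add: uhp_def)
        then have "((\<lambda>x. exp (2 * \<i> * z * of_real (t - (- x))) * (of_real (q t) * jost_mod q z t)) \<longlongrightarrow> 0 * (of_real (q t) * jost_mod q z t)) at_top"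
          by (intro tendsto_mult tendsto_const) (simp add: mult_ac)
        then have l: "((\<lambda>x. cmod (exp (2 * \<i> * z * of_real (t - (- x))) * (of_real (q t) * jost_mod q z t))) \<longlongrightarrow> 0) at_top"
          by (simp add: tendsto_norm_zero)
        have "((\<lambda>x. ?F x t) \<longlongrightarrow> 0) at_top"
          by (rule Lim_null_comparison[OF always_eventually l]) (auto simp: indicator_def)
        then show "(\<lambda>n. ?F (X n) t) \<longlonglongrightarrow> 0" by (rule filterlim_compose[OF _ X])
      qed
    qed auto
    then show ?thesis unfolding volterra_exp_def set_lebesgue_integral_def by simp
  qed
  then have "((\<lambda>x. - volterra_exp q z (jost_mod q z) (- x)) \<longlongrightarrow> - 0) at_top" by (intro tendsto_minus)
  then show "(jost_mod_deriv q z \<longlongrightarrow> 0) at_bot"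
    unfolding filterlim_at_bot_mirror jost_mod_deriv_def by simp
qed

text \<open>The Wronskian defining a is evaluated at -infinity. The exponentials of psi and psiL
  cancel, and of the left factors only the limit 1 of the reflected \<open>jost_mod\<close>
  survives, next to a derivative tending to 0.\<close>

lemma jost_sum_at_bot:
  assumes q: "integrable lebesgue q" and z: "z \<in> uhp"
  shows "(jost_sum q z \<longlongrightarrow> 2 * \<i> * z * jost_a q z) at_bot"
proof -
  let ?q = "\<lambda>t. q (- t)"
  note q' = integrable_lebesgue_reflect[OF q]
  have zc: "z \<in> uhp_closed" using z uhp_subset by blast
  obtain G where G: "(jost_sum q z \<longlongrightarrow> G) at_bot" using volterra_tails_at_bot(2)[OF q z] by blast
  note v0 = volterra_tails_at_bot(1)[OF q z]
  have refl: "(f \<longlongrightarrow> c) at_top \<Longrightarrow> ((\<lambda>x. f (- x)) \<longlongrightarrow> c) at_bot" for f :: "real \<Rightarrow> complex" and c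
    by (simp add: filterlim_at_bot_mirror)
  note m' = refl[OF jost_mod_tendsto(1)[OF q' zc]] refl[OF jost_mod_tendsto(2)[OF q' zc]]
  define m where "m = jost_mod q z" define v where "v = jost_mod_deriv q z"
  define n where "n = (\<lambda>x. jost_mod ?q z (- x))" define w where "w = (\<lambda>x. jost_mod_deriv ?q z (- x))"
  have z0: "2 * \<i> * z \<noteq> 0" using zc by (auto simp: uhp_closed_def)
  have eq: "- 2 * \<i> * z * jost_a q z = - jost_sum q z x * n x - m x * w x" for x
  proof -
    have e: "exp (\<i> * z * of_real x) * exp (\<i> * z * of_real (- x)) = 1" by (simp flip: exp_add)
    have "- 2 * \<i> * z * jost_a q z = psi q z x * dpsiL q z x - dpsi q z x * psiL q z x"
      using wronskian_psi_psiL[OF q zc, of x] by simp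
    also have "\<dots> = (exp (\<i> * z * of_real x) * exp (\<i> * z * of_real (- x))) * (- jost_sum q z x * n x - m x * w x)"
      unfolding psi_def dpsi_def psiL_def dpsiL_def jost_sum_def m_def n_def w_def by (simp add: algebra_simps)
    finally show ?thesis unfolding e by simp
  qed
  have m: "m x = (jost_sum q z x - v x) / (2 * \<i> * z)" for x
    using z0 by (simp add: jost_sum_def m_def v_def)
  have "((\<lambda>x. - jost_sum q z x * n x - (jost_sum q z x - v x) / (2 * \<i> * z) * w x) \<longlongrightarrow> - G * 1 - (G - 0) / (2 * \<i> * z) * 0) at_bot"
    unfolding n_def w_def v_def by (intro tendsto_intros G m' v0 z0)
  then have "((\<lambda>x. - jost_sum q z x * n x - m x * w x) \<longlongrightarrow> - G) at_bot" unfolding m by simp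
  then have "((\<lambda>x::real. - 2 * \<i> * z * jost_a q z) \<longlongrightarrow> - G) at_bot" unfolding eq[symmetric] .
  then have "- 2 * \<i> * z * jost_a q z = - G" using tendsto_unique[OF trivial_limit_at_bot_linorder] tendsto_const by blast
  then show ?thesis using G by simp
qed

lemma jost_mod_at_bot:
  assumes q: "integrable lebesgue q" and z: "z \<in> uhp"
  shows "(jost_mod q z \<longlongrightarrow> jost_a q z) at_bot"
proof -
  have z0: "2 * \<i> * z \<noteq> 0" using z by (auto simp: uhp_def)
  have "((\<lambda>x. (jost_sum q z x - jost_mod_deriv q z x) / (2 * \<i> * z)) \<longlongrightarrow> (2 * \<i> * z * jost_a q z - 0) / (2 * \<i> * z)) at_bot"
    by (intro tendsto_intros jost_sum_at_bot volterra_tails_at_bot q z z0)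
  then show ?thesis using z0 by (simp add: jost_sum_def)
qed

text \<open>\<open>jost_sum\<close> runs from 2 i z a at -infinity to 2 i z at +infinity, so |a| is
  bounded below once its growth is bounded above. Outside [-b, b] the rate |q| / Re z is used, the
  mass of |q| there being at most e / 4 on each side; across [-b, b] the rate |q| + 2 is
  used.\<close>

lemma jost_a_lower_bound:
  assumes q: "integrable lebesgue q" and e: "e > 0"
  shows "\<exists>d>0. \<forall>z\<in>uhp. Re z \<noteq> 0 \<and> cmod z < d \<longrightarrow> exp (- (e / \<bar>Re z\<bar>)) \<le> cmod (jost_a q z)"
proof -
  have "\<forall>\<^sub>F b in at_top. l1_tail q b < e / 4"
    using l1_tail_tendsto_0[OF q] e by (intro order_tendstoD(2)) auto
  then obtain b0 where b0: "\<And>b. b \<ge> b0 \<Longrightarrow> l1_tail q b < e / 4" by (auto simp: eventually_at_top_linorder)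
  have "((\<lambda>x. l1_tail q x) \<longlongrightarrow> l1_norm q) at_bot"
    using tail_integral_tendsto_at_bot[OF abs_q_integrable[OF q]] by (simp add: l1_tail_def[abs_def] l1_norm_def)
  then have "\<forall>\<^sub>F b in at_bot. l1_norm q - e / 4 < l1_tail q b"
    using e by (intro order_tendstoD(1)) auto
  then obtain b1 where b1: "\<And>b. b \<le> b1 \<Longrightarrow> l1_norm q - e / 4 < l1_tail q b" by (auto simp: eventually_at_bot_linorder)
  define b where "b = \<bar>b0\<bar> + \<bar>b1\<bar>"
  have b: "b \<ge> 0" "l1_tail q b < e / 4" "l1_norm q - l1_tail q (- b) < e / 4"
  proof -
    have "b0 \<le> b" "- b \<le> b1" unfolding b_def by linarith+
    then show "l1_tail q b < e / 4" "l1_norm q - l1_tail q (- b) < e / 4"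
      using b0[of b] b1[of "- b"] by simp_all
  qed (simp add: b_def)
  \<comment> \<open>The first factor is the growth across [-b, b]; the second pays for |exp (i z x)|
    at the two endpoints, where Im z \<le> 1. The 6 in K is 2 times 3 from
    \<open>dpsi_sum_comparison\<close>. The tails consume e / 2 in all, and K / Re z the other e /
    2.\<close>
  define C where "C = exp (l1_norm q + 2 * (b + b)) * exp (2 * b)"
  define K where "K = 6 * C"
  obtain d where d: "d > 0" "\<And>r. 0 < r \<Longrightarrow> r < d \<Longrightarrow> K / r ^ 1 \<le> exp ((e / 2) / r)"
    using inverse_power_le_exp_inverse[of "e / 2" K 1] e by (auto simp: K_def C_def)
  have pos: "exp (- (e / \<bar>Re z\<bar>)) \<le> cmod (jost_a q z)" if z: "z \<in> uhp" "Re z > 0" "cmod z < min d 1" for z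
  proof -
    have zc: "z \<in> uhp_closed" using z uhp_subset by blast
    have z1: "cmod z \<le> 1" and zi: "0 < Im z" "Im z \<le> 1" using z abs_Im_le_cmod[of z] by (auto simp: uhp_def)
    have rz: "Re z < d" using z complex_Re_le_cmod[of z] by auto
    define E where "E = exp ((e / 4) / Re z)"
    have E: "E > 0" by (simp add: E_def)
    let ?Z = "\<lambda>x. cmod (dpsi q z x + \<i> * psi q z x)"
    have gz: "cmod (jost_sum q z x) * exp (- (Im z * x)) = cmod (dpsi q z x + \<i> * z * psi q z x)" for x
    proof -
      have "cmod (exp (\<i> * z * of_real x)) = exp (- (Im z * x))" by simp
      then show ?thesis using jost_sum_eq[of q z x] by (metis norm_mult)
    qed
    have A: "2 * cmod z \<le> cmod (jost_sum q z b) * E"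
    proof -
      have "l1_tail q b / Re z \<le> (e/4) / Re z" using b z(2) by (intro divide_right_mono) auto
      then have "exp (- ((e/4) / Re z)) \<le> exp (- (l1_tail q b / Re z))" by (simp only: exp_le_cancel_iff neg_le_iff_le)
      then have "2 * cmod z * exp (- ((e/4) / Re z)) \<le> cmod (jost_sum q z b)"
        by (intro order_trans[OF mult_left_mono jost_sum_tail(2)[OF q zc z(2), of b]]) auto
      then show ?thesis by (simp add: E_def exp_minus field_simps)
    qed
    have B: "cmod (jost_sum q z b) * exp (- b) \<le> 2 * ?Z b"
    proof -
      have "Im z * b \<le> 1 * b" using zi b by (intro mult_right_mono) auto
      then have "cmod (jost_sum q z b) * exp (- b) \<le> cmod (jost_sum q z b) * exp (- (Im z * b))" by (intro mult_left_mono) auto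
      then show ?thesis unfolding gz using dpsi_sum_comparison(1)[OF q zc z(2) z1, of b] by linarith
    qed
    have Cc: "?Z b \<le> ?Z (- b) * exp (l1_norm q + 2 * (b + b))"
      using dpsi_i_psi_gronwall(1)[OF q zc z(2) _ z1, of "- b" b] b by simp
    have D: "Re z * ?Z (- b) \<le> 3 * (cmod (jost_sum q z (- b)) * exp b)"
    proof -
      have "Im z * b \<le> 1 * b" using zi b by (intro mult_right_mono) auto
      then have "cmod (jost_sum q z (- b)) * exp (- (Im z * (- b))) \<le> cmod (jost_sum q z (- b)) * exp b" by (intro mult_left_mono) auto
      then show ?thesis unfolding gz using dpsi_sum_comparison(2)[OF q zc z(2) z1, of "- b"] by linarith
    qed
    have F: "cmod (jost_sum q z (- b)) \<le> 2 * cmod z * cmod (jost_a q z) * E"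
    proof -
      have "((\<lambda>x. cmod (jost_sum q z x) * E) \<longlongrightarrow> cmod (2 * \<i> * z * jost_a q z) * E) at_bot"
        by (intro tendsto_intros jost_sum_at_bot q z)
      moreover have "\<forall>\<^sub>F x in at_bot. cmod (jost_sum q z (- b)) \<le> cmod (jost_sum q z x) * E"
      proof (rule eventually_mono[OF eventually_le_at_bot[of "- b"]])
        fix x assume x: "x \<le> - b"
        have "integral {x..- b} (\<lambda>t. \<bar>q t\<bar>) \<le> e / 4"
          using integral_abs_eq_l1_tail_diff[OF q x] l1_tail_le[OF q, of x] b by simp
        then have "integral {x..- b} (\<lambda>t. \<bar>q t\<bar>) / Re z \<le> (e / 4) / Re z" using z(2) by (intro divide_right_mono) auto
        then have "exp (integral {x..- b} (\<lambda>t. \<bar>q t\<bar>) / Re z) \<le> E" unfolding E_def by (simp only: exp_le_cancel_iff)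
        then show "cmod (jost_sum q z (- b)) \<le> cmod (jost_sum q z x) * E"
          by (intro order_trans[OF jost_sum_gronwall(1)[OF q zc z(2) x] mult_left_mono]) auto
      qed
      ultimately have "cmod (jost_sum q z (- b)) \<le> cmod (2 * \<i> * z * jost_a q z) * E"
        by (rule tendsto_lowerbound) simp
      then show ?thesis by (simp add: norm_mult)
    qed
    define a where "a = cmod (jost_a q z)"
    have "Re z * (2 * cmod z) \<le> Re z * (cmod (jost_sum q z b) * E)" using A z(2) by (intro mult_left_mono) auto
    also have "\<dots> = Re z * (cmod (jost_sum q z b) * exp (- b)) * (exp b * E)" by (simp add: exp_minus field_simps)
    also have "\<dots> \<le> Re z * (2 * (?Z (- b) * exp (l1_norm q + 2 * (b + b)))) * (exp b * E)"
      using B Cc z(2) E by (intro mult_right_mono mult_left_mono) auto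
    also have "\<dots> = (Re z * ?Z (- b)) * (2 * exp (l1_norm q + 2 * (b + b)) * exp b * E)" by (simp add: mult_ac)
    also have "\<dots> \<le> (3 * ((2 * cmod z * a * E) * exp b)) * (2 * exp (l1_norm q + 2 * (b + b)) * exp b * E)"
      using D F E unfolding a_def by (intro mult_right_mono order_trans[OF D] mult_left_mono) auto
    also have "\<dots> = (2 * cmod z) * (K * a * (E * E))"
    proof -
      have "exp (2 * b) = exp b * exp b" by (simp flip: exp_add)
      then show ?thesis by (simp add: K_def C_def mult_ac)
    qed
    finally have "(2 * cmod z) * Re z \<le> (2 * cmod z) * (K * a * (E * E))" by (simp add: mult_ac)
    moreover have "2 * cmod z > 0" using z(2) by auto
    ultimately have "Re z \<le> K * a * (E * E)" by (simp only: mult_le_cancel_left_pos)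
    then have "1 \<le> (K / Re z) * a * (E * E)" using z(2) by (simp add: field_simps)
    also have "\<dots> \<le> exp ((e / 2) / Re z) * a * (E * E)"
      using d(2)[OF z(2) rz] E by (intro mult_right_mono) (auto simp: a_def)
    also have "\<dots> = a * exp (e / Re z)"
      unfolding E_def by (simp add: field_simps flip: exp_add)
    finally show ?thesis using z(2) by (simp add: a_def exp_minus field_simps)
  qed
  show ?thesis
  proof (intro exI[of _ "min d 1"] conjI ballI impI)
    show "0 < min d 1" using d by simp
    fix z assume z: "z \<in> uhp" and h: "Re z \<noteq> 0 \<and> cmod z < min d 1"
    show "exp (- (e / \<bar>Re z\<bar>)) \<le> cmod (jost_a q z)"
    proof (cases "Re z > 0")
      case False
      have "- cnj z \<in> uhp" "Re (- cnj z) > 0" "cmod (- cnj z) < min d 1"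
        using z h False by (auto simp: uhp_def)
      then have "exp (- (e / \<bar>Re (- cnj z)\<bar>)) \<le> cmod (jost_a q (- cnj z))" by (rule pos)
      moreover have "z \<in> uhp_closed" using z uhp_subset by blast
      ultimately show ?thesis by (simp add: jost_a_cnj[OF q])
    qed (use pos z h in blast)
  qed
qed

section \<open>Zeros of the inverse transmission coefficient\<close>

lemma integrable_exp_minus_abs:
  assumes "\<eta> > 0"
  shows "integrable lebesgue (\<lambda>x::real. exp (- (\<eta> * \<bar>x\<bar>)))"
proof -
  define f where "f = (\<lambda>x::real. indicat_real {0..} x *\<^sub>R exp (- \<eta> * x))"
  have "(\<lambda>x::real. exp (- \<eta> * x)) absolutely_integrable_on {0..}"
    by (rule nonnegative_absolutely_integrable_1) (use has_integral_exp_minus_to_infinity[OF assms, of 0] in \<open>auto simp: integrable_on_def\<close>)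
  then have f: "integrable lebesgue f" by (simp add: set_integrable_def f_def)
  then have "integrable lebesgue (\<lambda>x. f x + f (0 + - 1 * x))"
    by (intro Bochner_Integration.integrable_add lebesgue_integrable_real_affine) auto
  then show ?thesis
  proof (rule Bochner_Integration.integrable_bound)
    show "(\<lambda>x::real. exp (- (\<eta> * \<bar>x\<bar>))) \<in> borel_measurable lebesgue"
      by (rule borel_measurable_lebesgue_continuous) (intro continuous_intros)
    show "AE x in lebesgue. norm (exp (- (\<eta> * \<bar>x\<bar>))) \<le> norm (f x + f (0 + - 1 * x))"
      by (rule AE_I2) (auto simp: f_def indicator_def abs_if)
  qed
qed

lemma norm_psi_le:
  assumes q: "integrable lebesgue q" and z: "z \<in> uhp_closed" and r: "0 < r" "r \<le> cmod z"
  shows "cmod (psi q z x) \<le> exp (l1_norm q / r) * exp (- (Im z * x))"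
    and "cmod (psiL q z x) \<le> exp (l1_norm q / r) * exp (Im z * x)"
proof -
  have z': "0 \<le> Im z" using z by (auto simp: uhp_closed_def)
  show "cmod (psi q z x) \<le> exp (l1_norm q / r) * exp (- (Im z * x))"
    using norm_jost_mod_le'[OF q z' r, of x] by (simp add: psi_def norm_mult mult.commute)
  show "cmod (psiL q z x) \<le> exp (l1_norm q / r) * exp (Im z * x)"
    using norm_jost_mod_le'[OF integrable_lebesgue_reflect[OF q] z' r, of "- x"]
    by (simp add: psiL_def psi_def norm_mult mult.commute l1_norm_reflect)
qed

lemma psi_not_identically_0:
  assumes q: "integrable lebesgue q" and z: "z \<in> uhp_closed"
  obtains x where "psi q z x \<noteq> 0"
proof (rule ccontr)
  assume "\<not> thesis"
  then have "psi q z x = 0" for x using that by blast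
  then have "jost_mod q z x = 0" for x using exp_psi[of z x q] by simp
  then have "(jost_mod q z \<longlongrightarrow> 0) at_top" by (intro tendsto_eventually always_eventually) simp
  then show False using tendsto_unique[OF trivial_limit_at_top_linorder _ jost_mod_tendsto(1)[OF q z]] by fastforce
qed

lemma psi_initial_nonzero:
  assumes q: "integrable lebesgue q" and z: "z \<in> uhp_closed"
  shows "psi q z x \<noteq> 0 \<or> dpsi q z x \<noteq> 0"
  using psi_not_identically_0[OF q z] sol_ivp_zero(1)[OF q sol_psi[OF q z]] by metis

lemma jost_a_zero_proportional:
  assumes q: "integrable lebesgue q" and z: "z \<in> uhp_closed" and a: "jost_a q z = 0"
  obtains c where "c \<noteq> 0" "\<And>x. psiL q z x = c * psi q z x" "\<And>x. dpsiL q z x = c * dpsi q z x"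
proof -
  have W: "psi q z 0 * dpsiL q z 0 = dpsi q z 0 * psiL q z 0"
    using wronskian_psi_psiL[OF q z, of 0] a by simp
  obtain c where c: "psiL q z 0 = c * psi q z 0" "dpsiL q z 0 = c * dpsi q z 0"
  proof (cases "psi q z 0 = 0")
    case True
    then have "dpsi q z 0 \<noteq> 0" using psi_initial_nonzero[OF q z, of 0] by simp
    then show ?thesis using that[of "dpsiL q z 0 / dpsi q z 0"] W True by simp
  next
    case False
    then show ?thesis using that[of "psiL q z 0 / psi q z 0"] W by (simp add: field_simps)
  qed
  have s: "sol q z (\<lambda>x. psiL q z x - c * psi q z x) (\<lambda>x. dpsiL q z x - c * dpsi q z x)"
    by (rule sol_diff[OF sol_psiL[OF q z] sol_cmult[OF sol_psi[OF q z]]])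
  have 0: "psiL q z x - c * psi q z x = 0" "dpsiL q z x - c * dpsi q z x = 0" for x
    using sol_ivp_zero[OF q s, of 0 x] c by simp_all
  have "c \<noteq> 0"
  proof
    assume "c = 0"
    then have "psi (\<lambda>t. q (- t)) z (- x) = 0" for x using 0(1)[of x] by (simp add: psiL_def)
    then have "psi (\<lambda>t. q (- t)) z x = 0" for x by (metis minus_minus)
    then show False using psi_not_identically_0[OF integrable_lebesgue_reflect[OF q] z] by blast
  qed
  then show thesis using that[of c] 0 by simp
qed

text \<open>When a vanishes, psi is a multiple of psiL: it decays exponentially on the right as psi
  and on the left as psiL.\<close>

lemma jost_a_zero_square_integrable:
  assumes q: "integrable lebesgue q" and z: "z \<in> uhp" and a: "jost_a q z = 0"
  shows "integrable lebesgue (\<lambda>x. (cmod (psi q z x))\<^sup>2)"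
proof -
  have zc: "z \<in> uhp_closed" using z uhp_subset by blast
  have im: "Im z > 0" and z0: "cmod z > 0" using z by (auto simp: uhp_def)
  obtain c where c: "c \<noteq> 0" "\<And>x. psiL q z x = c * psi q z x"
    using jost_a_zero_proportional[OF q zc a] by metis
  define C where "C = exp (l1_norm q / cmod z)"
  define D where "D = max C (C / cmod c)"
  have b: "cmod (psi q z x) \<le> D * exp (- (Im z * \<bar>x\<bar>))" for x
  proof (cases "x \<ge> 0")
    case True
    have "cmod (psi q z x) \<le> C * exp (- (Im z * x))"
      using norm_psi_le(1)[OF q zc z0 order_refl] by (simp add: C_def)
    also have "\<dots> \<le> D * exp (- (Im z * x))" by (intro mult_right_mono) (auto simp: D_def)
    finally show ?thesis using True by simp
  next
    case False
    have "cmod c * cmod (psi q z x) \<le> C * exp (Im z * x)"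
      using norm_psi_le(2)[OF q zc z0 order_refl, of x] by (simp add: C_def c norm_mult)
    then have "cmod (psi q z x) \<le> C / cmod c * exp (Im z * x)" using c by (simp add: field_simps)
    also have "\<dots> \<le> D * exp (Im z * x)" by (intro mult_right_mono) (auto simp: D_def)
    finally show ?thesis using False by simp
  qed
  show ?thesis
  proof (rule Bochner_Integration.integrable_bound)
    show "integrable lebesgue (\<lambda>x. D\<^sup>2 * exp (- (2 * Im z * \<bar>x\<bar>)))"
      using integrable_exp_minus_abs[of "2 * Im z"] im by simp
    show "(\<lambda>x. (cmod (psi q z x))\<^sup>2) \<in> borel_measurable lebesgue"
      by (rule borel_measurable_lebesgue_continuous) (intro continuous_intros sol_continuous(1)[OF sol_psi[OF q zc]])
    show "AE x in lebesgue. norm ((cmod (psi q z x))\<^sup>2) \<le> norm (D\<^sup>2 * exp (- (2 * Im z * \<bar>x\<bar>)))"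
    proof (rule AE_I2)
      fix x
      have "(cmod (psi q z x))\<^sup>2 \<le> (D * exp (- (Im z * \<bar>x\<bar>)))\<^sup>2" using b by (rule power_mono) simp
      also have "\<dots> = D\<^sup>2 * exp (- (2 * Im z * \<bar>x\<bar>))" by (simp add: power_mult_distrib mult.assoc flip: exp_double)
      finally show "norm ((cmod (psi q z x))\<^sup>2) \<le> norm (D\<^sup>2 * exp (- (2 * Im z * \<bar>x\<bar>)))" by simp
    qed
  qed
qed

text \<open>At a zero psi and psiL have the same logarithmic derivative. For Re w > 0 positivity for
  q and for its reflection gives the imaginary parts opposite signs, a contradiction; Re w < 0 is
  reduced to this by conjugation.\<close>

lemma jost_a_zero_imaginary:
  assumes q: "integrable lebesgue q" and z: "z \<in> uhp" and a: "jost_a q z = 0"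
  shows "Re z = 0"
proof -
  have "\<not> Re w > 0" if w: "w \<in> uhp" "jost_a q w = 0" for w
  proof
    assume re: "Re w > 0"
    have wc: "w \<in> uhp_closed" using w uhp_subset by blast
    obtain c where c: "c \<noteq> 0" "\<And>x. psiL q w x = c * psi q w x" "\<And>x. dpsiL q w x = c * dpsi q w x"
      using jost_a_zero_proportional[OF q wc w(2)] by metis
    have "Im (dpsi (\<lambda>t. q (- t)) w 0 * cnj (psi (\<lambda>t. q (- t)) w 0)) > 0"
      by (rule weyl_positivity[OF integrable_lebesgue_reflect[OF q] wc re])
    then have "Im (dpsiL q w 0 * cnj (psiL q w 0)) < 0" by (simp add: psiL_def dpsiL_def)
    moreover have "dpsiL q w 0 * cnj (psiL q w 0) = of_real ((cmod c)\<^sup>2) * (dpsi q w 0 * cnj (psi q w 0))"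
      unfolding complex_norm_square c by (simp add: mult_ac)
    ultimately have "(cmod c)\<^sup>2 * Im (dpsi q w 0 * cnj (psi q w 0)) < 0"
      by (simp only: times_complex.sel Re_complex_of_real Im_complex_of_real)
    then show False using weyl_positivity[OF q wc re, of 0] by (simp add: mult_less_0_iff)
  qed
  from this[of z] this[of "- cnj z"] show ?thesis
    using z a jost_a_cnj[OF q, of z] uhp_subset by (auto simp: uhp_def)
qed

text \<open>psi is the eigenfunction, and z^2 = - (Im z)^2 because z is imaginary. That psi is not
  almost everywhere 0 follows by continuity from one nonzero value.\<close>

lemma jost_a_zero_eigenvalue:
  assumes q: "integrable lebesgue q" and z: "z \<in> uhp" and a: "jost_a q z = 0"
  shows "- (Im z)\<^sup>2 \<in> neg_eigenvalues q"
proof -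
  have zc: "z \<in> uhp_closed" using z uhp_subset by blast
  have z2: "z\<^sup>2 = of_real (- (Im z)\<^sup>2)"
    using jost_a_zero_imaginary[OF q z a] by (simp add: complex_eq_iff power2_eq_square)
  note I = jost_a_zero_square_integrable[OF q z a]
  have c: "continuous_on UNIV (psi q z)" by (rule sol_continuous(1)[OF sol_psi[OF q zc]])
  have m: "(\<lambda>x. w * psi q z x) \<in> borel_measurable lebesgue" for w
    by (rule borel_measurable_lebesgue_continuous) (intro continuous_intros c)
  have L2: "(\<lambda>x. w * psi q z x) \<in> L2" for w
    using I m[of w] by (simp add: L2_def norm_mult power_mult_distrib)
  have "schroedinger_solution q z (psi q z)"
    using sol_psi[OF q zc] schroedinger_solution_iff_sol by blast
  then have "schroedinger_expr q (psi q z) (\<lambda>x. of_real (- (Im z)\<^sup>2) * psi q z x)"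
    unfolding schroedinger_solution_def z2 .
  then have "schroedinger_op q (psi q z) (\<lambda>x. of_real (- (Im z)\<^sup>2) * psi q z x)"
    using L2[of 1] L2[of "of_real (- (Im z)\<^sup>2)"] by (simp only: schroedinger_op_def mult_1)
  moreover have "\<not> (AE x in lebesgue. psi q z x = 0)"
  proof
    assume ae: "AE x in lebesgue. psi q z x = 0"
    obtain x where x: "psi q z x \<noteq> 0" using psi_not_identically_0[OF q zc] by blast
    let ?h = "\<lambda>t. (cmod (psi q z t))\<^sup>2"
    obtain N where N: "N \<in> null_sets lebesgue" "{x. psi q z x \<noteq> 0} \<subseteq> N"
      using ae unfolding eventually_ae_filter by auto
    have "integral {x..x+1} ?h = integral {x..x+1} (\<lambda>_. 0)"
      by (rule integral_spike[of N]) (use N in \<open>auto simp: negligible_iff_null_sets\<close>)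
    then have "integral {x..x+1} ?h = 0" by simp
    moreover have "continuous_on {x..x+1} ?h" by (intro continuous_intros continuous_on_subset[OF c]) auto
    ultimately have "\<forall>t\<in>{x..x+1}. ?h t = 0" using integral_eq_0_iff[of x "x+1" ?h] by auto
    then have "?h x = 0" by (rule bspec) simp
    then show False using x by simp
  qed
  ultimately show ?thesis using z by (auto simp: neg_eigenvalues_def uhp_def)
qed

text \<open>The value 1 / m^2 > 0 rules out the default value of a divergent integral, so psi is
  square integrable. If a were nonzero, \<open>jost_mod\<close> would tend to a at -infinity and
  |psi| would be at least |a| / 2 on a left half line.\<close>

lemma norming_constant_imp_zero:
  assumes q: "integrable lebesgue q" and k: "\<kappa> > 0" and m: "is_norming_constant q \<kappa> m"
  shows "jost_a q (\<i> * of_real \<kappa>) = 0"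
    and "m > 0" and "1 / m\<^sup>2 = (LINT x|lebesgue. (cmod (psi q (\<i> * of_real \<kappa>) x))\<^sup>2)"
proof -
  define z where "z = \<i> * complex_of_real \<kappa>"
  have z: "z \<in> uhp" "z \<in> uhp_closed" using k by (auto simp: z_def uhp_def uhp_closed_def)
  have "jost_right q z = psi q z" by (rule jost_right_eq_psi[OF q z(2)])
  then show m0: "m > 0" and eq: "1 / m\<^sup>2 = (LINT x|lebesgue. (cmod (psi q (\<i> * of_real \<kappa>) x))\<^sup>2)"
    using m by (simp_all add: is_norming_constant_def z_def)
  have I: "integrable lebesgue (\<lambda>x. (cmod (psi q z x))\<^sup>2)"
    by (rule ccontr) (use eq m0 in \<open>simp add: z_def not_integrable_integral_eq\<close>)
  have "jost_a q z = 0"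
  proof (rule ccontr)
    assume a: "jost_a q z \<noteq> 0"
    define c where "c = (cmod (jost_a q z) / 2)\<^sup>2"
    have c: "c > 0" using a by (simp add: c_def)
    have "((\<lambda>x. cmod (jost_mod q z x)) \<longlongrightarrow> cmod (jost_a q z)) at_bot"
      by (intro tendsto_norm jost_mod_at_bot[OF q z(1)])
    then have "\<forall>\<^sub>F x in at_bot. cmod (jost_a q z) / 2 < cmod (jost_mod q z x)"
      by (rule order_tendstoD(1)) (use a in simp)
    then obtain X where X: "\<And>x. x \<le> X \<Longrightarrow> cmod (jost_a q z) / 2 < cmod (jost_mod q z x)"
      by (auto simp: eventually_at_bot_linorder)
    define Y where "Y = min X 0"
    have low: "c \<le> (cmod (psi q z x))\<^sup>2" if "x \<le> Y" for x
    proof -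
      have "cmod (jost_mod q z x) * 1 \<le> cmod (jost_mod q z x) * exp (- (\<kappa> * x))"
        using that k by (intro mult_left_mono) (auto simp: Y_def mult_nonneg_nonpos)
      then have "cmod (jost_a q z) / 2 \<le> cmod (psi q z x)"
        using X[of x] that by (simp add: psi_def norm_mult z_def Y_def mult.commute)
      then show ?thesis unfolding c_def by (intro power_mono) auto
    qed
    have "real n * c \<le> 1 / m\<^sup>2" for n
    proof -
      have "(LINT x|lebesgue. c * indicat_real {Y - real n..Y} x) \<le> (LINT x|lebesgue. (cmod (psi q z x))\<^sup>2)"
      proof (rule Bochner_Integration.integral_mono[OF _ I])
        show "integrable lebesgue (\<lambda>x. c * indicat_real {Y - real n..Y} x)"
          by (intro integrable_mult_right integrable_real_indicator) (auto simp: emeasure_lborel_Icc_eq)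
        fix x show "c * indicat_real {Y - real n..Y} x \<le> (cmod (psi q z x))\<^sup>2"
          using low[of x] by (auto simp: indicator_def)
      qed
      then show ?thesis using eq by (simp add: z_def mult.commute)
    qed
    moreover obtain n :: nat where "1 / m\<^sup>2 / c < real n" using reals_Archimedean2 by blast
    ultimately show False using c by (metis not_le pos_divide_less_eq)
  qed
  then show "jost_a q (\<i> * of_real \<kappa>) = 0" by (simp add: z_def)
qed

text \<open>Green's identity on the half line, the contribution of +infinity being 0. Divided by z -
  w and combined with continuity of the integral, it replaces differentiation of the Wronskian with
  respect to z.\<close>

lemma wronskian_half_line:
  assumes q: "integrable lebesgue q" and z: "z \<in> uhp" and w: "w \<in> uhp"
  shows "psi q z 0 * dpsi q w 0 - dpsi q z 0 * psi q w 0 = - (z\<^sup>2 - w\<^sup>2) * (LINT t:{0..}|lebesgue. psi q z t * psi q w t)"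
proof -
  have c: "z \<in> uhp_closed" "w \<in> uhp_closed" using z w uhp_subset by auto
  define F where "F = (\<lambda>x. psi q z x * dpsi q w x - dpsi q z x * psi q w x)"
  have pc: "continuous_on UNIV (\<lambda>t. psi q z t * psi q w t)"
    by (intro continuous_intros sol_continuous(1)[OF sol_psi[OF q c(1)]] sol_continuous(1)[OF sol_psi[OF q c(2)]])
  have i: "set_integrable lebesgue {0..} (\<lambda>t. psi q z t * psi q w t)"
    unfolding set_integrable_def
  proof (rule Bochner_Integration.integrable_bound)
    define C where "C = exp (l1_norm q / cmod z) * exp (l1_norm q / cmod w)"
    show "integrable lebesgue (\<lambda>t. C * exp (- ((Im z + Im w) * \<bar>t\<bar>)))"
      using integrable_exp_minus_abs[of "Im z + Im w"] z w by (simp add: uhp_def)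
    show "(\<lambda>t. indicat_real {0..} t *\<^sub>R (psi q z t * psi q w t)) \<in> borel_measurable lebesgue"
      using borel_measurable_lebesgue_continuous[OF pc] by (intro borel_measurable_scaleR borel_measurable_indicator) auto
    show "AE t in lebesgue. norm (indicat_real {0..} t *\<^sub>R (psi q z t * psi q w t)) \<le> norm (C * exp (- ((Im z + Im w) * \<bar>t\<bar>)))"
    proof (rule AE_I2)
      fix t :: real
      have "cmod (psi q z t) * cmod (psi q w t) \<le> (exp (l1_norm q / cmod z) * exp (- (Im z * t))) * (exp (l1_norm q / cmod w) * exp (- (Im w * t)))"
        using c by (intro mult_mono norm_psi_le(1)[OF q]) (auto simp: uhp_closed_def)
      also have "\<dots> = C * exp (- ((Im z + Im w) * t))"
        by (simp add: C_def algebra_simps flip: exp_add)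
      finally show "norm (indicat_real {0..} t *\<^sub>R (psi q z t * psi q w t)) \<le> norm (C * exp (- ((Im z + Im w) * \<bar>t\<bar>)))"
        by (auto simp: indicator_def norm_mult C_def)
    qed
  qed
  have lim: "((\<lambda>b. LINT t:{0..b}|lebesgue. psi q z t * psi q w t) \<longlongrightarrow> (LINT t:{0..}|lebesgue. psi q z t * psi q w t)) at_top"
    by (rule tendsto_set_lebesgue_integral_at_top[OF _ i]) auto
  have "\<forall>\<^sub>F b in at_top. (z\<^sup>2 - w\<^sup>2) * (LINT t:{0..b}|lebesgue. psi q z t * psi q w t) = F b - F 0"
    using eventually_ge_at_top[of 0]
  proof eventually_elim
    case (elim b)
    have "((\<lambda>t. (z\<^sup>2 - w\<^sup>2) * (psi q z t * psi q w t)) has_integral F b - F 0) {0..b}"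
      using wronskian_lac[OF sol_psi[OF q c(1)] sol_psi[OF q c(2)]] elim unfolding loc_abs_cont_deriv_def F_def by blast
    then have "integral {0..b} (\<lambda>t. (z\<^sup>2 - w\<^sup>2) * (psi q z t * psi q w t)) = F b - F 0" by (rule integral_unique)
    moreover have "set_integrable lebesgue {0..b} (\<lambda>t. psi q z t * psi q w t)"
      by (rule set_integrable_subset[OF i]) auto
    ultimately show ?case by (simp add: set_lebesgue_integral_eq_integral(2))
  qed
  then have "((\<lambda>b. F b - F 0) \<longlongrightarrow> (z\<^sup>2 - w\<^sup>2) * (LINT t:{0..}|lebesgue. psi q z t * psi q w t)) at_top"
    by (rule Lim_transform_eventually[OF tendsto_mult_left[OF lim]])
  moreover have "((\<lambda>b. F b - F 0) \<longlongrightarrow> (0 * 0 - 0 * 0) - F 0) at_top"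
    unfolding F_def by (intro tendsto_intros psi_decay q z w)
  ultimately have "(z\<^sup>2 - w\<^sup>2) * (LINT t:{0..}|lebesgue. psi q z t * psi q w t) = (0 * 0 - 0 * 0) - F 0"
    using tendsto_unique[OF trivial_limit_at_top_linorder] by blast
  then have "F 0 = - ((z\<^sup>2 - w\<^sup>2) * (LINT t:{0..}|lebesgue. psi q z t * psi q w t))" by simp
  then show ?thesis by (simp only: F_def mult_minus_left)
qed

lemma half_line_integral_continuous:
  assumes q: "integrable lebesgue q" and w: "w \<in> uhp"
  shows "((\<lambda>z. LINT t:{0..}|lebesgue. psi q z t * psi q w t) \<longlongrightarrow> (LINT t:{0..}|lebesgue. psi q w t * psi q w t)) (at w)"
proof -
  define r where "r = Im w / 2"
  define S where "S = {z. r < Im z}"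
  have r: "r > 0" using w by (simp add: r_def uhp_def)
  have wS: "w \<in> S" using r by (simp add: S_def r_def)
  have S: "open S" unfolding S_def by (intro open_Collect_less continuous_intros)
  have SU: "S \<subseteq> uhp" "S \<subseteq> uhp_closed" using r uhp_subset by (auto simp: S_def uhp_def)
  have rS: "r \<le> cmod z" if "z \<in> S" for z using that abs_Im_le_cmod[of z] by (auto simp: S_def)
  define C where "C = exp (l1_norm q / r) * exp (l1_norm q / r)"
  have "continuous_on S (\<lambda>z. LINT t|lebesgue. indicat_real {0..} t *\<^sub>R (psi q z t * psi q w t))"
  proof (rule continuous_on_integral_dominated)
    show "integrable lebesgue (\<lambda>t. C * exp (- (r * \<bar>t\<bar>)))" using integrable_exp_minus_abs[OF r] by simp
    show "continuous_on S (\<lambda>z. indicat_real {0..} t *\<^sub>R (psi q z t * psi q w t))" for t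
      by (intro continuous_intros continuous_on_subset[OF psi_regular(1)[OF q] SU(2)])
    fix z assume z: "z \<in> S"
    have zc: "z \<in> uhp_closed" "w \<in> uhp_closed" using z wS SU by auto
    have "continuous_on UNIV (\<lambda>t. psi q z t * psi q w t)"
      by (intro continuous_intros sol_continuous(1)[OF sol_psi[OF q zc(1)]] sol_continuous(1)[OF sol_psi[OF q zc(2)]])
    then show "(\<lambda>t. indicat_real {0..} t *\<^sub>R (psi q z t * psi q w t)) \<in> borel_measurable lebesgue"
      using borel_measurable_lebesgue_continuous by (intro borel_measurable_scaleR borel_measurable_indicator) auto
    fix t :: real
    show "cmod (indicat_real {0..} t *\<^sub>R (psi q z t * psi q w t)) \<le> C * exp (- (r * \<bar>t\<bar>))"
    proof (cases "t \<ge> 0")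
      case True
      have "cmod (psi q z t) * cmod (psi q w t) \<le> (exp (l1_norm q / r) * exp (- (Im z * t))) * (exp (l1_norm q / r) * exp (- (Im w * t)))"
        using z wS rS r zc by (intro mult_mono norm_psi_le(1)[OF q]) auto
      also have "\<dots> \<le> (exp (l1_norm q / r) * exp (- (r * t))) * (exp (l1_norm q / r) * 1)"
        using z wS True r by (intro mult_mono) (auto simp: S_def mult_right_mono)
      finally show ?thesis using True by (simp add: norm_mult C_def mult_ac)
    next
      case False
      then show ?thesis by (simp add: C_def)
    qed
  qed
  then show ?thesis
    using wS S by (simp add: set_lebesgue_integral_def continuous_on_eq_continuous_at isCont_def)
qed

text \<open>The zero of \<open>a\<close> at \<open>\<mu> = i \<kappa>\<close> is simple, with \<open>a'(\<mu>) = - i c / m\<^sup>2\<close> where \<open>psiL = c psi\<close>; the factor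
  \<open>c\<close> drops out of the residue of \<open>psiL / a\<close>.\<close>

lemma jost_residue:
  assumes q: "integrable lebesgue q" and k: "\<kappa> > 0" and m: "is_norming_constant q \<kappa> m"
  defines "\<mu> \<equiv> \<i> * complex_of_real \<kappa>"
  shows "\<forall>\<^sub>F z in at \<mu>. jost_a q z \<noteq> 0"
    and "((\<lambda>z. (z - \<mu>) * (psiL q z x / jost_a q z)) \<longlongrightarrow> \<i> * of_real (m\<^sup>2) * psi q \<mu> x) (at \<mu>)"
proof -
  let ?q = "\<lambda>t. q (- t)"
  note q' = integrable_lebesgue_reflect[OF q]
  have mu: "\<mu> \<in> uhp" "\<mu> \<in> uhp_closed" and mu0: "\<mu> \<noteq> 0" using k by (auto simp: \<mu>_def uhp_def uhp_closed_def)
  note nc = norming_constant_imp_zero[OF q k m, folded \<mu>_def]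
  obtain c where c: "c \<noteq> 0" "\<And>x. psiL q \<mu> x = c * psi q \<mu> x" "\<And>x. dpsiL q \<mu> x = c * dpsi q \<mu> x"
    using jost_a_zero_proportional[OF q mu(2) nc(1)] by metis
  define J where "J = (\<lambda>z. LINT t:{0..}|lebesgue. psi q z t * psi q \<mu> t)"
  define K where "K = (\<lambda>z. LINT t:{0..}|lebesgue. psi ?q z t * psi ?q \<mu> t)"
  define I where "I = (LINT t|lebesgue. psi q \<mu> t * psi q \<mu> t)"
  \<comment> \<open>\<mu> is fixed by the reflection z to - cnj z, so psi is real there and its
    square is the density in the norming constant.\<close>
  have real: "cnj (psi q \<mu> t) = psi q \<mu> t" for t using psi_cnj(1)[OF q mu(2), of t] by (simp add: \<mu>_def)
  have sq: "psi q \<mu> t * psi q \<mu> t = of_real ((cmod (psi q \<mu> t))\<^sup>2)" for t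
    unfolding complex_norm_square real ..
  have I: "I = of_real (1 / m\<^sup>2)" unfolding I_def sq nc(3) by (rule integral_complex_of_real)
  have int: "integrable lebesgue (\<lambda>t. psi q \<mu> t * psi q \<mu> t)"
    unfolding sq by (intro integrable_of_real jost_a_zero_square_integrable[OF q mu(1) nc(1)])
  \<comment> \<open>\<open>J\<close> integrates psi^2 over the right half line. \<open>K\<close>
    integrates psiL^2 = c^2 psi^2 over the left one, so the weights c and 1 / c make the two halves
    add up to c times the integral over the line.\<close>
  have JK: "c * J \<mu> + K \<mu> / c = c * I"
  proof -
    have "K \<mu> = (LINT t|lebesgue. indicat_real {..0} (0 + - 1 * t) *\<^sub>R (psiL q \<mu> (0 + - 1 * t) * psiL q \<mu> (0 + - 1 * t)))"
      unfolding K_def set_lebesgue_integral_def psiL_def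
      by (rule Bochner_Integration.integral_cong) (auto simp: indicator_def)
    also have "\<dots> = (LINT t|lebesgue. indicat_real {..0} t *\<^sub>R (psiL q \<mu> t * psiL q \<mu> t))"
      using lebesgue_integral_real_affine[of "- 1" "\<lambda>t. indicat_real {..0} t *\<^sub>R (psiL q \<mu> t * psiL q \<mu> t)" 0] by simp
    also have "\<dots> = (LINT t:{..0}|lebesgue. c\<^sup>2 * (psi q \<mu> t * psi q \<mu> t))"
      unfolding set_lebesgue_integral_def c by (simp add: power2_eq_square mult_ac)
    also have "\<dots> = c\<^sup>2 * (LINT t:{..0}|lebesgue. psi q \<mu> t * psi q \<mu> t)" by simp
    finally have "K \<mu> / c = c * (LINT t:{..0}|lebesgue. psi q \<mu> t * psi q \<mu> t)"
      using c(1) by (simp add: power2_eq_square)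
    then show ?thesis
      unfolding I_def J_def lebesgue_integral_split_0[OF int] by (simp add: distrib_left)
  qed
  have Jl: "(J \<longlongrightarrow> J \<mu>) (at \<mu>)" and Kl: "(K \<longlongrightarrow> K \<mu>) (at \<mu>)"
    unfolding J_def K_def by (rule half_line_integral_continuous[OF q mu(1)], rule half_line_integral_continuous[OF q' mu(1)])
  define P where "P = (\<lambda>z. psi q z 0 - psi q \<mu> 0)" define dP where "dP = (\<lambda>z. dpsi q z 0 - dpsi q \<mu> 0)"
  define L where "L = (\<lambda>z. psiL q z 0 - psiL q \<mu> 0)" define dL where "dL = (\<lambda>z. dpsiL q z 0 - dpsiL q \<mu> 0)"
  \<comment> \<open>Bilinear expansion of the Wronskian about \<mu>: a second-order part in the
    increments P, dP, L and dL, and two parts with one argument frozen at \<mu>, which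
    \<open>wronskian_half_line\<close> evaluates for q and for its reflection.\<close>
  have split: "- 2 * \<i> * z * jost_a q z = (P z * dL z - dP z * L z) - (z\<^sup>2 - \<mu>\<^sup>2) * (c * J z + K z / c)" if z: "z \<in> uhp" for z
  proof -
    have zc: "z \<in> uhp_closed" using z uhp_subset by blast
    have "- 2 * \<i> * z * jost_a q z = psi q z 0 * dpsiL q z 0 - dpsi q z 0 * psiL q z 0"
      using wronskian_psi_psiL[OF q zc, of 0] by simp
    also have "\<dots> = (P z * dL z - dP z * L z) + (psi q z 0 * dpsiL q \<mu> 0 - dpsi q z 0 * psiL q \<mu> 0)
       + (psi q \<mu> 0 * dpsiL q z 0 - dpsi q \<mu> 0 * psiL q z 0) - (psi q \<mu> 0 * dpsiL q \<mu> 0 - dpsi q \<mu> 0 * psiL q \<mu> 0)"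
      unfolding P_def dP_def L_def dL_def by (simp add: algebra_simps)
    also have "psi q \<mu> 0 * dpsiL q \<mu> 0 - dpsi q \<mu> 0 * psiL q \<mu> 0 = 0" by (simp add: c)
    also have "psi q z 0 * dpsiL q \<mu> 0 - dpsi q z 0 * psiL q \<mu> 0 = - (z\<^sup>2 - \<mu>\<^sup>2) * (c * J z)"
    proof -
      have "psi q z 0 * dpsiL q \<mu> 0 - dpsi q z 0 * psiL q \<mu> 0 = c * (psi q z 0 * dpsi q \<mu> 0 - dpsi q z 0 * psi q \<mu> 0)"
        unfolding c by (simp add: algebra_simps)
      then show ?thesis unfolding wronskian_half_line[OF q z mu(1)] J_def by simp
    qed
    also have "psi q \<mu> 0 * dpsiL q z 0 - dpsi q \<mu> 0 * psiL q z 0 = - (z\<^sup>2 - \<mu>\<^sup>2) * (K z / c)"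
    proof -
      have "c * (psi q \<mu> 0 * dpsiL q z 0 - dpsi q \<mu> 0 * psiL q z 0) = psiL q \<mu> 0 * dpsiL q z 0 - dpsiL q \<mu> 0 * psiL q z 0"
        unfolding c by (simp add: algebra_simps)
      also have "\<dots> = psi ?q z 0 * dpsi ?q \<mu> 0 - dpsi ?q z 0 * psi ?q \<mu> 0"
        by (simp add: psiL_def dpsiL_def mult.commute)
      also have "\<dots> = - (z\<^sup>2 - \<mu>\<^sup>2) * K z" unfolding wronskian_half_line[OF q' z mu(1)] K_def ..
      finally show ?thesis using c(1) by (simp add: field_simps)
    qed
    finally show ?thesis by (simp add: algebra_simps)
  qed
  have diffq: "\<exists>D. ((\<lambda>z. (f z - f \<mu>) / (z - \<mu>)) \<longlongrightarrow> D) (at \<mu>)" if "f holomorphic_on uhp" for f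
    using that mu(1) unfolding holomorphic_on_open[OF open_uhp] has_field_derivative_iff by blast
  obtain D1 where D1: "((\<lambda>z. P z / (z - \<mu>)) \<longlongrightarrow> D1) (at \<mu>)"
    using diffq[OF psi_regular(2)[OF q, of 0]] unfolding P_def by blast
  obtain D2 where D2: "((\<lambda>z. dP z / (z - \<mu>)) \<longlongrightarrow> D2) (at \<mu>)"
    using diffq[OF psi_regular(4)[OF q, of 0]] unfolding dP_def by blast
  have isC: "(f \<longlongrightarrow> f \<mu>) (at \<mu>)" if "f holomorphic_on uhp" for f
    using holomorphic_on_imp_continuous_on[OF that] mu(1) open_uhp by (simp add: continuous_on_eq_continuous_at isCont_def)
  have dL: "(dL \<longlongrightarrow> 0) (at \<mu>)" and L: "(L \<longlongrightarrow> 0) (at \<mu>)"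
    using tendsto_diff[OF isC[OF psiL_regular(4)[OF q, of 0]] tendsto_const[of "dpsiL q \<mu> 0"]]
      tendsto_diff[OF isC[OF psiL_regular(2)[OF q, of 0]] tendsto_const[of "psiL q \<mu> 0"]]
    unfolding dL_def L_def by simp_all
  \<comment> \<open>The difference quotient of a at its zero \<mu>. The second-order part of the
    expansion drops out of the limit because the increments of psiL and dpsiL tend to 0.\<close>
  define A where "A = (\<lambda>z. jost_a q z / (z - \<mu>))"
  have Alim: "(A \<longlongrightarrow> - \<i> * c * I) (at \<mu>)"
  proof -
    have "((\<lambda>z. (P z / (z - \<mu>) * dL z - dP z / (z - \<mu>) * L z - (z + \<mu>) * (c * J z + K z / c)) / (- 2 * \<i> * z)) \<longlongrightarrow>
        (D1 * 0 - D2 * 0 - (\<mu> + \<mu>) * (c * J \<mu> + K \<mu> / c)) / (- 2 * \<i> * \<mu>)) (at \<mu>)"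
      by (intro tendsto_intros D1 D2 dL L Jl Kl) (use mu0 c in auto)
    also have "(D1 * 0 - D2 * 0 - (\<mu> + \<mu>) * (c * J \<mu> + K \<mu> / c)) / (- 2 * \<i> * \<mu>) = - \<i> * c * I"
      unfolding JK using mu0 by (simp add: field_simps)
    finally have "((\<lambda>z. (P z / (z - \<mu>) * dL z - dP z / (z - \<mu>) * L z - (z + \<mu>) * (c * J z + K z / c)) / (- 2 * \<i> * z)) \<longlongrightarrow> - \<i> * c * I) (at \<mu>)" .
    moreover have "\<forall>\<^sub>F z in at \<mu>. (P z / (z - \<mu>) * dL z - dP z / (z - \<mu>) * L z - (z + \<mu>) * (c * J z + K z / c)) / (- 2 * \<i> * z) = A z"
      unfolding eventually_at_topological
    proof (intro exI[of _ uhp] conjI ballI impI open_uhp mu(1))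
      fix z assume z: "z \<in> uhp" "z \<noteq> \<mu>"
      then have z0: "z \<noteq> 0" "z - \<mu> \<noteq> 0" by (auto simp: uhp_def)
      have "P z / (z - \<mu>) * dL z - dP z / (z - \<mu>) * L z - (z + \<mu>) * (c * J z + K z / c) =
          ((P z * dL z - dP z * L z) - (z\<^sup>2 - \<mu>\<^sup>2) * (c * J z + K z / c)) / (z - \<mu>)"
      proof -
        have sq: "z\<^sup>2 - \<mu>\<^sup>2 = (z - \<mu>) * (z + \<mu>)" by (simp add: algebra_simps power2_eq_square)
        show ?thesis unfolding sq using z0(2) by (simp add: diff_divide_distrib)
      qed
      also have "\<dots> = (- 2 * \<i> * z * jost_a q z) / (z - \<mu>)" unfolding split[OF z(1)] ..
      finally show "(P z / (z - \<mu>) * dL z - dP z / (z - \<mu>) * L z - (z + \<mu>) * (c * J z + K z / c)) / (- 2 * \<i> * z) = A z"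
        using z0 by (simp add: A_def)
    qed
    ultimately show ?thesis by (rule Lim_transform_eventually)
  qed
  have ne: "- \<i> * c * I \<noteq> 0" using c(1) I nc(2) by simp
  have "\<forall>\<^sub>F z in at \<mu>. A z \<noteq> 0" using tendsto_imp_eventually_ne[OF Alim ne] .
  then show "\<forall>\<^sub>F z in at \<mu>. jost_a q z \<noteq> 0" by eventually_elim (auto simp: A_def)
  have "((\<lambda>z. psiL q z x / A z) \<longlongrightarrow> psiL q \<mu> x / (- \<i> * c * I)) (at \<mu>)"
    by (intro tendsto_divide isC[OF psiL_regular(2)[OF q]] Alim ne)
  moreover have "psiL q z x / A z = (z - \<mu>) * (psiL q z x / jost_a q z)" for z by (simp add: A_def)
  moreover have "psiL q \<mu> x / (- \<i> * c * I) = \<i> * of_real (m\<^sup>2) * psi q \<mu> x"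
    unfolding c I using c(1) nc(2) by (simp add: field_simps)
  ultimately show "((\<lambda>z. (z - \<mu>) * (psiL q z x / jost_a q z)) \<longlongrightarrow> \<i> * of_real (m\<^sup>2) * psi q \<mu> x) (at \<mu>)"
    by simp
qed

section \<open>A Phragmen--Lindelof principle\<close>

text \<open>Phragmen--Lindelof on the triangle with vertices \<open>-R, R, iR\<close>. The exponent below is a harmonic
  majorant: nonnegative on the base, at least \<open>R\<^sup>2 / \<bar>Re u\<bar>\<close> on the two sides (so that it absorbs the
  singular growth bound near the tip), and \<open>O(\<bar>u\<bar>)\<close> at a fixed \<open>u\<close>, uniformly in \<open>R\<close>.\<close>

lemma minimal_type_upper_bound:
  assumes holo: "g holomorphic_on UNIV" and B: "1 \<le> B" "\<And>x::real. cmod (g (of_real x)) \<le> B"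
    and growth: "\<And>e. e > 0 \<Longrightarrow> \<exists>R. \<forall>u. cmod u \<ge> R \<and> Re u \<noteq> 0 \<longrightarrow> cmod (g u) \<le> exp (e * (cmod u)\<^sup>2 / \<bar>Re u\<bar>)"
    and z: "Im z > 0"
  shows "cmod (g z) \<le> B"
proof -
  have est: "cmod (g z) \<le> B * exp (11 * e * cmod z)" if e: "e > 0" for e
  proof -
    obtain R0 where R0: "\<And>u. cmod u \<ge> R0 \<Longrightarrow> Re u \<noteq> 0 \<Longrightarrow> cmod (g u) \<le> exp (e * (cmod u)\<^sup>2 / \<bar>Re u\<bar>)"
      using growth[OF e] by blast
    \<comment> \<open>The slanted sides satisfy |u| \<ge> R / 2, so R \<ge> 2 R0 puts them within
      reach of the growth bound; R > 2 |z| puts z inside the triangle.\<close>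
    define R where "R = 2 * \<bar>R0\<bar> + 2 * cmod z + 1"
    have R: "R > 0" "R > 2 * cmod z" "R \<ge> 2 * R0"
    proof -
      have "0 \<le> cmod z" "0 \<le> \<bar>R0\<bar>" "R0 \<le> \<bar>R0\<bar>" by auto
      note h = this
      show "R > 0" using h unfolding R_def by linarith
      show "R > 2 * cmod z" using h unfolding R_def by linarith
      show "R \<ge> 2 * R0" using h unfolding R_def by linarith
    qed
    define U where "U = {u. Im u > 0 \<and> \<bar>Re u\<bar> + Im u < R}"
    define T where "T = {u. Im u \<ge> 0 \<and> \<bar>Re u\<bar> + Im u \<le> R}"
    define p where "p = Complex 0 R"
    \<comment> \<open>The pole at the tip i R contributes the real part 2 R^2 (R - Im u) / |u -
      p|^2, which equals R^2 / |Re u| on the sides, where R - Im u = |Re u|. The mirror term 1 / (R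
      - i u) cancels it on the base and costs at most 2 R in the triangle. On the sides the last two
      terms add up to exactly 2 R and pay for this.\<close>
    define w where "w = (\<lambda>u. 2 * of_real R ^ 2 * (1 / (of_real R + \<i> * u) - 1 / (of_real R - \<i> * u)) - 4 * (\<i> * u) + 2 * u\<^sup>2 / of_real R)"
    define F where "F = (\<lambda>u. if u = p then 0 else g u * exp (- of_real e * w u))"
    have Re_mult_real: "Re (complex_of_real a * v) = a * Re v" for a v by simp
    have "open U" unfolding U_def by (intro open_Collect_conj open_Collect_less continuous_intros)
    have "closed T" unfolding T_def by (intro closed_Collect_conj closed_Collect_le continuous_intros)
    have UT: "U \<subseteq> T" by (auto simp: U_def T_def)
    have clU: "closure U \<subseteq> T" by (rule closure_minimal[OF UT \<open>closed T\<close>])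
    have Tn: "cmod u \<le> R" if "u \<in> T" for u
      using that cmod_le[of u] by (auto simp: T_def)
    have ne1: "of_real R + \<i> * u \<noteq> 0" if "u \<noteq> p" for u
    proof
      assume "of_real R + \<i> * u = 0"
      then have "Re (of_real R + \<i> * u) = 0" "Im (of_real R + \<i> * u) = 0" by simp_all
      then show False using that by (auto simp: p_def complex_eq_iff)
    qed
    have ne2: "of_real R - \<i> * u \<noteq> 0" if "u \<in> T" for u
    proof
      assume "of_real R - \<i> * u = 0"
      then have "Re (of_real R - \<i> * u) = 0" by simp
      then show False using that R by (auto simp: T_def)
    qed
    have pU: "p \<notin> U" by (auto simp: p_def U_def)
    have "of_real R + \<i> * u \<noteq> 0" "of_real R - \<i> * u \<noteq> 0" if "u \<in> U" for u
      using that pU UT ne1[of u] ne2[of u] by blast+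
    then have holw: "w holomorphic_on U" unfolding w_def
      by (intro holomorphic_intros) (use R in auto)
    have "(\<lambda>u. g u * exp (- of_real e * w u)) holomorphic_on U"
      by (intro holomorphic_intros holw holomorphic_on_subset[OF holo]) auto
    then have holF: "F holomorphic_on U"
      by (rule holomorphic_transform) (use pU in \<open>auto simp: F_def\<close>)
    have re1: "Re (1 / (of_real R + \<i> * u)) = (R - Im u) / ((R - Im u)\<^sup>2 + (Re u)\<^sup>2)" for u
      by (simp add: Re_divide power2_eq_square)
    have re2: "Re (1 / (of_real R - \<i> * u)) = (R + Im u) / ((R + Im u)\<^sup>2 + (Re u)\<^sup>2)" for u
      by (simp add: Re_divide power2_eq_square)
    have Rew: "Re (w u) = 2 * R\<^sup>2 * ((R - Im u) / ((R - Im u)\<^sup>2 + (Re u)\<^sup>2) - (R + Im u) / ((R + Im u)\<^sup>2 + (Re u)\<^sup>2))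
        + 4 * Im u + 2 * ((Re u)\<^sup>2 - (Im u)\<^sup>2) / R" for u
    proof -
      have "Re (2 * u\<^sup>2 / of_real R) = 2 * ((Re u)\<^sup>2 - (Im u)\<^sup>2) / R"
        by (simp add: Re_divide_of_real power2_eq_square)
      moreover have "Re (2 * of_real R ^ 2 * v) = 2 * R\<^sup>2 * Re v" for v
      proof -
        have "2 * of_real R ^ 2 = complex_of_real (2 * R\<^sup>2)" by simp
        then show ?thesis by (simp only: Re_complex_of_real Re_mult_real)
      qed
      moreover have "Re (4 * (\<i> * u)) = - 4 * Im u" by simp
      ultimately show ?thesis unfolding w_def
        by (simp only: minus_complex.sel plus_complex.sel re1 re2)
    qed
    have small: "2 * R\<^sup>2 * ((R + Im u) / ((R + Im u)\<^sup>2 + (Re u)\<^sup>2)) \<le> 2 * R" if "u \<in> T" for u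
    proof -
      have "R + Im u \<ge> R" using that by (auto simp: T_def)
      then have "R + Im u > 0" using R by linarith
      then have "(R + Im u) / ((R + Im u)\<^sup>2 + (Re u)\<^sup>2) \<le> (R + Im u) / (R + Im u)\<^sup>2"
        by (intro divide_left_mono mult_pos_pos add_pos_nonneg) auto
      also have "\<dots> \<le> 1 / R" using \<open>R + Im u \<ge> R\<close> R by (simp add: power2_eq_square frac_le)
      finally have "2 * R\<^sup>2 * ((R + Im u) / ((R + Im u)\<^sup>2 + (Re u)\<^sup>2)) \<le> 2 * R\<^sup>2 * (1 / R)"
        by (intro mult_left_mono) auto
      then show ?thesis using R by (simp add: power2_eq_square)
    qed
    have gc: "continuous_on UNIV g" using holo holomorphic_on_imp_continuous_on by blast
    have "compact T"
      using \<open>closed T\<close> Tn by (auto simp: compact_eq_bounded_closed bounded_iff)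
    then obtain K where K: "K > 0" "\<And>u. u \<in> T \<Longrightarrow> cmod (g u) \<le> K"
      using compact_imp_bounded[OF compact_continuous_image[OF continuous_on_subset[OF gc] \<open>compact T\<close>]]
      unfolding bounded_pos by auto
    \<comment> \<open>Within the triangle |u - p| is at most 2 (R - Im u), so Re w is at least R^2 /
      |u - p| - 4 R. The exponential thus vanishes at the tip, and the value 0 chosen there makes F
      continuous.\<close>
    have tip: "(F \<longlongrightarrow> 0) (at p within T)"
    proof (rule Lim_null_comparison)
      show "\<forall>\<^sub>F u in at p within T. cmod (F u) \<le> K * exp (4 * e * R) * exp (- (e * R\<^sup>2 * inverse (cmod (u - p))))"
        unfolding eventually_at_topological
      proof (intro exI[of _ UNIV] conjI ballI impI)
        fix u assume u: "u \<noteq> p" "u \<in> T"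
        define s where "s = R - Im u"
        have s: "\<bar>Re u\<bar> \<le> s" using u by (auto simp: s_def T_def)
        have t2: "(cmod (u - p))\<^sup>2 = s\<^sup>2 + (Re u)\<^sup>2"
          unfolding cmod_power2 by (simp add: p_def s_def power2_commute)
        have t0: "cmod (u - p) > 0" using u by simp
        have "(Re u)\<^sup>2 \<le> s\<^sup>2" using s by (metis abs_ge_zero power2_abs power_mono)
        then have "(cmod (u - p))\<^sup>2 \<le> (2 * s)\<^sup>2"
        proof -
          have "(2 * s)\<^sup>2 = 4 * s\<^sup>2" by simp
          then show ?thesis using t2 zero_le_power2[of s] \<open>(Re u)\<^sup>2 \<le> s\<^sup>2\<close> by linarith
        qed
        moreover have "0 \<le> 2 * s" using s abs_ge_zero[of "Re u"] by linarith
        ultimately have "cmod (u - p) \<le> 2 * s" by (rule power2_le_imp_le)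
        then have "1 / (2 * cmod (u - p)) \<le> s / (cmod (u - p))\<^sup>2"
          using t0 by (simp add: field_simps power2_eq_square)
        then have A: "R\<^sup>2 * inverse (cmod (u - p)) \<le> 2 * R\<^sup>2 * ((R - Im u) / ((R - Im u)\<^sup>2 + (Re u)\<^sup>2))"
          using mult_left_mono[of "1 / (2 * cmod (u - p))" "s / (cmod (u - p))\<^sup>2" "2 * R\<^sup>2"]
          unfolding t2 s_def by (simp add: field_simps)
        have I: "0 \<le> Im u" "Im u \<le> R" using u by (auto simp: T_def)
        have "(Im u)\<^sup>2 \<le> R\<^sup>2" using I by (intro power_mono) auto
        then have "- R\<^sup>2 \<le> (Re u)\<^sup>2 - (Im u)\<^sup>2" using zero_le_power2[of "Re u"] by linarith
        then have "2 * (- R\<^sup>2) / R \<le> 2 * ((Re u)\<^sup>2 - (Im u)\<^sup>2) / R"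
          using R by (intro divide_right_mono mult_left_mono) auto
        moreover have "2 * (- R\<^sup>2) / R = - 2 * R" using R by (simp add: power2_eq_square)
        ultimately have "- 2 * R \<le> 2 * ((Re u)\<^sup>2 - (Im u)\<^sup>2) / R" by simp
        then have "R\<^sup>2 * inverse (cmod (u - p)) - 4 * R \<le> Re (w u)"
          using A small[OF u(2)] I unfolding Rew right_diff_distrib by linarith
        then have "e * (R\<^sup>2 * inverse (cmod (u - p)) - 4 * R) \<le> e * Re (w u)"
          using e by (intro mult_left_mono) auto
        then have "- e * Re (w u) \<le> 4 * e * R + - (e * R\<^sup>2 * inverse (cmod (u - p)))"
          by (simp add: algebra_simps)
        then have "exp (- e * Re (w u)) \<le> exp (4 * e * R) * exp (- (e * R\<^sup>2 * inverse (cmod (u - p))))"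
          unfolding exp_add[symmetric] by simp
        then show "cmod (F u) \<le> K * exp (4 * e * R) * exp (- (e * R\<^sup>2 * inverse (cmod (u - p))))"
          using K(1) K(2)[OF u(2)] u by (simp add: F_def norm_mult mult.assoc mult_mono)
      qed auto
      have "filterlim (\<lambda>u. inverse (cmod (u - p))) at_top (at p within T)"
        by (rule filterlim_inverse_at_top)
           (auto intro!: tendsto_eq_intros simp: eventually_at_topological)
      then have "filterlim (\<lambda>u. e * R\<^sup>2 * inverse (cmod (u - p))) at_top (at p within T)"
        using e R by (intro filterlim_tendsto_pos_mult_at_top[OF tendsto_const]) auto
      then have "((\<lambda>u. exp (- (e * R\<^sup>2 * inverse (cmod (u - p))))) \<longlongrightarrow> 0) (at p within T)"
        by (intro filterlim_compose[OF exp_at_bot]) (simp add: filterlim_uminus_at_top)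
      then show "((\<lambda>u. K * exp (4 * e * R) * exp (- (e * R\<^sup>2 * inverse (cmod (u - p))))) \<longlongrightarrow> 0) (at p within T)"
        by (rule tendsto_mult_right_zero)
    qed
    have contF: "continuous_on T F"
      unfolding continuous_on_def
    proof
      fix u assume u: "u \<in> T"
      show "(F \<longlongrightarrow> F u) (at u within T)"
      proof (cases "u = p")
        case True
        then show ?thesis using tip by (simp add: F_def)
      next
        case False
        have "isCont g u" using gc by (simp add: continuous_on_eq_continuous_at)
        moreover have "isCont w u" unfolding w_def
          using ne1[OF False] ne2[OF u] R by (intro continuous_intros) auto
        ultimately have "isCont (\<lambda>u. g u * exp (- of_real e * w u)) u" by (intro continuous_intros)
        then have "((\<lambda>u. g u * exp (- of_real e * w u)) \<longlongrightarrow> F u) (at u within T)"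
          using False by (simp add: F_def isCont_def tendsto_within_subset[of _ _ _ UNIV])
        moreover have "\<forall>\<^sub>F v in at u within T. g v * exp (- of_real e * w v) = F v"
          unfolding eventually_at_topological
          by (rule exI[of _ "- {p}"]) (use False in \<open>auto simp: F_def\<close>)
        ultimately show ?thesis using Lim_transform_eventually by blast
      qed
    qed
    have "cmod (F z) \<le> B"
    proof (rule maximum_modulus_frontier[where S = U and f = F])
      show "bounded U" using \<open>compact T\<close> UT bounded_subset compact_imp_bounded by blast
      show "F holomorphic_on interior U" using holF \<open>open U\<close> by (simp add: interior_open)
      show "continuous_on (closure U) F" by (rule continuous_on_subset[OF contF clU])
      show "z \<in> U" using z R abs_Re_le_cmod[of z] abs_Im_le_cmod[of z] by (auto simp: U_def)
      fix u assume "u \<in> frontier U"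
      then have u: "u \<in> T" "u \<notin> U" using clU \<open>open U\<close> by (auto simp: frontier_def interior_open)
      consider "u = p" | "u \<noteq> p" "Im u = 0" | "u \<noteq> p" "\<bar>Re u\<bar> + Im u = R" "Im u \<ge> 0"
        using u by (force simp: T_def U_def)
      then show "cmod (F u) \<le> B"
      proof cases
        case 1
        then show ?thesis using B by (simp add: F_def)
      next
        case 2
        have "u = of_real (Re u)" using 2 by (simp add: complex_eq_iff)
        then have "cmod (g u) \<le> B" using B(2)[of "Re u"] by simp
        moreover have "exp (- (e * Re (w u))) \<le> 1" unfolding Rew using 2 e R by simp
        ultimately have "cmod (g u) * exp (- (e * Re (w u))) \<le> B * 1" by (intro mult_mono) (use B in auto)
        then show ?thesis using 2 by (simp add: F_def norm_mult)
      next
        case 3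
        define x where "x = \<bar>Re u\<bar>"
        have x: "x > 0" using 3 by (auto simp: x_def p_def complex_eq_iff)
        have xu: "R - Im u = x" "(Re u)\<^sup>2 = x\<^sup>2" "Im u = R - x" using 3 by (auto simp: x_def)
        have q: "2 * (x\<^sup>2 - (R - x)\<^sup>2) / R = 2 * R - 4 * (R - x)"
          using R by (simp add: power2_eq_square field_simps)
        have "2 * R\<^sup>2 * (x / (x\<^sup>2 + x\<^sup>2)) = R\<^sup>2 / x" using x by (simp add: power2_eq_square)
        then have "R\<^sup>2 / x \<le> Re (w u)"
          using small[OF u(1)] q unfolding Rew right_diff_distrib xu by (simp add: xu)
        then have w: "e * (R\<^sup>2 / x) \<le> e * Re (w u)" using e by (intro mult_left_mono) auto
        have "R / 2 \<le> cmod u"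
          using 3 abs_Re_le_cmod[of u] abs_Im_le_cmod[of u] by linarith
        then have "cmod (g u) \<le> exp (e * (cmod u)\<^sup>2 / x)"
          using R0[of u] R x by (auto simp: x_def)
        also have "\<dots> \<le> exp (e * (R\<^sup>2 / x))"
        proof -
          have "(cmod u)\<^sup>2 \<le> R\<^sup>2" using Tn[OF u(1)] by (intro power_mono) auto
          then show ?thesis using e x by (simp add: divide_right_mono)
        qed
        finally have "cmod (g u) * exp (- (e * Re (w u))) \<le> exp (e * (R\<^sup>2 / x)) * exp (- (e * (R\<^sup>2 / x)))"
          using w by (intro mult_mono) auto
        also have "\<dots> = 1" by (simp add: exp_minus)
        finally show ?thesis using 3 B by (simp add: F_def norm_mult)
      qed
    qed
    moreover have "z \<noteq> p" using R z abs_Im_le_cmod[of z] by (auto simp: p_def)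
    ultimately have "cmod (g z) * exp (- (e * Re (w z))) \<le> B" by (simp add: F_def norm_mult)
    then have 1: "cmod (g z) \<le> B * exp (e * Re (w z))" by (simp add: exp_minus field_simps)
    \<comment> \<open>Putting the two fractions over a common denominator cancels R^2. With |z|
      \<le> R / 2 the three terms contribute at most 16/3, 4 and 1 times |z|. The bound does not
      involve R, which depends on e, so e can tend to 0 afterwards.\<close>
    have "Re (w z) \<le> 11 * cmod z"
    proof -
      have z2: "cmod z \<le> R / 2" using R by simp
      have zT: "z \<in> T" using z R abs_Re_le_cmod[of z] abs_Im_le_cmod[of z] by (auto simp: T_def)
      have "w z = 2 * of_real R ^ 2 * (- 2 * \<i> * z / (of_real R ^ 2 + z\<^sup>2)) - 4 * (\<i> * z) + 2 * z\<^sup>2 / of_real R"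
      proof -
        have "1 / (of_real R + \<i> * z) - 1 / (of_real R - \<i> * z) = - 2 * \<i> * z / ((of_real R + \<i> * z) * (of_real R - \<i> * z))"
          using ne1[OF \<open>z \<noteq> p\<close>] ne2[OF zT] by (simp add: field_simps)
        also have "(of_real R + \<i> * z) * (of_real R - \<i> * z) = of_real R ^ 2 + z\<^sup>2"
          by (simp add: algebra_simps power2_eq_square)
        finally show ?thesis by (simp add: w_def)
      qed
      also have "cmod \<dots> \<le> 2 * R\<^sup>2 * (2 * cmod z / (3/4 * R\<^sup>2)) + 4 * cmod z + 2 * (cmod z)\<^sup>2 / R"
      proof -
        have "(cmod z)\<^sup>2 \<le> (R/2)\<^sup>2" using z2 by (intro power_mono) auto
        moreover have "R\<^sup>2 \<le> cmod (of_real R ^ 2 + z\<^sup>2) + (cmod z)\<^sup>2"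
          using norm_triangle_ineq4[of "of_real R ^ 2 + z\<^sup>2" "z\<^sup>2"] by (simp add: norm_power)
        ultimately have den: "3/4 * R\<^sup>2 \<le> cmod (of_real R ^ 2 + z\<^sup>2)" by (simp add: power2_eq_square)
        have "cmod (- 2 * \<i> * z / (of_real R ^ 2 + z\<^sup>2)) \<le> 2 * cmod z / (3/4 * R\<^sup>2)"
        proof -
          have "cmod (- 2 * \<i> * z) = 2 * cmod z" by (simp add: norm_mult)
          moreover have "0 < 3/4 * R\<^sup>2" using R by simp
          ultimately show ?thesis unfolding norm_divide using den by (intro frac_le) auto
        qed
        then have "cmod (2 * of_real R ^ 2 * (- 2 * \<i> * z / (of_real R ^ 2 + z\<^sup>2))) \<le> 2 * R\<^sup>2 * (2 * cmod z / (3/4 * R\<^sup>2))"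
          unfolding norm_mult by (intro mult_mono) (auto simp: norm_power)
        moreover have "cmod (4 * (\<i> * z)) = 4 * cmod z" "cmod (2 * z\<^sup>2 / of_real R) = 2 * (cmod z)\<^sup>2 / R"
          using R by (simp_all add: norm_mult norm_divide norm_power)
        ultimately show ?thesis
          using norm_triangle_ineq[of "2 * of_real R ^ 2 * (- 2 * \<i> * z / (of_real R ^ 2 + z\<^sup>2)) - 4 * (\<i> * z)" "2 * z\<^sup>2 / of_real R"]
            norm_triangle_ineq4[of "2 * of_real R ^ 2 * (- 2 * \<i> * z / (of_real R ^ 2 + z\<^sup>2))" "4 * (\<i> * z)"] by linarith
      qed
      also have "2 * R\<^sup>2 * (2 * cmod z / (3/4 * R\<^sup>2)) = 16 / 3 * cmod z" using R by simp
      also have "2 * (cmod z)\<^sup>2 / R \<le> cmod z"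
      proof -
        have "2 * (cmod z)\<^sup>2 \<le> R * cmod z" unfolding power2_eq_square
          using mult_right_mono[OF z2, of "cmod z"] by simp
        then show ?thesis using R by (simp add: field_simps)
      qed
      finally have "cmod (w z) \<le> 11 * cmod z" using norm_ge_zero[of z] by linarith
      then show ?thesis using complex_Re_le_cmod[of "w z"] by linarith
    qed
    then have "e * Re (w z) \<le> 11 * e * cmod z" using mult_left_mono[of "Re (w z)" "11 * cmod z" e] e by (simp add: mult_ac)
    then have "B * exp (e * Re (w z)) \<le> B * exp (11 * e * cmod z)" using B by simp
    with 1 show ?thesis by linarith
  qed
  have "((\<lambda>e. B * exp (11 * e * cmod z)) \<longlongrightarrow> B * exp (11 * 0 * cmod z)) (at_right 0)"
    by (intro tendsto_intros)
  then have "((\<lambda>e. B * exp (11 * e * cmod z)) \<longlongrightarrow> B) (at_right 0)" by simp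
  then show ?thesis
    by (rule tendsto_lowerbound) (auto simp: eventually_at_right_less intro: eventually_mono[OF eventually_at_right_less] est)
qed

text \<open>The quotient g = f (u) / u is entire and bounded on the real axis, hence bounded in the
  upper half plane by \<open>minimal_type_upper_bound\<close> and in the lower one because it is
  odd. By Liouville it is a constant c, and f (u) = c u is even only for c = 0.\<close>

lemma even_entire_minimal_type_zero:
  assumes holo: "f holomorphic_on UNIV" and even: "\<And>u. f (- u) = f u" and f0: "f 0 = 0"
    and B: "\<And>x::real. cmod (f (of_real x)) \<le> B * \<bar>x\<bar>"
    and growth: "\<And>e. e > 0 \<Longrightarrow> \<exists>R. \<forall>u. cmod u \<ge> R \<and> Re u \<noteq> 0 \<longrightarrow> cmod (f u) \<le> exp (e * (cmod u)\<^sup>2 / \<bar>Re u\<bar>)"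
  shows "f u = 0"
proof -
  define g where "g = (\<lambda>z. if z = 0 then deriv f 0 else (f z - f 0) / (z - 0))"
  have holg: "g holomorphic_on UNIV"
    unfolding g_def by (rule pole_lemma[OF holo]) simp
  have fg: "f z = z * g z" for z using f0 by (simp add: g_def)
  define C where "C = 1 + max B (cmod (g 0))"
  have B0: "B \<ge> 0" using order_trans[OF norm_ge_zero B[of 1]] by simp
  have C1: "1 \<le> C" using B0 by (simp add: C_def)
  have real: "cmod (g (of_real x)) \<le> C" for x :: real
  proof (cases "x = 0")
    case False
    have "\<bar>x\<bar> * cmod (g (of_real x)) \<le> B * \<bar>x\<bar>" using B[of x] by (simp add: fg norm_mult)
    then have "cmod (g (of_real x)) \<le> B" using False by simp
    then show ?thesis by (simp add: C_def)
  qed (simp add: C_def)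
  have grow: "\<exists>R. \<forall>u. cmod u \<ge> R \<and> Re u \<noteq> 0 \<longrightarrow> cmod (g u) \<le> exp (e * (cmod u)\<^sup>2 / \<bar>Re u\<bar>)" if e: "e > 0" for e
  proof -
    obtain R where R: "\<And>u. cmod u \<ge> R \<and> Re u \<noteq> 0 \<Longrightarrow> cmod (f u) \<le> exp (e * (cmod u)\<^sup>2 / \<bar>Re u\<bar>)"
      using growth[OF e] by blast
    show ?thesis
    proof (intro exI[of _ "max R 1"] allI impI)
      fix u :: complex assume u: "cmod u \<ge> max R 1 \<and> Re u \<noteq> 0"
      have "1 * cmod (g u) \<le> cmod u * cmod (g u)" using u by (intro mult_right_mono) auto
      also have "\<dots> = cmod (f u)" by (simp add: fg norm_mult)
      finally show "cmod (g u) \<le> exp (e * (cmod u)\<^sup>2 / \<bar>Re u\<bar>)" using R[of u] u by simp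
    qed
  qed
  have up: "cmod (g z) \<le> C" if "Im z > 0" for z
    by (rule minimal_type_upper_bound[OF holg C1 real grow that])
  have low: "cmod (g z) \<le> C" if "Im z < 0" for z
  proof -
    have "z * (g (- (- z)) + g (- z)) = 0" using even[of "-z"] by (simp add: fg algebra_simps)
    moreover have "z \<noteq> 0" using that by auto
    ultimately have "g (- (- z)) = - g (- z)" by (simp add: add_eq_0_iff2)
    then show ?thesis using up[of "-z"] that by simp
  qed
  have "cmod (g z) \<le> C" for z
    using up[of z] low[of z] real[of "Re z"] by (cases "Im z = 0") (auto simp: complex_is_Real_iff neq_iff complex_eq_iff intro: complex_eqI simp flip: complex_of_real_def)
  then have "bounded (range g)" by (auto simp: bounded_iff)
  then obtain c where c: "\<And>z. g z = c" using Liouville_theorem[OF holg] unfolding constant_on_def by blast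
  have "f u + f (- u) = 0" by (simp add: fg c)
  then have "2 * f u = 0" unfolding even mult_2 .
  then show ?thesis by simp
qed

section \<open>Uniqueness\<close>

text \<open>Lebesgue differentiation: at almost every x the averages over [x, x + h] tend to f
  x.\<close>

lemma AE_zero_if_interval_integrals_zero:
  fixes f :: "real \<Rightarrow> real"
  assumes f: "\<And>a b. f integrable_on {a..b}" and z: "\<And>a b. a \<le> b \<Longrightarrow> integral {a..b} f = 0"
  shows "AE x in lebesgue. f x = 0"
proof -
  obtain N where N: "negligible N" and lim: "\<And>x e. \<lbrakk>x \<notin> N; 0 < e\<rbrakk> \<Longrightarrow> \<exists>d>0. \<forall>h. 0 < h \<and> h < d \<longrightarrow>
      norm (integral (cbox x (x + h *\<^sub>R One)) f /\<^sub>R h ^ DIM(real) - f x) < e"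
    using integrable_ccontinuous_explicit[of f] f by auto
  have "f x = 0" if x: "x \<notin> N" for x
  proof (rule ccontr)
    assume "f x \<noteq> 0"
    then obtain d where d: "d > 0" "\<forall>h. 0 < h \<and> h < d \<longrightarrow> norm (integral (cbox x (x + h *\<^sub>R One)) f /\<^sub>R h ^ DIM(real) - f x) < \<bar>f x\<bar>"
      using lim[OF x, of "\<bar>f x\<bar>"] by auto
    from d(2)[rule_format, of "d / 2"] d(1) show False using z[of x "x + d / 2"] by simp
  qed
  moreover have "AE x in lebesgue. x \<notin> N"
    using N by (simp add: negligible_iff_null_sets AE_not_in)
  ultimately show ?thesis by (auto elim: eventually_mono)
qed

text \<open>The two expressions for the limit of \<open>jost_sum\<close> at -infinity give 2 i z (1
  - a) as the integral of q m. For |z| \<ge> 3 Q + 1 the bound |m| \<le> exp 1 \<le> 3 makes this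
  integral at most |z|, hence |1 - a| \<le> 1/2.\<close>

lemma jost_a_large:
  assumes q: "integrable lebesgue q"
  shows "\<exists>R>0. \<forall>z\<in>uhp. R \<le> cmod z \<longrightarrow> 1/2 \<le> cmod (jost_a q z)"
proof (intro exI conjI ballI impI)
  define Q where "Q = l1_norm q"
  have Q: "Q \<ge> 0" using l1_norm_nonneg[OF q] by (simp add: Q_def)
  show "3 * Q + 1 > 0" using Q by simp
  fix z assume z: "z \<in> uhp" and R: "3 * Q + 1 \<le> cmod z"
  have zc: "z \<in> uhp_closed" and z': "0 \<le> Im z" "z \<noteq> 0" using z by (auto simp: uhp_def uhp_closed_def)
  define I where "I = (LINT t|lebesgue. of_real (q t) * jost_mod q z t)"
  have "2 * \<i> * z - I = 2 * \<i> * z * jost_a q z"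
    unfolding I_def by (rule tendsto_unique[OF trivial_limit_at_bot_linorder volterra_tails_at_bot(2)[OF q z] jost_sum_at_bot[OF q z]])
  from this[symmetric] have "2 * \<i> * z * (1 - jost_a q z) = I" by (simp only: right_diff_distrib mult_1_right) simp
  then have n: "2 * cmod z * cmod (1 - jost_a q z) = cmod I" by (metis (no_types, lifting) norm_ii norm_mult norm_numeral mult_1_right)
  have "Q / cmod z \<le> 1" using Q R by (simp add: divide_le_eq)
  then have e: "exp (Q / cmod z) \<le> 3" using exp_le by (meson exp_le_cancel_iff order_trans)
  have "cmod I \<le> (LINT t|lebesgue. 3 * \<bar>q t\<bar>)"
    unfolding I_def
  proof (rule Bochner_Integration.integral_norm_bound_integral)
    show "integrable lebesgue (\<lambda>t. 3 * \<bar>q t\<bar>)" using abs_q_integrable[OF q] by simp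
    have b: "cmod (jost_mod q z t) \<le> 3" for t
      using norm_jost_mod_le'[OF q z'(1), of "cmod z" t] e z' by (simp add: Q_def)
    have "jost_mod q z \<in> borel_measurable lebesgue"
      by (rule borel_measurable_lebesgue_continuous[OF continuous_jost_mod[OF q z']])
    then show "integrable lebesgue (\<lambda>t. of_real (q t) * jost_mod q z t)"
      using mult_q_integrable[OF q, of "jost_mod q z" UNIV 3] b by (simp add: set_integrable_def mult.commute)
    show "norm (of_real (q t) * jost_mod q z t) \<le> 3 * \<bar>q t\<bar>" for t
      using mult_right_mono[OF b[of t], of "\<bar>q t\<bar>"] by (simp add: norm_mult mult.commute)
  qed
  also have "\<dots> = 3 * Q" by (simp add: Q_def l1_norm_def)
  also have "\<dots> \<le> cmod z" using R by linarith
  finally have "2 * cmod z * cmod (1 - jost_a q z) \<le> cmod z * 1" using n by simp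
  then have "cmod z * (2 * cmod (1 - jost_a q z)) \<le> cmod z * 1" by (simp only: mult_ac)
  moreover have "0 < cmod z" using z' by simp
  ultimately have "2 * cmod (1 - jost_a q z) \<le> 1" by (simp only: mult_le_cancel_left_pos)
  moreover have "1 \<le> cmod (jost_a q z) + cmod (1 - jost_a q z)" using norm_triangle_ineq[of "jost_a q z" "1 - jost_a q z"] by simp
  ultimately show "1/2 \<le> cmod (jost_a q z)" by linarith
qed

text \<open>At real k, a (- k) is the conjugate of a (k) and |a (k)| = 1, so dividing by a (k) is
  multiplying by a (- k). This turns the proportionality at - k into the claim.\<close>

lemma reflectionless_psiL_quotient:
  assumes q: "integrable lebesgue q" and r: "reflectionless q" and k: "k \<noteq> 0"
  shows "psiL q (of_real k) x / jost_a q (of_real k) = psi q (of_real (- k)) x"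
proof -
  have k': "- k \<noteq> 0" using k by simp
  define a where "a = jost_a q (of_real k)"
  have "- cnj (complex_of_real k) = of_real (- k)" by simp
  then have "jost_a q (of_real (- k)) = cnj a"
    using jost_a_cnj[OF q of_real_in_uhp_closed[OF k]] by (simp add: a_def)
  moreover have "a * cnj a = 1"
    unfolding complex_norm_square[symmetric] a_def using reflectionless_psi(3)[OF q r k] by simp
  ultimately have *: "a * jost_a q (of_real (- k)) = 1" and a0: "a \<noteq> 0" by auto
  have "psi q (of_real (- k)) x = jost_a q (of_real (- k)) * psiL q (of_real k) x"
    using reflectionless_psi(1)[OF q r k', of x] by simp
  then have "a * psi q (of_real (- k)) x = psiL q (of_real k) x" using * by (simp flip: mult.assoc)
  then show ?thesis using a0 by (simp add: a_def field_simps)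
qed

text \<open>For real \<open>k\<close>, \<open>psiL (k) / a (k) = psi (- k)\<close>, so on the real line the numerator of \<open>D\<close> below is the
  antisymmetrisation of \<open>psi p (- k) psi q (k)\<close>. Hence \<open>D\<close> is even there and continues to the whole punctured plane;
  equality of the norming constants cancels the poles at the eigenvalues.\<close>

lemma antisymmetrised_jost_zero:
  assumes q: "integrable lebesgue q" and p: "integrable lebesgue p"
    and rq: "reflectionless q" and rp: "reflectionless p"
    and zeros: "\<And>z. z \<in> uhp \<Longrightarrow> jost_a q z = 0 \<longleftrightarrow> jost_a p z = 0"
    and norming: "\<And>z. z \<in> uhp \<Longrightarrow> jost_a q z = 0 \<Longrightarrow>
      \<exists>\<kappa> m. \<kappa> > 0 \<and> z = \<i> * of_real \<kappa> \<and> is_norming_constant q \<kappa> m \<and> is_norming_constant p \<kappa> m"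
    and k: "k \<noteq> 0"
  shows "psi p (of_real (- k)) x * psi q (of_real k) x = psi q (of_real (- k)) x * psi p (of_real k) x"
proof -
  define B where "B = (\<lambda>r z. psiL r z x / jost_a r z)"
  define D where "D = (\<lambda>z. (B p z * psi q z x - B q z * psi p z x) / z)"
  \<comment> \<open>At a zero of a the quotient in D is a division by zero with value 0, so the
    limit is taken instead; it exists once the residues of the two products are seen to
    cancel.\<close>
  define D0 where "D0 = (\<lambda>z. if jost_a q z = 0 then Lim (at z) D else D z)"
  have areal: "jost_a q (of_real t) \<noteq> 0" "jost_a p (of_real t) \<noteq> 0" if "t \<noteq> 0" for t
    using reflectionless_psi(3)[OF q rq that] reflectionless_psi(3)[OF p rp that] by auto
  have closed_cases: "z \<in> uhp \<or> (\<exists>t. t \<noteq> 0 \<and> z = of_real t)" if "z \<in> uhp_closed" for z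
  proof (cases "Im z = 0")
    case True
    then have "z = of_real (Re z)" by (simp add: complex_eq_iff)
    moreover have "Re z \<noteq> 0" using that True by (auto simp: uhp_closed_def complex_eq_iff)
    ultimately show ?thesis by blast
  qed (use that in \<open>auto simp: uhp_closed_def uhp_def\<close>)
  define V where "V = uhp_closed \<inter> jost_a q -` (- {0})"
  have Vp: "jost_a p z \<noteq> 0" "jost_a q z \<noteq> 0" "z \<noteq> 0" if "z \<in> V" for z
    using that closed_cases[of z] zeros[of z] areal by (auto simp: V_def uhp_closed_def)
  have VD0: "D0 z = D z" if "z \<in> V" for z using Vp[OF that] by (simp add: D0_def)
  define G where "G = uhp \<inter> jost_a q -` (- {0})"
  have opG: "open G"
    unfolding G_def
    by (rule continuous_open_preimage[OF holomorphic_on_imp_continuous_on[OF jost_a_regular(2)[OF q]] open_uhp]) auto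
  have GV: "G \<subseteq> V" using uhp_subset by (auto simp: G_def V_def)
  have Gu: "G \<subseteq> uhp" by (auto simp: G_def)
  have holDG: "D holomorphic_on G"
    unfolding D_def B_def
    by (intro holomorphic_intros holomorphic_on_subset[OF psi_regular(2)[OF q] Gu] holomorphic_on_subset[OF psi_regular(2)[OF p] Gu]
        holomorphic_on_subset[OF psiL_regular(2)[OF q] Gu] holomorphic_on_subset[OF psiL_regular(2)[OF p] Gu]
        holomorphic_on_subset[OF jost_a_regular(2)[OF q] Gu] holomorphic_on_subset[OF jost_a_regular(2)[OF p] Gu])
      (use Vp GV in auto)
  have holD0: "D0 holomorphic_on uhp"
    unfolding holomorphic_on_open[OF open_uhp]
  proof
    fix z0 assume z0: "z0 \<in> uhp"
    show "\<exists>f'. (D0 has_field_derivative f') (at z0)"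
    proof (cases "jost_a q z0 = 0")
      case False
      have "D0 holomorphic_on G" by (rule holomorphic_transform[OF holDG]) (use VD0 GV in auto)
      then show ?thesis using opG z0 False by (auto simp: holomorphic_on_open G_def)
    next
      case True
      obtain \<kappa> m where km: "\<kappa> > 0" "z0 = \<i> * of_real \<kappa>" "is_norming_constant q \<kappa> m" "is_norming_constant p \<kappa> m"
        using norming[OF z0 True] by blast
      have "\<forall>\<^sub>F z in at z0. jost_a q z \<noteq> 0" using jost_residue(1)[OF q km(1,3)] by (simp add: km(2))
      moreover have "\<forall>\<^sub>F z in at z0. z \<in> uhp" using open_uhp z0 by (rule eventually_at_in_open')
      ultimately have "\<forall>\<^sub>F z in at z0. jost_a q z \<noteq> 0 \<and> z \<in> uhp" by (rule eventually_conj)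
      then obtain d where d: "d > 0" "\<And>z. z \<noteq> z0 \<Longrightarrow> dist z z0 < d \<Longrightarrow> jost_a q z \<noteq> 0 \<and> z \<in> uhp"
        unfolding eventually_at by auto
      define S where "S = ball z0 d"
      have "z \<in> G" if "z \<in> S - {z0}" for z
        using d(2)[of z] that by (simp add: S_def G_def dist_commute)
      then have SG: "S - {z0} \<subseteq> G" by blast
      have S: "open S" "z0 \<in> S" using d(1) by (auto simp: S_def)
      have holDS: "D holomorphic_on (S - {z0})" by (rule holomorphic_on_subset[OF holDG SG])
      have cont: "((\<lambda>z. psi r z x) \<longlongrightarrow> psi r z0 x) (at z0)" if "integrable lebesgue r" for r
        using holomorphic_on_imp_continuous_on[OF psi_regular(2)[OF that]] z0 open_uhp
        by (simp add: continuous_on_eq_continuous_at isCont_def)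
      have z00: "z0 \<noteq> 0" using z0 by (auto simp: uhp_def)
      have "((\<lambda>z. ((z - z0) * B p z * psi q z x - (z - z0) * B q z * psi p z x) / z) \<longlongrightarrow>
          (\<i> * of_real (m\<^sup>2) * psi p z0 x * psi q z0 x - \<i> * of_real (m\<^sup>2) * psi q z0 x * psi p z0 x) / z0) (at z0)"
        unfolding B_def km(2)
        by (intro tendsto_divide tendsto_diff tendsto_mult jost_residue(2)[OF q km(1,3)] jost_residue(2)[OF p km(1,4)]
            cont[unfolded km(2)] q p tendsto_ident_at) (use km(1) in auto)
      moreover have "((z - z0) * B p z * psi q z x - (z - z0) * B q z * psi p z x) / z = (z - z0) * D z" for z
        unfolding D_def by (simp only: times_divide_eq_right right_diff_distrib mult.assoc)
      ultimately have "((\<lambda>z. (z - z0) * D z) \<longlongrightarrow> 0) (at z0)" by (simp add: mult_ac)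
      then obtain g where g: "g holomorphic_on S" "\<And>z. z \<in> S - {z0} \<Longrightarrow> g z = D z"
        using holomorphic_on_extend_lim[OF holDS] S by (auto simp: interior_open)
      have "(g \<longlongrightarrow> g z0) (at z0)"
        using holomorphic_on_imp_continuous_on[OF g(1)] S by (simp add: continuous_on_eq_continuous_at isCont_def)
      moreover have "\<forall>\<^sub>F z in at z0. g z = D z"
        using S g(2) by (auto simp: eventually_at_topological)
      ultimately have "(D \<longlongrightarrow> g z0) (at z0)" by (rule Lim_transform_eventually)
      then have "D0 z0 = g z0" using True by (simp add: D0_def tendsto_Lim)
      moreover have "D0 z = g z" if "z \<in> S" "z \<noteq> z0" for z
        using that g(2)[of z] SG by (auto simp: D0_def G_def)
      ultimately have "D0 holomorphic_on S"
        by (intro holomorphic_transform[OF g(1)]) metis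
      then show ?thesis using S by (auto simp: holomorphic_on_open)
    qed
  qed
  have contD0: "continuous_on uhp_closed D0"
  proof -
    \<comment> \<open>All zeros of a lie in the open half plane, so the real boundary is covered by
      V, on which D0 is the explicit quotient. Both pieces are relatively open, so continuity may be
      checked on each.\<close>
    have un: "uhp_closed = uhp \<union> V"
    proof
      show "uhp_closed \<subseteq> uhp \<union> V"
      proof
        fix z assume z: "z \<in> uhp_closed"
        show "z \<in> uhp \<union> V" using closed_cases[OF z] areal(1) z by (auto simp: V_def)
      qed
    qed (use uhp_subset in \<open>auto simp: V_def\<close>)
    have o1: "openin (top_of_set (uhp \<union> V)) uhp"
      unfolding un[symmetric] using openin_open_Int[OF open_uhp, of uhp_closed] uhp_subset by (simp add: Int_absorb1)
    have o2: "openin (top_of_set (uhp \<union> V)) V"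
    proof -
      have "openin (top_of_set uhp_closed) V"
        unfolding V_def by (rule continuous_openin_preimage_gen[OF jost_a_regular(1)[OF q]]) auto
      then show ?thesis by (simp only: un[symmetric])
    qed
    have VU: "V \<subseteq> uhp_closed" by (auto simp: V_def)
    have "continuous_on V D"
      unfolding D_def B_def
      by (intro continuous_intros continuous_on_subset[OF psi_regular(1)[OF q] VU] continuous_on_subset[OF psi_regular(1)[OF p] VU]
          continuous_on_subset[OF psiL_regular(1)[OF q] VU] continuous_on_subset[OF psiL_regular(1)[OF p] VU]
          continuous_on_subset[OF jost_a_regular(1)[OF q] VU] continuous_on_subset[OF jost_a_regular(1)[OF p] VU])
        (use Vp in auto)
    then have "continuous_on V D0" by (rule continuous_on_eq) (simp add: VD0)
    then show ?thesis
      unfolding un by (rule continuous_on_Un_local_open[OF o1 o2 holomorphic_on_imp_continuous_on[OF holD0]])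
  qed
  have D0real: "D0 (of_real t) = (psi p (of_real (- t)) x * psi q (of_real t) x - psi q (of_real (- t)) x * psi p (of_real t) x) / of_real t"
    if t: "t \<noteq> 0" for t
  proof -
    have "B q (of_real t) = psi q (of_real (- t)) x" "B p (of_real t) = psi p (of_real (- t)) x"
      unfolding B_def by (rule reflectionless_psiL_quotient[OF q rq t] reflectionless_psiL_quotient[OF p rp t])+
    then show ?thesis using areal[OF t] by (simp add: D0_def D_def)
  qed
  have D0even: "D0 (of_real t) = D0 (- of_real t)" if t: "t \<noteq> 0" for t
  proof -
    have swap: "(a * b - c * d) / z = (d * c - b * a) / - z" for a b c d z :: complex
      by (cases "z = 0") (simp_all add: field_simps)
    have "D0 (- of_real t) = (psi p (of_real t) x * psi q (of_real (- t)) x - psi q (of_real t) x * psi p (of_real (- t)) x) / - of_real t"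
      using D0real[of "- t"] t by simp
    then show ?thesis unfolding D0real[OF t] by (simp only: swap[symmetric])
  qed
  have D0bound: "cmod (D0 (of_real t)) \<le> 2 / \<bar>t\<bar>" if t: "t \<noteq> 0" for t
  proof -
    have b: "cmod (psi p (of_real (- t)) x * psi q (of_real t) x) \<le> 1 * 1" "cmod (psi q (of_real (- t)) x * psi p (of_real t) x) \<le> 1 * 1"
      unfolding norm_mult using t
      by (intro mult_mono reflectionless_psi_le_1 q p rq rp; simp)+
    have "cmod (psi p (of_real (- t)) x * psi q (of_real t) x - psi q (of_real (- t)) x * psi p (of_real t) x) \<le> 2"
      by (rule order_trans[OF norm_triangle_ineq4]) (use b in linarith)
    then show ?thesis unfolding D0real[OF t] norm_divide norm_of_real by (rule divide_right_mono) simp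
  qed
  define E where "E = (\<lambda>z. if 0 \<le> Im z then D0 z else D0 (- z))"
  define A' where "A' = {z. - z \<in> uhp_closed}"
  have Ereal: "E (of_real t) = D0 (of_real t)" for t by (simp add: E_def)
  have Eeven: "E (- z) = E z" if "z \<noteq> 0" for z
  proof (cases "Im z = 0")
    case True
    then have z: "z = of_real (Re z)" by (simp add: complex_eq_iff)
    then have "Re z \<noteq> 0" using that by auto
    from D0even[OF this] show ?thesis using True z by (simp add: E_def)
  qed (auto simp: E_def)
  have contE: "continuous_on (- {0}) E"
  proof -
    have un: "- {0} = uhp_closed \<union> A'" by (auto simp: uhp_closed_def A'_def)
    have "uhp_closed = - {0} \<inter> {z. 0 \<le> Im z}" "A' = - {0} \<inter> {z. Im z \<le> 0}" by (auto simp: uhp_closed_def A'_def)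
    moreover have "closed {z. 0 \<le> Im z}" "closed {z. Im z \<le> 0}"
      by (intro closed_Collect_le continuous_intros)+
    ultimately have cl: "closedin (top_of_set (uhp_closed \<union> A')) uhp_closed" "closedin (top_of_set (uhp_closed \<union> A')) A'"
      unfolding un[symmetric] by (metis closedin_closed_Int)+
    have c2: "continuous_on A' (\<lambda>z. D0 (- z))"
      by (rule continuous_on_compose2[OF contD0]) (auto simp: A'_def intro!: continuous_intros)
    show ?thesis unfolding un E_def
    proof (rule continuous_on_cases_local[OF cl contD0 c2])
      fix z assume "z \<in> uhp_closed \<and> \<not> 0 \<le> Im z \<or> z \<in> A' \<and> 0 \<le> Im z"
      then have "Im z = 0" "z \<noteq> 0" by (auto simp: uhp_closed_def A'_def)
      then have z: "z = of_real (Re z)" "Re z \<noteq> 0" by (auto simp: complex_eq_iff)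
      show "D0 z = D0 (- z)" using D0even[OF z(2)] z(1) by simp
    qed
  qed
  have holE: "E holomorphic_on (- {0})"
  proof (rule holomorphic_on_paste_across_line[OF _ _ _ _ contE, of \<i> 0])
    have h1: "D0 holomorphic_on (- {0} \<inter> {z. 0 < Im z})" by (rule holomorphic_on_subset[OF holD0]) (auto simp: uhp_def)
    have h2: "(\<lambda>z. D0 (- z)) holomorphic_on (- {0} \<inter> {z. Im z < 0})"
      by (rule holomorphic_on_compose_gen[OF _ holD0, unfolded o_def]) (auto simp: uhp_def intro!: holomorphic_intros)
    have "- {0} \<inter> {z. \<i> \<bullet> z < 0} = - {0} \<inter> {z. Im z < 0}" "- {0} \<inter> {z. 0 < \<i> \<bullet> z} = - {0} \<inter> {z. 0 < Im z}"
      by (auto simp: inner_complex_def)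
    then show "E holomorphic_on (- {0} \<inter> {z. \<i> \<bullet> z < 0})" "E holomorphic_on (- {0} \<inter> {z. 0 < \<i> \<bullet> z})"
      using holomorphic_transform[OF h1, of E] holomorphic_transform[OF h2, of E] by (auto simp: E_def)
  qed auto
  obtain R1 where R1: "R1 > 0" "\<forall>z\<in>uhp. R1 \<le> cmod z \<longrightarrow> 1/2 \<le> cmod (jost_a q z)"
    using jost_a_large[OF q] by blast
  obtain R2 where R2: "R2 > 0" "\<forall>z\<in>uhp. R2 \<le> cmod z \<longrightarrow> 1/2 \<le> cmod (jost_a p z)"
    using jost_a_large[OF p] by blast
  define R where "R = max R1 (max R2 1)"
  \<comment> \<open>For |z| \<ge> R \<ge> 1 the growth in x of psiL cancels the decay of psi, and 1
    / |a| \<le> 2, so each of the two products is at most C / 2.\<close>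
  define C where "C = 4 * exp (l1_norm q) * exp (l1_norm p)"
  have C1: "2 \<le> C"
  proof -
    have "1 * 1 \<le> exp (l1_norm q) * exp (l1_norm p)"
      using l1_norm_nonneg[OF q] l1_norm_nonneg[OF p] by (intro mult_mono) auto
    then show ?thesis unfolding C_def mult.assoc by linarith
  qed
  have D0large: "cmod (D0 z) \<le> C / cmod z" if z: "z \<in> uhp_closed" "R \<le> cmod z" for z
  proof (cases "z \<in> uhp")
    case False
    then obtain t where t: "t \<noteq> 0" "z = of_real t" using closed_cases z by blast
    have "2 / \<bar>t\<bar> \<le> C / \<bar>t\<bar>" using C1 by (rule divide_right_mono) simp
    then show ?thesis using D0bound[OF t(1)] t by simp
  next
    case True
    have az: "1/2 \<le> cmod (jost_a q z)" "1/2 \<le> cmod (jost_a p z)" using R1 R2 True z by (auto simp: R_def)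
    have z1: "1 \<le> cmod z" using z by (simp add: R_def)
    have bd: "cmod (B r1 z * psi r2 z x) \<le> C / 2"
      if r: "integrable lebesgue r1" "integrable lebesgue r2" "1/2 \<le> cmod (jost_a r1 z)" "exp (l1_norm r1) * exp (l1_norm r2) = C / 4" for r1 r2
    proof -
      have ex: "exp (Im z * x) * exp (- (Im z * x)) = 1" by (simp flip: exp_add)
      have "cmod (psiL r1 z x) * cmod (psi r2 z x) \<le> (exp (l1_norm r1) * exp (Im z * x)) * (exp (l1_norm r2) * exp (- (Im z * x)))"
        using norm_psi_le(2)[OF r(1) z(1) zero_less_one z1, of x] norm_psi_le(1)[OF r(2) z(1) zero_less_one z1, of x]
        by (intro mult_mono) auto
      also have "\<dots> = (exp (l1_norm r1) * exp (l1_norm r2)) * (exp (Im z * x) * exp (- (Im z * x)))" by (simp only: mult_ac)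
      finally have "cmod (psiL r1 z x) * cmod (psi r2 z x) \<le> C / 4" unfolding ex r(4) by simp
      moreover have "cmod (B r1 z * psi r2 z x) = cmod (psiL r1 z x) * cmod (psi r2 z x) / cmod (jost_a r1 z)"
        by (simp add: B_def norm_mult norm_divide)
      moreover have "cmod (psiL r1 z x) * cmod (psi r2 z x) / cmod (jost_a r1 z) \<le> (C / 4) / (1/2)"
        using r(3) calculation(1) C1 by (intro frac_le) auto
      ultimately show ?thesis by simp
    qed
    have "cmod (B p z * psi q z x - B q z * psi p z x) \<le> C / 2 + C / 2"
      by (rule order_trans[OF norm_triangle_ineq4], rule add_mono; rule bd) (use az p q in \<open>simp_all add: C_def mult.commute\<close>)
    moreover have "D0 z = D z" using az by (auto simp: D0_def)
    ultimately show ?thesis by (simp add: D_def norm_divide divide_right_mono)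
  qed
  have Elarge: "cmod (E z) \<le> C / cmod z" if "R \<le> cmod z" for z
  proof -
    have "z \<noteq> 0" using that by (auto simp: R_def)
    then show ?thesis using D0large[of z] D0large[of "- z"] that by (auto simp: E_def uhp_closed_def)
  qed
  \<comment> \<open>Inversion sends the uncontrolled point z = 0 to infinity. At u = 0 the decay C /
    |z| becomes C |u|, so the value 0 removes the singularity.\<close>
  define f where "f = (\<lambda>u. if u = 0 then 0 else E (1 / u))"
  have holf: "f holomorphic_on UNIV"
    unfolding f_def
  proof (rule removable_singularity)
    show "(\<lambda>u. E (1 / u)) holomorphic_on UNIV - {0}"
      by (rule holomorphic_on_compose_gen[OF _ holE, unfolded o_def]) (auto intro!: holomorphic_intros)
    show "((\<lambda>u. E (1 / u)) \<longlongrightarrow> 0) (at 0)"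
    proof (rule Lim_null_comparison)
      have R0: "R > 0" by (simp add: R_def)
      show "\<forall>\<^sub>F u in at 0. norm (E (1 / u)) \<le> C * cmod u"
        unfolding eventually_at
      proof (intro exI[of _ "1 / R"] conjI ballI impI)
        fix u :: complex assume u: "u \<noteq> 0 \<and> dist u 0 < 1 / R"
        then have "R \<le> cmod (1 / u)" using R0 by (simp add: norm_divide field_simps)
        from Elarge[OF this] show "norm (E (1 / u)) \<le> C * cmod u" by (simp add: norm_divide)
      qed (use R0 in simp)
      show "((\<lambda>u. C * cmod u) \<longlongrightarrow> 0) (at 0)" by (auto intro!: tendsto_eq_intros)
    qed
  qed simp
  have Bexp: "cmod (E z) \<le> exp (e / \<bar>Re z\<bar>)"
    if e: "e > 0" and z: "z \<noteq> 0" "Re z \<noteq> 0"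
      and sub: "\<And>w. w \<in> uhp_closed \<Longrightarrow> Re w \<noteq> 0 \<Longrightarrow> cmod w = cmod z \<Longrightarrow> cmod (D0 w) \<le> exp (e / \<bar>Re w\<bar>)" for e z
    using sub[of z] sub[of "- z"] z by (auto simp: E_def uhp_closed_def)
  have small: "\<exists>d>0. \<forall>w\<in>uhp_closed. Re w \<noteq> 0 \<and> cmod w < d \<longrightarrow> cmod (D0 w) \<le> exp (e / \<bar>Re w\<bar>)" if e: "e > 0" for e
  proof -
    \<comment> \<open>Four factors share the exponent: psiL, 1 / a, psi, and 2 / |Re w|, the last
      coming from the two terms of the numerator and the divisor w.\<close>
    define \<epsilon> where "\<epsilon> = e / 4"
    have \<epsilon>: "\<epsilon> > 0" using e by (simp add: \<epsilon>_def)
    note q' = integrable_lebesgue_reflect[OF q] and p' = integrable_lebesgue_reflect[OF p]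
    obtain d1 where d1: "d1 > 0" "\<forall>z\<in>uhp_closed. Re z \<noteq> 0 \<and> cmod z < d1 \<longrightarrow> cmod (psi q z x) \<le> exp (\<epsilon> / \<bar>Re z\<bar>)"
      using psi_subexponential[OF q \<epsilon>] by blast
    obtain d2 where d2: "d2 > 0" "\<forall>z\<in>uhp_closed. Re z \<noteq> 0 \<and> cmod z < d2 \<longrightarrow> cmod (psi p z x) \<le> exp (\<epsilon> / \<bar>Re z\<bar>)"
      using psi_subexponential[OF p \<epsilon>] by blast
    obtain d3 where d3: "d3 > 0" "\<forall>z\<in>uhp_closed. Re z \<noteq> 0 \<and> cmod z < d3 \<longrightarrow> cmod (psiL q z x) \<le> exp (\<epsilon> / \<bar>Re z\<bar>)"
      using psi_subexponential[OF q' \<epsilon>] unfolding psiL_def by blast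
    obtain d4 where d4: "d4 > 0" "\<forall>z\<in>uhp_closed. Re z \<noteq> 0 \<and> cmod z < d4 \<longrightarrow> cmod (psiL p z x) \<le> exp (\<epsilon> / \<bar>Re z\<bar>)"
      using psi_subexponential[OF p' \<epsilon>] unfolding psiL_def by blast
    obtain d5 where d5: "d5 > 0" "\<forall>z\<in>uhp. Re z \<noteq> 0 \<and> cmod z < d5 \<longrightarrow> exp (- (\<epsilon> / \<bar>Re z\<bar>)) \<le> cmod (jost_a q z)"
      using jost_a_lower_bound[OF q \<epsilon>] by blast
    obtain d6 where d6: "d6 > 0" "\<forall>z\<in>uhp. Re z \<noteq> 0 \<and> cmod z < d6 \<longrightarrow> exp (- (\<epsilon> / \<bar>Re z\<bar>)) \<le> cmod (jost_a p z)"
      using jost_a_lower_bound[OF p \<epsilon>] by blast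
    obtain d7 where d7: "d7 > 0" "\<forall>r::real. 0 < r \<and> r < d7 \<longrightarrow> 2 / r ^ 1 \<le> exp (\<epsilon> / r)"
      using inverse_power_le_exp_inverse[OF \<epsilon>, of 2 1] by auto
    define d where "d = Min {d1, d2, d3, d4, d5, d6, d7}"
    have "d > 0" using d1(1) d2(1) d3(1) d4(1) d5(1) d6(1) d7(1) by (simp add: d_def)
    moreover have "d \<le> y" if "y \<in> {d1, d2, d3, d4, d5, d6, d7}" for y
      unfolding d_def using that by (intro Min_le) simp_all
    ultimately have d: "d > 0" "d \<le> d1" "d \<le> d2" "d \<le> d3" "d \<le> d4" "d \<le> d5" "d \<le> d6" "d \<le> d7" by simp_all
    show ?thesis
    proof (intro exI[of _ d] conjI ballI impI d(1))
      fix w assume w: "w \<in> uhp_closed" and h: "Re w \<noteq> 0 \<and> cmod w < d"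
      define r where "r = \<bar>Re w\<bar>"
      have r: "0 < r" "r < d7" "r \<le> cmod w" using h d abs_Re_le_cmod[of w] by (auto simp: r_def)
      have two: "2 / r \<le> exp (\<epsilon> / r)" using d7 r by auto
      show "cmod (D0 w) \<le> exp (e / \<bar>Re w\<bar>)"
      proof (cases "w \<in> uhp")
        case False
        then obtain t where t: "t \<noteq> 0" "w = of_real t" using closed_cases w by blast
        have "cmod (D0 w) \<le> 2 / r" using D0bound[OF t(1)] t by (simp add: r_def)
        also have "\<dots> \<le> exp (\<epsilon> / r)" by (rule two)
        also have "\<dots> \<le> exp (e / r)" using divide_right_mono[of \<epsilon> e r] e r by (simp add: \<epsilon>_def)
        finally show ?thesis by (simp add: r_def)
      next
        case True
        define X where "X = exp (\<epsilon> / r)"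
        have X: "X > 0" by (simp add: X_def)
        have lo: "1 / X \<le> cmod (jost_a q w)" "1 / X \<le> cmod (jost_a p w)"
          using d5 d6 True h d unfolding X_def r_def by (auto simp: exp_minus inverse_eq_divide)
        have a0: "jost_a q w \<noteq> 0"
        proof
          assume "jost_a q w = 0"
          then show False using lo(1) X by (simp add: divide_le_0_iff)
        qed
        have bd: "cmod (B r1 w * psi r2 w x) \<le> X * X * X"
          if "cmod (psiL r1 w x) \<le> X" "cmod (psi r2 w x) \<le> X" "1 / X \<le> cmod (jost_a r1 w)" for r1 r2
        proof -
          have "cmod (B r1 w) \<le> X / (1 / X)"
            unfolding B_def norm_divide using that X by (intro frac_le) auto
          then have "cmod (B r1 w) \<le> X * X" by simp
          then show ?thesis unfolding norm_mult using that X by (intro mult_mono) auto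
        qed
        have "cmod (B p w * psi q w x) \<le> X * X * X" "cmod (B q w * psi p w x) \<le> X * X * X"
          using d1 d2 d3 d4 w h d lo unfolding X_def r_def by (intro bd[unfolded X_def r_def]; simp)+
        then have "cmod (B p w * psi q w x - B q w * psi p w x) \<le> 2 * (X * X * X)"
          using norm_triangle_ineq4[of "B p w * psi q w x" "B q w * psi p w x"] by linarith
        then have "cmod (D w) \<le> 2 * (X * X * X) / r"
          unfolding D_def norm_divide using r X by (intro frac_le) auto
        also have "\<dots> = 2 / r * (X * X * X)" by simp
        also have "\<dots> \<le> X * (X * X * X)" using two X unfolding X_def by (intro mult_right_mono) auto
        also have "\<dots> = exp (e / r)" unfolding X_def \<epsilon>_def by (simp flip: exp_add)
        finally show ?thesis using a0 by (simp add: D0_def r_def)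
      qed
    qed
  qed
  have "f u = 0" for u
  proof (rule even_entire_minimal_type_zero[OF holf, of 2])
    show "f (- u) = f u" for u using Eeven[of "1 / u"] by (simp add: f_def)
    show "f 0 = 0" by (simp add: f_def)
    show "cmod (f (of_real t)) \<le> 2 * \<bar>t\<bar>" for t
    proof (cases "t = 0")
      case False
      have "1 / complex_of_real t = of_real (1 / t)" by simp
      then show ?thesis using False D0bound[of "1 / t"] Ereal[of "1 / t"] by (simp add: f_def)
    qed (simp add: f_def)
    fix e :: real assume e: "e > 0"
    obtain d where d: "d > 0" "\<And>w. w \<in> uhp_closed \<Longrightarrow> Re w \<noteq> 0 \<and> cmod w < d \<Longrightarrow> cmod (D0 w) \<le> exp (e / \<bar>Re w\<bar>)"
      using small[OF e] by blast
    show "\<exists>R. \<forall>u. R \<le> cmod u \<and> Re u \<noteq> 0 \<longrightarrow> cmod (f u) \<le> exp (e * (cmod u)\<^sup>2 / \<bar>Re u\<bar>)"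
    proof (intro exI[of _ "2 / d"] allI impI)
      fix u assume u: "2 / d \<le> cmod u \<and> Re u \<noteq> 0"
      then have u0: "u \<noteq> 0" by auto
      have re: "Re (1 / u) = Re u / (cmod u)\<^sup>2" by (simp add: Re_divide cmod_power2)
      have rn: "Re (1 / u) \<noteq> 0" unfolding re using u u0 by simp
      have "cmod (1 / u) < d" using u d(1) u0 by (simp add: norm_divide field_simps)
      then have "cmod (E (1 / u)) \<le> exp (e / \<bar>Re (1 / u)\<bar>)"
        using u0 rn by (intro Bexp[OF e] d(2)) auto
      then show "cmod (f u) \<le> exp (e * (cmod u)\<^sup>2 / \<bar>Re u\<bar>)"
        using u0 unfolding re by (simp add: f_def)
    qed
  qed
  from this[of "of_real (1 / k)"] have "E (of_real k) = 0" using k by (simp add: f_def)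
  then show ?thesis using D0real[OF k] k by (simp add: Ereal)
qed

text \<open>As psi (- 1) is the conjugate of psi (1), the hypothesis says that \<rho> = u / y is
  real. The imaginary part of du cnj u is then \<rho>^2 times that of dy cnj y, and both equal 1, so
  \<rho>^2 = 1. Hence \<rho> is constant, and the normalisation at +infinity selects the value
  1.\<close>

lemma potentials_agree:
  assumes q: "integrable lebesgue q" and p: "integrable lebesgue p"
    and eq: "\<And>x. psi p (of_real (- 1)) x * psi q (of_real 1) x = psi q (of_real (- 1)) x * psi p (of_real 1) x"
  shows "AE x in lebesgue. q x = p x"
proof -
  have one: "complex_of_real 1 \<in> uhp_closed" "Re (complex_of_real 1) > 0" by (auto simp: uhp_closed_def)
  define y where "y = psi q (of_real 1)" define dy where "dy = dpsi q (of_real 1)"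
  define u where "u = psi p (of_real 1)" define du where "du = dpsi p (of_real 1)"
  have sy: "sol q 1 y dy" and su: "sol p 1 u du"
    using sol_psi[OF q one(1)] sol_psi[OF p one(1)] by (simp_all add: y_def dy_def u_def du_def)
  have cnj1: "psi r (of_real (- 1)) x = cnj (psi r (of_real 1) x)" "dpsi r (of_real (- 1)) x = cnj (dpsi r (of_real 1) x)"
    if "integrable lebesgue r" for r x
    using psi_cnj[OF that one(1), of x] by simp_all
  have wy: "Im (dy x * cnj (y x)) = 1" for x
    using arg_cong[OF wronskian_psi_real[OF q, of 1 x], of Im] cnj1[OF q, of x] by (simp add: y_def dy_def algebra_simps)
  have wu: "Im (du x * cnj (u x)) = 1" for x
    using arg_cong[OF wronskian_psi_real[OF p, of 1 x], of Im] cnj1[OF p, of x] by (simp add: u_def du_def algebra_simps)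
  have y0: "y x \<noteq> 0" for x using psi_nonzero[OF q one] by (simp add: y_def)
  have real_quot: "cnj (u x) * y x = cnj (y x) * u x" for x
    using eq[of x] unfolding cnj1(1)[OF q] cnj1(1)[OF p] by (simp add: y_def u_def)
  define \<rho> where "\<rho> = (\<lambda>x. u x * inverse (y x))"
  define \<rho>' where "\<rho>' = (\<lambda>x. (du x * y x - u x * dy x) / (y x)\<^sup>2)"
  have idy: "((\<lambda>x. inverse (y x)) has_vector_derivative dy x * - (inverse (y x) ^ 2)) (at x)" for x
  proof -
    have "(y has_vector_derivative dy x) (at x)" using sy by (simp add: sol_def)
    from field_vector_diff_chain_at[OF this DERIV_inverse[OF y0]] show ?thesis by (simp add: o_def numeral_2_eq_2)
  qed
  have d\<rho>: "(\<rho> has_vector_derivative \<rho>' x) (at x)" for x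
  proof -
    have "(u has_vector_derivative du x) (at x)" using su by (simp add: sol_def)
    from has_vector_derivative_mult[OF this idy[of x]] show ?thesis unfolding \<rho>_def
      by (rule has_vector_derivative_eq_rhs) (use y0[of x] in \<open>simp add: \<rho>'_def field_simps power2_eq_square\<close>)
  qed
  have u\<rho>: "u x = \<rho> x * y x" for x using y0[of x] by (simp add: \<rho>_def)
  have du\<rho>: "du x = \<rho>' x * y x + \<rho> x * dy x" for x
    using y0[of x] by (simp add: \<rho>_def \<rho>'_def field_simps power2_eq_square)
  have c\<rho>: "cnj (\<rho> x) = \<rho> x" for x
    using real_quot[of x] y0[of x] by (simp add: \<rho>_def field_simps)
  then have im\<rho>: "Im (\<rho> x) = 0" for x by (metis Reals_cnj_iff complex_is_Real_iff)
  have im\<rho>': "Im (\<rho>' x) = 0" for x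
  proof -
    have "((\<lambda>x. Im (\<rho> x)) has_vector_derivative Im (\<rho>' x)) (at x)"
      by (rule bounded_linear.has_vector_derivative[OF bounded_linear_Im d\<rho>])
    then have "((\<lambda>x. 0) has_vector_derivative Im (\<rho>' x)) (at x)" by (simp only: im\<rho>)
    then show ?thesis using vector_derivative_unique_at has_vector_derivative_const by blast
  qed
  \<comment> \<open>The term with \<rho>' is real, being \<rho>' \<rho> |y|^2, and disappears from
    the imaginary part.\<close>
  have sq: "\<rho> x * \<rho> x = 1" for x
  proof -
    have "du x * cnj (u x) = (\<rho>' x * \<rho> x) * (y x * cnj (y x)) + (\<rho> x * \<rho> x) * (dy x * cnj (y x))"
      unfolding du\<rho> u\<rho> by (simp add: c\<rho> algebra_simps)
    from wu[of x, unfolded this] have "1 = Im ((\<rho>' x * \<rho> x) * (y x * cnj (y x)) + (\<rho> x * \<rho> x) * (dy x * cnj (y x)))"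
      by (rule sym)
    also have "\<dots> = Re (\<rho> x * \<rho> x) * Im (dy x * cnj (y x))"
      unfolding plus_complex.sel times_complex.sel(2)[of "\<rho>' x * \<rho> x"] times_complex.sel(2)[of "\<rho> x * \<rho> x"]
      by (simp add: im\<rho> im\<rho>' complex_norm_square[symmetric])
    finally have "Re (\<rho> x * \<rho> x) = 1" unfolding wy by simp
    then show ?thesis by (simp add: complex_eq_iff im\<rho>)
  qed
  have "\<rho>' x = 0" for x
  proof -
    have "((\<lambda>x. \<rho> x * \<rho> x) has_vector_derivative \<rho> x * \<rho>' x + \<rho>' x * \<rho> x) (at x)"
      by (rule has_vector_derivative_mult[OF d\<rho> d\<rho>])
    then have "((\<lambda>x. 1) has_vector_derivative \<rho> x * \<rho>' x + \<rho>' x * \<rho> x) (at x)" by (simp only: sq)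
    then have "\<rho> x * \<rho>' x + \<rho>' x * \<rho> x = 0" using vector_derivative_unique_at has_vector_derivative_const by blast
    then have "2 * (\<rho> x * \<rho>' x) = 0" by (simp add: mult.commute)
    moreover have "\<rho> x \<noteq> 0" using sq[of x] by auto
    ultimately show ?thesis by simp
  qed
  then have "loc_abs_cont_deriv \<rho> (\<lambda>x. 0)"
    using d\<rho> by (intro lac_C1) auto
  then have const: "\<rho> x = \<rho> t" for x t by (rule lac_zero_const) simp
  have "((\<lambda>x. jost_mod p 1 x / jost_mod q 1 x) \<longlongrightarrow> 1 / 1) at_top"
    by (intro tendsto_divide jost_mod_tendsto) (use q p one in auto)
  moreover have "jost_mod p 1 x / jost_mod q 1 x = \<rho> x" for x
    by (simp add: \<rho>_def y_def u_def psi_def divide_inverse)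
  ultimately have "(\<rho> \<longlongrightarrow> 1) at_top" by simp
  moreover have "(\<rho> \<longlongrightarrow> \<rho> x) at_top" for x
    by (rule tendsto_eventually, rule always_eventually) (use const in blast)
  ultimately have "\<rho> x = 1" for x using tendsto_unique[OF trivial_limit_at_top_linorder] by blast
  then have uy: "u = y" using u\<rho> by (intro ext) simp
  have "du x = dy x" for x
  proof -
    have "(y has_vector_derivative dy x) (at x)" "(y has_vector_derivative du x) (at x)"
      using sy su uy by (simp_all add: sol_def)
    then show ?thesis by (rule vector_derivative_unique_at[symmetric])
  qed
  then have duy: "du = dy" by (intro ext)
  have l1: "loc_abs_cont_deriv dy (\<lambda>x. (of_real (q x) - 1\<^sup>2) * y x)" and l2: "loc_abs_cont_deriv dy (\<lambda>x. (of_real (p x) - 1\<^sup>2) * y x)"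
    using sy su uy duy by (simp_all add: sol_def)
  have ciy: "continuous_on UNIV (\<lambda>x. dy x * - (inverse (y x) ^ 2))"
    by (intro continuous_intros sol_continuous[OF sy]) (use y0 in auto)
  \<comment> \<open>The difference of the two equations makes (q - p) y a derivative of dy - dy = 0.
    The product rule with 1 / y removes the factor y and leaves a derivative of 0.\<close>
  have "loc_abs_cont_deriv (\<lambda>x. 0) (\<lambda>x. complex_of_real (q x - p x))"
    by (rule lac_transform[OF lac_mult[OF lac_diff[OF l1 l2] lac_C1[OF idy ciy]]])
       (use y0 in \<open>simp_all add: left_diff_distrib[symmetric]\<close>)
  then have H: "((\<lambda>x. complex_of_real (q x - p x)) has_integral 0) {a..b}" if "a \<le> b" for a b
    using that by (auto simp: loc_abs_cont_deriv_def)
  have HR: "((\<lambda>x. q x - p x) has_integral 0) {a..b}" if "a \<le> b" for a b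
    using has_integral_linear[OF H[OF that] bounded_linear_Re] by (simp add: o_def)
  have "AE x in lebesgue. q x - p x = 0"
  proof (rule AE_zero_if_interval_integrals_zero)
    show "(\<lambda>x. q x - p x) integrable_on {a..b}" for a b
      using HR[of a b] by (cases "a \<le> b") (auto intro: has_integral_integrable)
    show "integral {a..b} (\<lambda>x. q x - p x) = 0" if "a \<le> b" for a b
      using HR[OF that] by (rule integral_unique)
  qed
  then show ?thesis by eventually_elim simp
qed

theorem theorem5p1:
  fixes q q' :: "real \<Rightarrow> real" and N :: enat and \<kappa> m :: "nat \<Rightarrow> real"
  assumes "q \<in> Q1" and "q' \<in> Q1"
    and "reflectionless q" and "reflectionless q'"
    and "has_spectral_data q N \<kappa> m" and "has_spectral_data q' N \<kappa> m"
  shows "AE x in lebesgue. q x = q' x"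
proof -
  have q: "integrable lebesgue q" and q': "integrable lebesgue q'" using assms(1,2) by (auto simp: Q1_def)
  \<comment> \<open>A zero of a gives an eigenvalue, hence lies at some i \<kappa> n; conversely
    each prescribed norming constant forces a zero there. In this way the common spectral data give
    both potentials the same zeros of a.\<close>
  have nor: "\<exists>n. enat n < N \<and> z = \<i> * of_real (\<kappa> n)"
    if r: "integrable lebesgue r" "has_spectral_data r N \<kappa> m" and z: "z \<in> uhp" "jost_a r z = 0" for r z
  proof -
    have "- (Im z)\<^sup>2 \<in> {- (\<kappa> n)\<^sup>2 | n. enat n < N}"
      using jost_a_zero_eigenvalue[OF r(1) z] r(2) by (simp add: has_spectral_data_def)
    then obtain n where n: "enat n < N" "(Im z)\<^sup>2 = (\<kappa> n)\<^sup>2" by auto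
    have "\<kappa> n > 0" using n(1) r(2) by (simp add: has_spectral_data_def)
    then have "Im z = \<kappa> n" using n(2) z(1) by (simp add: uhp_def power2_eq_iff_nonneg)
    then show ?thesis using n(1) jost_a_zero_imaginary[OF r(1) z] by (auto simp: complex_eq_iff)
  qed
  have data: "\<kappa> n > 0" "is_norming_constant q (\<kappa> n) (m n)" "is_norming_constant q' (\<kappa> n) (m n)" if "enat n < N" for n
    using assms(5,6) that by (auto simp: has_spectral_data_def)
  have "psi q' (of_real (- 1)) x * psi q (of_real 1) x = psi q (of_real (- 1)) x * psi q' (of_real 1) x" for x
  proof (rule antisymmetrised_jost_zero[OF q q' assms(3,4)])
    fix z assume z: "z \<in> uhp"
    show "jost_a q z = 0 \<longleftrightarrow> jost_a q' z = 0"
    proof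
      assume "jost_a q z = 0"
      then obtain n where n: "enat n < N" "z = \<i> * of_real (\<kappa> n)" using nor[OF q assms(5) z] by blast
      then show "jost_a q' z = 0" using norming_constant_imp_zero(1)[OF q'] data[OF n(1)] by blast
    next
      assume "jost_a q' z = 0"
      then obtain n where n: "enat n < N" "z = \<i> * of_real (\<kappa> n)" using nor[OF q' assms(6) z] by blast
      then show "jost_a q z = 0" using norming_constant_imp_zero(1)[OF q] data[OF n(1)] by blast
    qed
    assume "jost_a q z = 0"
    then show "\<exists>k m. k > 0 \<and> z = \<i> * of_real k \<and> is_norming_constant q k m \<and> is_norming_constant q' k m"
      using nor[OF q assms(5) z] data by metis
  qed simp
  then show ?thesis by (rule potentials_agree[OF q q'])
qed

end
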